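(* Let $G$ be a locally compact group and let $S^1(G)$ be a Segal algebra in $L^1(G)$. If $S^1(G)$ is pseudo-amenable, then $G$ is amenable.
   Context: A Segal algebra $S^1(G)$ in $L^1(G)$ is a dense subspace of the convolution algebra $L^1(G)$ which is a left ideal of $L^1(G)$, is complete under a norm $\|\cdot\|_{S^1}$ for which it is a contractive left $L^1(G)$-module ($\|f*g\|_{S^1}\le\|f\|_1\|g\|_{S^1}$) that is essential ($L^1(G)*S^1(G)$ is $\|\cdot\|_{S^1}$-dense), is contractively embedded in $L^1(G)$ ($\|f\|_1\le\|f\|_{S^1}$), and is closed under left translations $L_xf(y)=f(x^{-1}y)$, with $(x,f)\mapsto L_xf:G\times S^1(G)\to S^1(G)$ continuous and $\|L_xf\|_{S^1}=\|f\|_{S^1}$. It is a Banach algebra under convolution. A Banach algebra $A$ is pseudo-amenable if there is a (not necessarily bounded) net $(m_\alpha)$ in the projective tensor product $A\widehat{\otimes}A$ with $a\cdot m_\alpha-m_\alpha\cdot a\to0$ and $\pi(m_\alpha)a\to a$ in norm for all $a\in A$, where $a\cdot(b\otimes c)=(ab)\otimes c$, $(b\otimes c)\cdot a=b\otimes(ca)$, and $\pi(b\otimes c)=bc$. *)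

theory Defs
  imports "HOL-Analysis.Analysis" "HOL-Algebra.Module" "HOL-Algebra.Algebraic_Closure_Type"
begin

no_notation Polynomials.var ("X\<index>") \<comment> \<open>frees \<open>X\<close> for use as a variable\<close>

section \<open>Normed spaces and Banach algebras over the complex numbers\<close>

text \<open>
  Spaces are given by an explicit carrier, since \<open>L\<^sup>1(G)\<close> depends on a Haar measure and a Segal
  algebra is a subset of it. The record inherits the fields \<open>mult\<close> and \<open>one\<close> from rings. The field
  \<open>mult\<close> is the product of an algebra; \<open>one\<close> is never used (the algebras here need not be unital),
  and fields that carry no structure are left \<open>undefined\<close>.
\<close>

record 'b normed_space = "(complex, 'b) module" +
  vnorm :: "'b \<Rightarrow> real"

abbreviation complex_field :: "complex ring" where
  "complex_field \<equiv> ring_of_type_algebra"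

text \<open>The value off the carrier only serves to satisfy the axioms of \<^locale>\<open>Metric_space\<close>.\<close>

definition ndist :: "('b, 'm) normed_space_scheme \<Rightarrow> 'b \<Rightarrow> 'b \<Rightarrow> real" where
  "ndist V x y = (if x \<in> carrier V \<and> y \<in> carrier V then vnorm V (x \<ominus>\<^bsub>V\<^esub> y) else 0)"

definition ntopology :: "('b, 'm) normed_space_scheme \<Rightarrow> 'b topology" where
  "ntopology V = Metric_space.mtopology (carrier V) (ndist V)"

definition lin_span :: "('b, 'm) normed_space_scheme \<Rightarrow> 'b set \<Rightarrow> 'b set" where
  "lin_span V X = \<Inter>{W. submodule W complex_field V \<and> X \<subseteq> W}"

locale normed_space = module complex_field V
  for V :: "('b, 'm) normed_space_scheme" (structure) +
  assumes vnorm_eq_0: "x \<in> carrier V \<Longrightarrow> vnorm V x = 0 \<longleftrightarrow> x = \<zero>"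
    and vnorm_add: "\<lbrakk>x \<in> carrier V; y \<in> carrier V\<rbrakk> \<Longrightarrow> vnorm V (x \<oplus> y) \<le> vnorm V x + vnorm V y"
    and vnorm_smult: "x \<in> carrier V \<Longrightarrow> vnorm V (c \<odot> x) = cmod c * vnorm V x"

locale banach_space = normed_space V for V :: "('b, 'm) normed_space_scheme" (structure) +
  assumes complete: "Metric_space.mcomplete (carrier V) (ndist V)"

locale banach_algebra = banach_space A for A :: "('b, 'm) normed_space_scheme" (structure) +
  assumes mult_closed: "\<lbrakk>x \<in> carrier A; y \<in> carrier A\<rbrakk> \<Longrightarrow> x \<otimes> y \<in> carrier A"
    and mult_assoc: "\<lbrakk>x \<in> carrier A; y \<in> carrier A; z \<in> carrier A\<rbrakk> \<Longrightarrow> (x \<otimes> y) \<otimes> z = x \<otimes> (y \<otimes> z)"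
    and mult_distr_l: "\<lbrakk>x \<in> carrier A; y \<in> carrier A; z \<in> carrier A\<rbrakk> \<Longrightarrow> (x \<oplus> y) \<otimes> z = x \<otimes> z \<oplus> y \<otimes> z"
    and mult_distr_r: "\<lbrakk>x \<in> carrier A; y \<in> carrier A; z \<in> carrier A\<rbrakk> \<Longrightarrow> z \<otimes> (x \<oplus> y) = z \<otimes> x \<oplus> z \<otimes> y"
    and mult_smult_l: "\<lbrakk>x \<in> carrier A; y \<in> carrier A\<rbrakk> \<Longrightarrow> (c \<odot> x) \<otimes> y = c \<odot> (x \<otimes> y)"
    and mult_smult_r: "\<lbrakk>x \<in> carrier A; y \<in> carrier A\<rbrakk> \<Longrightarrow> x \<otimes> (c \<odot> y) = c \<odot> (x \<otimes> y)"
    and vnorm_mult: "\<lbrakk>x \<in> carrier A; y \<in> carrier A\<rbrakk> \<Longrightarrow> vnorm A (x \<otimes> y) \<le> vnorm A x * vnorm A y"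


section \<open>Completion of a normed space\<close>

definition cauchy_seqs :: "('b, 'm) normed_space_scheme \<Rightarrow> (nat \<Rightarrow> 'b) set" where
  "cauchy_seqs V = {s. Metric_space.MCauchy (carrier V) (ndist V) s}"

definition null_rel :: "('b, 'm) normed_space_scheme \<Rightarrow> ((nat \<Rightarrow> 'b) \<times> (nat \<Rightarrow> 'b)) set" where
  "null_rel V = {(s, t). s \<in> cauchy_seqs V \<and> t \<in> cauchy_seqs V \<and>
                         (\<lambda>n. vnorm V (s n \<ominus>\<^bsub>V\<^esub> t n)) \<longlonglongrightarrow> 0}"

text \<open>Operations on classes, here and below, act on a chosen representative of the class.\<close>

definition rep :: "'c set \<Rightarrow> 'c" where
  "rep X = (SOME x. x \<in> X)"

definition completion :: "('b, 'm) normed_space_scheme \<Rightarrow> (nat \<Rightarrow> 'b) set normed_space" where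
  "completion V = \<lparr>
     carrier = cauchy_seqs V // null_rel V,
     mult = undefined,
     one = undefined,
     zero = null_rel V `` {\<lambda>n. \<zero>\<^bsub>V\<^esub>},
     add = (\<lambda>X Y. null_rel V `` {\<lambda>n. rep X n \<oplus>\<^bsub>V\<^esub> rep Y n}),
     smult = (\<lambda>c X. null_rel V `` {\<lambda>n. c \<odot>\<^bsub>V\<^esub> rep X n}),
     vnorm = (\<lambda>X. lim (\<lambda>n. vnorm V (rep X n)))\<rparr>"

text \<open>Extension by continuity to the completion of a bounded linear map from \<open>V\<close> to itself, and
  of one from \<open>V\<close> to a Banach space \<open>B\<close>.\<close>

definition extend_endo ::
  "('b, 'm) normed_space_scheme \<Rightarrow> ('b \<Rightarrow> 'b) \<Rightarrow> (nat \<Rightarrow> 'b) set \<Rightarrow> (nat \<Rightarrow> 'b) set" where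
  "extend_endo V f X = null_rel V `` {\<lambda>n. f (rep X n)}"

definition extend_into ::
  "('c, 'n) normed_space_scheme \<Rightarrow> ('b \<Rightarrow> 'c) \<Rightarrow> (nat \<Rightarrow> 'b) set \<Rightarrow> 'c" where
  "extend_into B f X = (THE y. limitin (ntopology B) (\<lambda>n. f (rep X n)) y sequentially)"


section \<open>The projective tensor product\<close>

definition bilinear_form :: "('b, 'm) normed_space_scheme \<Rightarrow> ('b \<Rightarrow> 'b \<Rightarrow> complex) \<Rightarrow> bool" where
  "bilinear_form A \<phi> \<longleftrightarrow>
     (\<forall>x\<in>carrier A. \<forall>y\<in>carrier A. \<forall>z\<in>carrier A. \<forall>c.
        \<phi> (x \<oplus>\<^bsub>A\<^esub> y) z = \<phi> x z + \<phi> y z \<and> \<phi> z (x \<oplus>\<^bsub>A\<^esub> y) = \<phi> z x + \<phi> z y \<and>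
        \<phi> (c \<odot>\<^bsub>A\<^esub> x) z = c * \<phi> x z \<and> \<phi> z (c \<odot>\<^bsub>A\<^esub> x) = c * \<phi> z x)"

text \<open>
  The algebraic tensor product \<open>A \<otimes> A\<close> is realised as a space of functionals on the space of all
  (not necessarily bounded) bilinear forms: \<open>b \<otimes> c\<close> is evaluation at \<open>(b, c)\<close>. A list of pairs is
  a formal sum \<open>b\<^sub>1 \<otimes> c\<^sub>1 + \<dots> + b\<^sub>n \<otimes> c\<^sub>n\<close>; scalars are absorbed in the first factor.
\<close>

type_synonym 'b tensor = "('b \<Rightarrow> 'b \<Rightarrow> complex) \<Rightarrow> complex"

definition formal_sums :: "('b, 'm) normed_space_scheme \<Rightarrow> ('b \<times> 'b) list set" where
  "formal_sums A = lists (carrier A \<times> carrier A)"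

definition tens :: "('b, 'm) normed_space_scheme \<Rightarrow> ('b \<times> 'b) list \<Rightarrow> 'b tensor" where
  "tens A xs = (\<lambda>\<phi>. if bilinear_form A \<phi> then \<Sum>(b, c)\<leftarrow>xs. \<phi> b c else 0)"

text \<open>\<open>A \<otimes> A\<close> with the projective norm.\<close>

definition alg_tensor :: "('b, 'm) normed_space_scheme \<Rightarrow> 'b tensor normed_space" where
  "alg_tensor A = \<lparr>
     carrier = tens A ` formal_sums A,
     mult = undefined,
     one = undefined,
     zero = (\<lambda>\<phi>. 0),
     add = (\<lambda>u v \<phi>. u \<phi> + v \<phi>),
     smult = (\<lambda>k u \<phi>. k * u \<phi>),
     vnorm = (\<lambda>u. Inf {\<Sum>(b, c)\<leftarrow>xs. vnorm A b * vnorm A c | xs. xs \<in> formal_sums A \<and> tens A xs = u})\<rparr>"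

definition some_sum :: "('b, 'm) normed_space_scheme \<Rightarrow> 'b tensor \<Rightarrow> ('b \<times> 'b) list" where
  "some_sum A u = (SOME xs. xs \<in> formal_sums A \<and> tens A xs = u)"

definition lact_alg :: "('b, 'm) normed_space_scheme \<Rightarrow> 'b \<Rightarrow> 'b tensor \<Rightarrow> 'b tensor" where
  "lact_alg A a u = tens A (map (\<lambda>(b, c). (a \<otimes>\<^bsub>A\<^esub> b, c)) (some_sum A u))"

definition ract_alg :: "('b, 'm) normed_space_scheme \<Rightarrow> 'b tensor \<Rightarrow> 'b \<Rightarrow> 'b tensor" where
  "ract_alg A u a = tens A (map (\<lambda>(b, c). (b, c \<otimes>\<^bsub>A\<^esub> a)) (some_sum A u))"

definition prod_alg :: "('b, 'm) normed_space_scheme \<Rightarrow> 'b tensor \<Rightarrow> 'b" where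
  "prod_alg A u = foldr (\<lambda>(b, c) s. (b \<otimes>\<^bsub>A\<^esub> c) \<oplus>\<^bsub>A\<^esub> s) (some_sum A u) \<zero>\<^bsub>A\<^esub>"

type_synonym 'b ptensor = "(nat \<Rightarrow> 'b tensor) set"

definition proj_tensor :: "('b, 'm) normed_space_scheme \<Rightarrow> 'b ptensor normed_space" where
  "proj_tensor A = completion (alg_tensor A)"

definition lact :: "('b, 'm) normed_space_scheme \<Rightarrow> 'b \<Rightarrow> 'b ptensor \<Rightarrow> 'b ptensor" where
  "lact A a = extend_endo (alg_tensor A) (lact_alg A a)"

definition ract :: "('b, 'm) normed_space_scheme \<Rightarrow> 'b ptensor \<Rightarrow> 'b \<Rightarrow> 'b ptensor" where
  "ract A m a = extend_endo (alg_tensor A) (\<lambda>u. ract_alg A u a) m"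

definition prod_map :: "('b, 'm) normed_space_scheme \<Rightarrow> 'b ptensor \<Rightarrow> 'b" where
  "prod_map A = extend_into A (prod_alg A)"


section \<open>Pseudo-amenability\<close>

text \<open>
  A net in the projective tensor product is given by its filter of tails: a net \<open>(m\<^sub>\<alpha>)\<close> yields the
  proper filter of all sets that eventually contain \<open>m\<^sub>\<alpha>\<close>, and each proper filter arises from a
  net in this way. Convergence along the net is convergence along the filter. This avoids a
  quantification over the type of the index set.
\<close>

definition (in banach_algebra) pseudo_amenable :: bool where
  "pseudo_amenable \<longleftrightarrow>
     (\<exists>F :: 'b ptensor filter. F \<noteq> bot \<and>
        (\<forall>\<^sub>F m in F. m \<in> carrier (proj_tensor A)) \<and>
        (\<forall>a\<in>carrier A.
           ((\<lambda>m. vnorm (proj_tensor A) (lact A a m \<ominus>\<^bsub>proj_tensor A\<^esub> ract A m a)) \<longlongrightarrow> 0) F \<and>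
           ((\<lambda>m. vnorm A (prod_map A m \<otimes> a \<ominus> a)) \<longlongrightarrow> 0) F))"


section \<open>Locally compact groups and Haar measure\<close>

locale locally_compact_group = group G for G :: "('a, 'g) monoid_scheme" (structure) +
  fixes T :: "'a topology"
  assumes topspace_eq: "topspace T = carrier G"
    and continuous_mult: "continuous_map (prod_topology T T) T (\<lambda>(x, y). x \<otimes> y)"
    and continuous_inv: "continuous_map T T (\<lambda>x. inv x)"
    and hausdorff: "Hausdorff_space T"
    and locally_compact: "locally_compact_space T"

text \<open>
  A left Haar measure is a nonzero left-invariant Radon measure on the Borel sets; Radon means
  finite on compact sets, outer regular on Borel sets and inner regular on open sets.
\<close>

locale left_haar_measure = locally_compact_group G T
  for G :: "('a, 'g) monoid_scheme" (structure) and T :: "'a topology" +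
  fixes \<mu> :: "'a measure"
  assumes space_haar: "space \<mu> = carrier G"
    and sets_haar: "sets \<mu> = sigma_sets (carrier G) {U. openin T U}"
    and nonzero: "emeasure \<mu> (carrier G) \<noteq> 0"
    and finite_compact: "compactin T K \<Longrightarrow> K \<in> sets \<mu> \<Longrightarrow> emeasure \<mu> K < \<infinity>"
    and outer_regular: "E \<in> sets \<mu> \<Longrightarrow> emeasure \<mu> E = (INF U \<in> {U. openin T U \<and> E \<subseteq> U}. emeasure \<mu> U)"
    and inner_regular: "openin T U \<Longrightarrow> emeasure \<mu> U = (SUP K \<in> {K. compactin T K \<and> K \<subseteq> U}. emeasure \<mu> K)"
    and left_invariant: "x \<in> carrier G \<Longrightarrow> E \<in> sets \<mu> \<Longrightarrow> emeasure \<mu> ((\<lambda>y. x \<otimes> y) ` E) = emeasure \<mu> E"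

definition ltrans :: "('a, 'g) monoid_scheme \<Rightarrow> 'a \<Rightarrow> ('a \<Rightarrow> complex) \<Rightarrow> 'a \<Rightarrow> complex" where
  "ltrans G x f = (\<lambda>y. f (inv\<^bsub>G\<^esub> x \<otimes>\<^bsub>G\<^esub> y))"


section \<open>Amenability\<close>

text \<open>
  Since \<open>\<mu>\<close> need not be \<open>\<sigma>\<close>-finite, \<open>L\<^sup>\<infinity>(G)\<close> consists of the locally measurable functions that
  are bounded locally almost everywhere, and exceptional sets are locally null.
\<close>

definition loc_AE :: "'a measure \<Rightarrow> ('a \<Rightarrow> bool) \<Rightarrow> bool" where
  "loc_AE \<mu> P \<longleftrightarrow> (\<forall>E\<in>fmeasurable \<mu>. AE x in \<mu>. x \<in> E \<longrightarrow> P x)"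

definition Linf :: "'a measure \<Rightarrow> ('a \<Rightarrow> complex) set" where
  "Linf \<mu> = {f. (\<forall>E\<in>fmeasurable \<mu>. f \<in> borel_measurable (restrict_space \<mu> E)) \<and>
                (\<exists>C. loc_AE \<mu> (\<lambda>x. cmod (f x) \<le> C))}"

definition Linf_norm :: "'a measure \<Rightarrow> ('a \<Rightarrow> complex) \<Rightarrow> real" where
  "Linf_norm \<mu> f = Inf {C. 0 \<le> C \<and> loc_AE \<mu> (\<lambda>x. cmod (f x) \<le> C)}"

text \<open>
  A mean is a linear functional \<open>\<Lambda>\<close> on \<open>L\<^sup>\<infinity>(G)\<close> with \<open>\<parallel>\<Lambda>\<parallel> = \<Lambda> 1 = 1\<close>. The norm bound forces \<open>\<Lambda>\<close> to
  agree on functions that are equal locally almost everywhere, so \<open>\<Lambda>\<close> may be taken on functions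
  instead of classes.
\<close>

definition mean :: "'a measure \<Rightarrow> (('a \<Rightarrow> complex) \<Rightarrow> complex) \<Rightarrow> bool" where
  "mean \<mu> \<Lambda> \<longleftrightarrow>
     (\<forall>f\<in>Linf \<mu>. \<forall>g\<in>Linf \<mu>. \<Lambda> (\<lambda>x. f x + g x) = \<Lambda> f + \<Lambda> g) \<and>
     (\<forall>f\<in>Linf \<mu>. \<forall>c. \<Lambda> (\<lambda>x. c * f x) = c * \<Lambda> f) \<and>
     (\<forall>f\<in>Linf \<mu>. cmod (\<Lambda> f) \<le> Linf_norm \<mu> f) \<and>
     \<Lambda> (\<lambda>x. 1) = 1"

definition (in left_haar_measure) amenable :: bool where
  "amenable \<longleftrightarrow> (\<exists>\<Lambda>. mean \<mu> \<Lambda> \<and> (\<forall>x\<in>carrier G. \<forall>f\<in>Linf \<mu>. \<Lambda> (ltrans G x f) = \<Lambda> f))"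


section \<open>The group algebra and Segal algebras\<close>

definition ae_rel :: "'a measure \<Rightarrow> (('a \<Rightarrow> complex) \<times> ('a \<Rightarrow> complex)) set" where
  "ae_rel \<mu> = {(f, g). integrable \<mu> f \<and> integrable \<mu> g \<and> (AE x in \<mu>. f x = g x)}"

definition convolution ::
  "('a, 'g) monoid_scheme \<Rightarrow> 'a measure \<Rightarrow> ('a \<Rightarrow> complex) \<Rightarrow> ('a \<Rightarrow> complex) \<Rightarrow> 'a \<Rightarrow> complex" where
  "convolution G \<mu> f g = (\<lambda>x. \<integral>y. f y * g (inv\<^bsub>G\<^esub> y \<otimes>\<^bsub>G\<^esub> x) \<partial>\<mu>)"

definition L1 :: "('a, 'g) monoid_scheme \<Rightarrow> 'a measure \<Rightarrow> ('a \<Rightarrow> complex) set normed_space" where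
  "L1 G \<mu> = \<lparr>
     carrier = {f. integrable \<mu> f} // ae_rel \<mu>,
     mult = (\<lambda>X Y. ae_rel \<mu> `` {convolution G \<mu> (rep X) (rep Y)}),
     one = undefined,
     zero = ae_rel \<mu> `` {\<lambda>x. 0},
     add = (\<lambda>X Y. ae_rel \<mu> `` {\<lambda>x. rep X x + rep Y x}),
     smult = (\<lambda>c X. ae_rel \<mu> `` {\<lambda>x. c * rep X x}),
     vnorm = (\<lambda>X. \<integral>x. cmod (rep X x) \<partial>\<mu>)\<rparr>"

definition L1_ltrans ::
  "('a, 'g) monoid_scheme \<Rightarrow> 'a measure \<Rightarrow> 'a \<Rightarrow> ('a \<Rightarrow> complex) set \<Rightarrow> ('a \<Rightarrow> complex) set" where
  "L1_ltrans G \<mu> x X = ae_rel \<mu> `` {ltrans G x (rep X)}"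

text \<open>The subset \<open>S\<close> of \<open>L\<^sup>1(G)\<close> with the operations of \<open>L\<^sup>1(G)\<close> and the norm \<open>N\<close>.\<close>

definition L1_sub ::
  "('a, 'g) monoid_scheme \<Rightarrow> 'a measure \<Rightarrow> ('a \<Rightarrow> complex) set set \<Rightarrow> (('a \<Rightarrow> complex) set \<Rightarrow> real) \<Rightarrow>
   ('a \<Rightarrow> complex) set normed_space" where
  "L1_sub G \<mu> S N = (L1 G \<mu>)\<lparr>carrier := S, vnorm := N\<rparr>"

locale segal_algebra = left_haar_measure G T \<mu>
  for G :: "('a, 'g) monoid_scheme" (structure) and T :: "'a topology" and \<mu> :: "'a measure" +
  fixes S :: "('a \<Rightarrow> complex) set set" and N :: "('a \<Rightarrow> complex) set \<Rightarrow> real"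
  assumes subspace: "submodule S complex_field (L1 G \<mu>)"
    and dense: "ntopology (L1 G \<mu>) closure_of S = carrier (L1 G \<mu>)"
    and left_ideal: "\<lbrakk>f \<in> carrier (L1 G \<mu>); g \<in> S\<rbrakk> \<Longrightarrow> f \<otimes>\<^bsub>L1 G \<mu>\<^esub> g \<in> S"
    and banach: "banach_space (L1_sub G \<mu> S N)"
    and contractive_module:
      "\<lbrakk>f \<in> carrier (L1 G \<mu>); g \<in> S\<rbrakk> \<Longrightarrow> N (f \<otimes>\<^bsub>L1 G \<mu>\<^esub> g) \<le> vnorm (L1 G \<mu>) f * N g"
    and essential:
      "ntopology (L1_sub G \<mu> S N) closure_of
         lin_span (L1_sub G \<mu> S N) {f \<otimes>\<^bsub>L1 G \<mu>\<^esub> g | f g. f \<in> carrier (L1 G \<mu>) \<and> g \<in> S} = S"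
    and contractive_embedding: "f \<in> S \<Longrightarrow> vnorm (L1 G \<mu>) f \<le> N f"
    and translation_closed: "\<lbrakk>x \<in> carrier G; f \<in> S\<rbrakk> \<Longrightarrow> L1_ltrans G \<mu> x f \<in> S"
    and translation_continuous:
      "continuous_map (prod_topology T (ntopology (L1_sub G \<mu> S N))) (ntopology (L1_sub G \<mu> S N))
         (\<lambda>(x, f). L1_ltrans G \<mu> x f)"
    and translation_isometric: "\<lbrakk>x \<in> carrier G; f \<in> S\<rbrakk> \<Longrightarrow> N (L1_ltrans G \<mu> x f) = N f"

end

theory Submission
  imports Defs
begin

text \<open>
  Write \<open>aug f = \<integral> f\<close>, a character of \<open>L\<^sup>1(G)\<close>. Applying \<open>b \<otimes> c \<mapsto> aug c \<cdot> b\<close> to an approximate diagonal of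
  \<open>S\<^sup>1(G)\<close> gives \<open>n\<close> in \<open>S\<^sup>1(G)\<close> with \<open>a * n - aug a \<cdot> n \<rightarrow> 0\<close> in \<open>L\<^sup>1\<close> for each \<open>a\<close> and \<open>aug n \<rightarrow> 1\<close>. Fix \<open>a\<close> with
  \<open>aug a \<noteq> 0\<close> and put \<open>g = a * n\<close>. As the translates of \<open>a\<close> have the same integral,
  \<open>L\<^sub>x g - g = (L\<^sub>x a) * n - a * n \<rightarrow> 0\<close>, while \<open>\<parallel>g\<parallel>\<^sub>1\<close> stays away from 0. No bound on the \<open>n\<close> is needed: the
  normalised \<open>\<bar>g\<bar> / \<parallel>g\<parallel>\<^sub>1\<close> satisfy Reiter's condition, and a cluster point of them is an invariant mean.

  Convolution requires Fubini's theorem, which the library only offers for \<open>\<sigma>\<close>-finite measures and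
  product \<open>\<sigma>\<close>-algebras. It is derived from the Radon property of \<open>\<mu>\<close>, for Borel functions on \<open>G \<times> G\<close> that
  live on a countable union of sets \<open>{(y, x). y \<in> U \<and> y\<inverse> x \<in> V}\<close> with \<open>\<mu> U\<close> and \<open>\<mu> V\<close> finite.
\<close>

section \<open>Tonelli's theorem for Borel sets of the product\<close>

text \<open>The slice map works because \<open>aug\<close> is multiplicative: it turns the right
  action of \<open>a\<close> into multiplication by the number \<open>aug a\<close>, and
  \<open>aug\<close> of the slice of \<open>m\<close> equals \<open>aug\<close> of the product of
  \<open>m\<close>. Hence the first condition of pseudo-amenability gives almost invariance and the
  second one \<open>aug n \<rightarrow> 1\<close>. Only finitely many \<open>a\<close> matter at a
  time, namely one element and its translates by a finite set, so the filter can be traded for a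
  single formal sum; the Segal norm enters through its domination of the norm of
  \<open>L\<^sup>1(G)\<close>. The obstacle is the projective norm. Tensors are equal when all
  bilinear forms agree on them, bounded or not, while a small projective norm only controls bounded
  forms. The functionals that integrate over a Borel set are bounded and separate points, and a
  purely algebraic reduction of formal sums shows that products of two such functionals already
  decide equality.\<close>

lemma nn_integral_layer_less:
  fixes h :: "'a \<Rightarrow> ennreal"
  assumes h [measurable]: "h \<in> borel_measurable M" and c: "c < (\<integral>\<^sup>+x. h x \<partial>M)"
  shows "\<exists>n>0. \<exists>N. c < (\<Sum>k=1..N. ennreal (1 / real n) * emeasure M {x \<in> space M. ennreal (real k / real n) < h x})"
proof -
  \<comment> \<open>Riemann sums of the layer-cake formula with mesh \<open>1/n\<close>, cut off at
    height \<open>n\<close> so that they are finite. They are not monotone in \<open>n\<close>,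
    hence Fatou's lemma below instead of monotone convergence.\<close>
  define s where "s n x = (\<Sum>k=1..n*n. ennreal (1 / real n) * indicator {x \<in> space M. ennreal (real k / real n) < h x} x)"
    for n :: nat and x
  have s_meas [measurable]: "s n \<in> borel_measurable M" for n
    unfolding s_def by measurable
  have int_s: "(\<integral>\<^sup>+x. s n x \<partial>M) =
      (\<Sum>k=1..n*n. ennreal (1 / real n) * emeasure M {x \<in> space M. ennreal (real k / real n) < h x})" for n
    unfolding s_def by (subst nn_integral_sum; simp add: nn_integral_cmult)
  have "h x \<le> liminf (\<lambda>n. s n x)" if x: "x \<in> space M" for x
    unfolding le_Liminf_iff
  proof (intro allI impI)
    fix t :: ennreal assume "t < h x"
    then obtain u where u: "t < u" "u < h x" using dense by blast
    define r where "r = enn2real u"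
    define q where "q = enn2real t"
    have "u < \<infinity>" using u(2) by (rule order_less_le_trans) simp
    then have ur: "u = ennreal r" by (simp add: r_def)
    have "t < \<infinity>" using u(1) \<open>u < \<infinity>\<close> by (rule less_trans)
    then have tq: "t = ennreal q" by (simp add: q_def)
    have q0: "0 \<le> q" "0 \<le> r" by (auto simp: q_def r_def)
    have qr: "q < r" using u(1) q0 unfolding ur tq by (simp add: ennreal_less_iff)
    \<comment> \<open>\<open>n > r\<close> keeps all layers up to height \<open>r\<close> below the
      cut-off \<open>n * n\<close>; \<open>n > 1 / (r - q)\<close> makes the mesh fine enough for a
      grid point \<open>j / n\<close> to lie between \<open>q\<close> and \<open>r\<close>.\<close>
    obtain n0 :: nat where n0: "real n0 > max r (1 / (r - q))" using reals_Archimedean2 by blast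
    have "t < s n x" if n: "n \<ge> n0" for n
    proof -
      have nr: "real n > r" "real n > 1 / (r - q)" using n0 n by auto
      have npos: "real n > 0" using nr q0 by linarith
      define j where "j = nat \<lfloor>real n * r\<rfloor>"
      have j1: "real j \<le> real n * r" using q0 npos unfolding j_def by simp
      have j2: "real n * r < real j + 1" using q0 npos unfolding j_def by linarith
      have "real n * r \<le> real n * real n" using nr npos by (intro mult_left_mono) auto
      then have "real j \<le> real n * real n" using j1 by linarith
      then have jn: "j \<le> n * n" by (metis of_nat_le_iff of_nat_mult)
      have "1 < real n * (r - q)" using nr(2) qr by (simp add: divide_simps)
      then have "real n * q < real j" using j2 by (simp add: algebra_simps)
      then have qj: "q < real j / real n" using npos by (simp add: field_simps)
      have "ennreal (real k / real n) < h x" if "k \<le> j" for k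
      proof -
        have "real k \<le> real n * r" using that j1 by linarith
        then have "real k / real n \<le> r" using npos by (simp add: field_simps)
        then show ?thesis using u(2) unfolding ur by (meson ennreal_leI le_less_trans)
      qed
      then have eq1: "ennreal (1 / real n) * indicator {x \<in> space M. ennreal (real k / real n) < h x} x = ennreal (1 / real n)"
        if "k \<in> {1..j}" for k using that x by (auto simp: indicator_def)
      have "ennreal (real j / real n) = (\<Sum>k=1..j. ennreal (1 / real n))"
        by (simp add: ennreal_of_nat_eq_real_of_nat flip: ennreal_mult)
      also have "\<dots> = (\<Sum>k=1..j. ennreal (1 / real n) * indicator {x \<in> space M. ennreal (real k / real n) < h x} x)"
        using eq1 by (intro sum.cong) auto
      also have "\<dots> \<le> s n x" unfolding s_def using jn by (intro sum_mono2) auto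
      finally have "ennreal (real j / real n) \<le> s n x" .
      moreover have "t < ennreal (real j / real n)" using qj q0 unfolding tq by (simp add: ennreal_less_iff)
      ultimately show ?thesis by simp
    qed
    then show "\<forall>\<^sub>F n in sequentially. t < s n x" unfolding eventually_sequentially by blast
  qed
  then have "(\<integral>\<^sup>+x. h x \<partial>M) \<le> (\<integral>\<^sup>+x. liminf (\<lambda>n. s n x) \<partial>M)" by (intro nn_integral_mono)
  also have "\<dots> \<le> liminf (\<lambda>n. \<integral>\<^sup>+x. s n x \<partial>M)" by (intro nn_integral_liminf) simp
  finally have "c < liminf (\<lambda>n. \<integral>\<^sup>+x. s n x \<partial>M)" using c by simp
  then have "\<forall>\<^sub>F n in sequentially. c < (\<integral>\<^sup>+x. s n x \<partial>M)" by (rule less_LiminfD)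
  then have "\<forall>\<^sub>F n in sequentially. c < (\<integral>\<^sup>+x. s n x \<partial>M) \<and> 0 < n"
    using eventually_gt_at_top[of 0] by eventually_elim auto
  then obtain n where "c < (\<integral>\<^sup>+x. s n x \<partial>M)" "0 < n"
    using eventually_happens'[OF sequentially_bot] by blast
  then show ?thesis unfolding int_s by blast
qed

text \<open>The suprema are replaced by near-optimal members one after the other; the addend
  \<open>b\<close> collects the terms already replaced, which is why the induction runs over
  arbitrary \<open>b\<close>. It serves to apply inner regularity to all superlevel sets at
  once.\<close>

lemma sum_SUP_less_choice:
  fixes m :: "'b \<Rightarrow> ennreal"
  assumes "finite I" and "\<And>k. k \<in> I \<Longrightarrow> D k \<noteq> {}"
    and "c < b + (\<Sum>k\<in>I. a * (SUP K\<in>D k. m K))"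
  shows "\<exists>K. (\<forall>k\<in>I. K k \<in> D k) \<and> c < b + (\<Sum>k\<in>I. a * m (K k))"
  using assms
proof (induction I arbitrary: b rule: finite_induct)
  case empty then show ?case by auto
next
  case (insert k I)
  let ?R = "b + (\<Sum>k\<in>I. a * (SUP K\<in>D k. m K))"
  have "c < ?R + (SUP K\<in>D k. a * m K)" using insert.prems(2) insert.hyps
    by (simp add: SUP_mult_left_ennreal ac_simps)
  also have "\<dots> = (SUP K\<in>D k. ?R + a * m K)" using insert.prems(1)[of k]
    by (subst ennreal_SUP_add_right) auto
  finally obtain K0 where K0: "K0 \<in> D k" "c < ?R + a * m K0" by (auto simp: less_SUP_iff)
  then have "c < (b + a * m K0) + (\<Sum>k\<in>I. a * (SUP K\<in>D k. m K))" by (simp add: ac_simps)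
  from insert.IH[OF _ this] insert.prems(1) obtain K where
    K: "\<forall>k\<in>I. K k \<in> D k" "c < (b + a * m K0) + (\<Sum>k\<in>I. a * m (K k))" by auto
  have eq: "(\<Sum>j\<in>I. a * m ((K(k := K0)) j)) = (\<Sum>j\<in>I. a * m (K j))"
    using insert.hyps by (intro sum.cong) auto
  show ?case
  proof (intro exI[of _ "K(k := K0)"] conjI)
    show "\<forall>ka\<in>insert k I. (K(k := K0)) ka \<in> D ka" using K(1) K0(1) by auto
    show "c < b + (\<Sum>j\<in>insert k I. a * m ((K(k := K0)) j))"
      using K(2) insert.hyps eq by (simp add: ac_simps)
  qed
qed

context left_haar_measure
begin

lemma open_sets: "openin T U \<Longrightarrow> U \<in> sets \<mu>"
  unfolding sets_haar by (auto intro: sigma_sets.Basic)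

lemma compactin_sets: "compactin T K \<Longrightarrow> K \<in> sets \<mu>"
proof -
  assume K: "compactin T K"
  then have "closedin T K" by (simp add: compactin_imp_closedin hausdorff)
  then have "openin T (carrier G - K)" by (simp add: closedin_def topspace_eq)
  then have "carrier G - K \<in> sets \<mu>" by (rule open_sets)
  then have "space \<mu> - (carrier G - K) \<in> sets \<mu>" by blast
  moreover have "K \<subseteq> carrier G" using compactin_subset_topspace[OF K] topspace_eq by simp
  ultimately show ?thesis by (simp add: space_haar double_diff)
qed

lemma section_open:
  assumes W: "openin (prod_topology T T) W"
  shows "openin T {y. (x, y) \<in> W}"
proof (cases "x \<in> carrier G")
  case True
  have "continuous_map T (prod_topology T T) (\<lambda>y. (x, y))"
    using True by (auto simp: continuous_map_pairwise o_def topspace_eq)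
  then have "openin T {y \<in> topspace T. (x, y) \<in> W}" using W by (rule openin_continuous_map_preimage)
  moreover have "{y \<in> topspace T. (x, y) \<in> W} = {y. (x, y) \<in> W}"
    using openin_subset[OF W] by auto
  ultimately show ?thesis by simp
next
  case False
  then have "{y. (x, y) \<in> W} = {}" using openin_subset[OF W] by (auto simp: topspace_eq)
  then show ?thesis by simp
qed

lemma openin_prod_swap:
  assumes "openin (prod_topology T T) W"
  shows "openin (prod_topology T T) {(x, y). (y, x) \<in> W}"
proof -
  have "continuous_map (prod_topology T T) (prod_topology T T) (\<lambda>p. (snd p, fst p))"
    by (auto simp: continuous_map_pairwise o_def continuous_map_fst continuous_map_snd)
  from openin_continuous_map_preimage[OF this assms]
  have "openin (prod_topology T T) {p \<in> topspace (prod_topology T T). (snd p, fst p) \<in> W}" .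
  moreover have "{p \<in> topspace (prod_topology T T). (snd p, fst p) \<in> W} = {(x, y). (y, x) \<in> W}"
    using openin_subset[OF assms] by auto
  ultimately show ?thesis by simp
qed

text \<open>Inner regularity puts a compact \<open>C\<close> inside the open section, and the tube
  lemma thickens the point \<open>x\<close> to a neighbourhood that works for all of
  \<open>C\<close>.\<close>

lemma section_compact_inside:
  assumes W: "openin (prod_topology T T) W" and c: "c < emeasure \<mu> {y. (x, y) \<in> W}" and x: "x \<in> carrier G"
  shows "\<exists>U C. openin T U \<and> compactin T C \<and> x \<in> U \<and> U \<times> C \<subseteq> W \<and> c < emeasure \<mu> C"
proof -
  have "\<exists>C. compactin T C \<and> C \<subseteq> {y. (x, y) \<in> W} \<and> c < emeasure \<mu> C"
    using c inner_regular[OF section_open[OF W, of x]] by (auto simp: less_SUP_iff)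
  then obtain C where C: "compactin T C" "C \<subseteq> {y. (x, y) \<in> W}" "c < emeasure \<mu> C" by blast
  have "\<exists>U V. openin T U \<and> openin T V \<and> x \<in> U \<and> C \<subseteq> V \<and> U \<times> V \<subseteq> W"
    using C x by (intro tube_lemma_right[OF W]) (auto simp: topspace_eq)
  then show ?thesis using C by blast
qed

text \<open>The rectangle \<open>U \<times> C\<close> around \<open>x\<close> keeps the lower bound
  for every \<open>z\<close> in \<open>U\<close>. This semicontinuity makes section measures
  measurable even for an open \<open>W\<close> outside the product \<sigma>-algebra.\<close>

lemma section_measure_lsc:
  assumes W: "openin (prod_topology T T) W"
  shows "openin T {x \<in> carrier G. c < emeasure \<mu> {y. (x, y) \<in> W}}"
proof (subst openin_subopen, intro ballI)
  fix x assume "x \<in> {x \<in> carrier G. c < emeasure \<mu> {y. (x, y) \<in> W}}"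
  then obtain U C where U: "openin T U" "compactin T C" "x \<in> U" "U \<times> C \<subseteq> W" "c < emeasure \<mu> C"
    using section_compact_inside[OF W] by blast
  have "c < emeasure \<mu> {y. (z, y) \<in> W}" if "z \<in> U" for z
  proof -
    have "emeasure \<mu> C \<le> emeasure \<mu> {y. (z, y) \<in> W}"
      using that U(4) open_sets[OF section_open[OF W, of z]] by (intro emeasure_mono) auto
    then show ?thesis using U(5) by simp
  qed
  moreover have "U \<subseteq> carrier G" using openin_subset[OF U(1)] topspace_eq by simp
  ultimately show "\<exists>Ta. openin T Ta \<and> x \<in> Ta \<and> Ta \<subseteq> {x \<in> carrier G. c < emeasure \<mu> {y. (x, y) \<in> W}}"
    using U by (intro exI[of _ U]) auto
qed

lemma section_measure_measurable:
  assumes W: "openin (prod_topology T T) W"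
  shows "(\<lambda>x. emeasure \<mu> {y. (x, y) \<in> W}) \<in> borel_measurable \<mu>"
  using open_sets[OF section_measure_lsc[OF W]]
  by (intro borel_measurableI_greater) (simp add: space_haar)

lemma finite_nbhd:
  assumes "x \<in> carrier G"
  shows "\<exists>U. openin T U \<and> x \<in> U \<and> emeasure \<mu> U < \<infinity>"
proof -
  obtain U K where U: "openin T U" "compactin T K" "x \<in> U" "U \<subseteq> K"
    using locally_compact assms by (auto simp: locally_compact_space_def topspace_eq)
  have "emeasure \<mu> U \<le> emeasure \<mu> K" using U compactin_sets by (intro emeasure_mono) auto
  then show ?thesis using U finite_compact[OF U(2) compactin_sets[OF U(2)]] le_less_trans by blast
qed

text \<open>Densities cut \<open>\<mu>\<close> down to finite measures on \<open>A\<close> and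
  \<open>B\<close>, to which the theorem for \<sigma>-finite factors applies; since \<open>R\<close>
  lies in \<open>A \<times> B\<close>, the sections have the same measure as before.\<close>

lemma rectangles_Fubini:
  assumes R: "R \<in> sets (\<mu> \<Otimes>\<^sub>M \<mu>)" "R \<subseteq> A \<times> B"
    and A: "A \<in> sets \<mu>" "emeasure \<mu> A < \<infinity>" and B: "B \<in> sets \<mu>" "emeasure \<mu> B < \<infinity>"
  shows "(\<integral>\<^sup>+x. emeasure \<mu> {y. (x, y) \<in> R} \<partial>\<mu>) = (\<integral>\<^sup>+y. emeasure \<mu> {x. (x, y) \<in> R} \<partial>\<mu>)"
proof -
  define \<alpha> where "\<alpha> = density \<mu> (indicator A)"
  define \<beta> where "\<beta> = density \<mu> (indicator B)"
  have fin: "finite_measure (density \<mu> (indicator C))" if "C \<in> sets \<mu>" "emeasure \<mu> C < \<infinity>" for C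
  proof (rule finite_measureI)
    have "emeasure (density \<mu> (indicator C)) (space \<mu>) = (\<integral>\<^sup>+x. indicator C x \<partial>\<mu>)"
      using that(1) by (subst emeasure_density) (auto intro!: nn_integral_cong)
    also have "\<dots> = emeasure \<mu> C" using that(1) by (rule nn_integral_indicator)
    finally show "emeasure (density \<mu> (indicator C)) (space (density \<mu> (indicator C))) \<noteq> \<infinity>"
      using that(2) by simp
  qed
  have fin\<alpha>: "finite_measure \<alpha>" and fin\<beta>: "finite_measure \<beta>"
    using fin A B unfolding \<alpha>_def \<beta>_def by auto
  interpret \<alpha>: finite_measure \<alpha> by (rule fin\<alpha>)
  interpret \<beta>: finite_measure \<beta> by (rule fin\<beta>)
  interpret pair_sigma_finite \<alpha> \<beta> ..
  have sR: "R \<in> sets (\<alpha> \<Otimes>\<^sub>M \<beta>)" using R by (simp add: \<alpha>_def \<beta>_def cong: sets_pair_measure_cong)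
  have Rsec: "Pair x -` R \<in> sets \<mu>" "(\<lambda>x. (x, y)) -` R \<in> sets \<mu>" for x y
    using R(1) by (auto intro: sets_Pair1 sets_Pair2)
  have 1: "emeasure \<beta> (Pair x -` R) = emeasure \<mu> {y. (x, y) \<in> R}" for x
  proof -
    have "emeasure \<beta> (Pair x -` R) = emeasure \<mu> (B \<inter> Pair x -` R)"
      unfolding \<beta>_def using Rsec B by (subst emeasure_density) (auto simp flip: indicator_inter_arith)
    also have "B \<inter> Pair x -` R = {y. (x, y) \<in> R}" using R by auto
    finally show ?thesis .
  qed
  have 2: "emeasure \<alpha> ((\<lambda>x. (x, y)) -` R) = emeasure \<mu> {x. (x, y) \<in> R}" for y
  proof -
    have "emeasure \<alpha> ((\<lambda>x. (x, y)) -` R) = emeasure \<mu> (A \<inter> (\<lambda>x. (x, y)) -` R)"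
      unfolding \<alpha>_def using Rsec A by (subst emeasure_density) (auto simp flip: indicator_inter_arith)
    also have "A \<inter> (\<lambda>x. (x, y)) -` R = {x. (x, y) \<in> R}" using R by auto
    finally show ?thesis .
  qed
  have 3: "(\<integral>\<^sup>+x. emeasure \<mu> {y. (x, y) \<in> R} \<partial>\<alpha>) = (\<integral>\<^sup>+x. emeasure \<mu> {y. (x, y) \<in> R} \<partial>\<mu>)"
  proof -
    have m: "(\<lambda>x. emeasure \<mu> {y. (x, y) \<in> R}) \<in> borel_measurable \<mu>"
      using \<beta>.measurable_emeasure_Pair[OF sR] unfolding 1 by (simp add: \<alpha>_def)
    have z: "{y. (x, y) \<in> R} = {}" if "x \<notin> A" for x using R that by auto
    show ?thesis unfolding \<alpha>_def using A m
      by (subst nn_integral_density) (auto intro!: nn_integral_cong simp: indicator_def z)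
  qed
  have 4: "(\<integral>\<^sup>+y. emeasure \<mu> {x. (x, y) \<in> R} \<partial>\<beta>) = (\<integral>\<^sup>+y. emeasure \<mu> {x. (x, y) \<in> R} \<partial>\<mu>)"
  proof -
    have m: "(\<lambda>y. emeasure \<mu> {x. (x, y) \<in> R}) \<in> borel_measurable \<mu>"
      using measurable_emeasure_Pair2[OF sR] unfolding 2 by (simp add: \<beta>_def)
    have z: "{x. (x, y) \<in> R} = {}" if "y \<notin> B" for y using R that by auto
    show ?thesis unfolding \<beta>_def using B m
      by (subst nn_integral_density) (auto intro!: nn_integral_cong simp: indicator_def z)
  qed
  show ?thesis
    using \<beta>.emeasure_pair_measure_alt[OF sR] emeasure_pair_measure_alt2[OF sR] unfolding 1 2 3 4 by simp
qed


text \<open>Compactness of \<open>K\<close> leaves finitely many rectangles, so their union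
  \<open>R\<close> stays in the product \<sigma>-algebra and has sides of finite measure, which is
  what \<open>rectangles_Fubini\<close> asks for. Local compactness lets the open sides be shrunk to
  finite measure.\<close>

lemma rectangles_inside:
  assumes W: "openin (prod_topology T T) W" and K: "compactin T K"
    and KW: "K \<subseteq> {x \<in> carrier G. c < emeasure \<mu> {y. (x, y) \<in> W}}"
  shows "\<exists>A B R. R \<in> sets (\<mu> \<Otimes>\<^sub>M \<mu>) \<and> R \<subseteq> A \<times> B \<and> R \<subseteq> W \<and> A \<in> sets \<mu> \<and> emeasure \<mu> A < \<infinity> \<and>
    B \<in> sets \<mu> \<and> emeasure \<mu> B < \<infinity> \<and> (\<forall>x\<in>K. c < emeasure \<mu> {y. (x, y) \<in> R})"
proof -
  have "\<exists>U C. openin T U \<and> compactin T C \<and> x \<in> U \<and> U \<times> C \<subseteq> W \<and> c < emeasure \<mu> C \<and> emeasure \<mu> U < \<infinity>"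
    if "x \<in> K" for x
  proof -
    have x: "x \<in> carrier G" "c < emeasure \<mu> {y. (x, y) \<in> W}" using that KW by auto
    obtain U C where U: "openin T U" "compactin T C" "x \<in> U" "U \<times> C \<subseteq> W" "c < emeasure \<mu> C"
      using section_compact_inside[OF W x(2,1)] by blast
    obtain V where V: "openin T V" "x \<in> V" "emeasure \<mu> V < \<infinity>" using finite_nbhd[OF x(1)] by blast
    have "emeasure \<mu> (U \<inter> V) \<le> emeasure \<mu> V" using open_sets[OF V(1)] by (intro emeasure_mono) auto
    then have "emeasure \<mu> (U \<inter> V) < \<infinity>" using V(3) by (rule le_less_trans)
    then show ?thesis using U V by (intro exI[of _ "U \<inter> V"] exI[of _ C]) auto
  qed
  then obtain U C where UC: "\<And>x. x \<in> K \<Longrightarrow> openin T (U x) \<and> compactin T (C x) \<and> x \<in> U x \<and> U x \<times> C x \<subseteq> W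
      \<and> c < emeasure \<mu> (C x) \<and> emeasure \<mu> (U x) < \<infinity>" by metis
  have "\<exists>\<F>. finite \<F> \<and> \<F> \<subseteq> U ` K \<and> K \<subseteq> \<Union>\<F>"
    by (rule compactinD[OF K]) (use UC in auto)
  then obtain \<F> where F: "finite \<F>" "\<F> \<subseteq> U ` K" "K \<subseteq> \<Union>\<F>" by blast
  obtain X where "X \<subseteq> K" "finite X" "\<F> = U ` X" using finite_subset_image[OF F(1,2)] by blast
  then have X: "finite X" "X \<subseteq> K" "K \<subseteq> (\<Union>x\<in>X. U x)" using F(3) by auto
  have Cs: "C x \<in> sets \<mu>" "U x \<in> sets \<mu>" "emeasure \<mu> (C x) < \<infinity>" if "x \<in> X" for x
    using UC[of x] that X compactin_sets finite_compact open_sets by (blast, blast, blast)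
  define A B R where "A = (\<Union>x\<in>X. U x)" and "B = (\<Union>x\<in>X. C x)" and "R = (\<Union>x\<in>X. U x \<times> C x)"
  have "emeasure \<mu> A \<le> (\<Sum>x\<in>X. emeasure \<mu> (U x))" "emeasure \<mu> B \<le> (\<Sum>x\<in>X. emeasure \<mu> (C x))"
    unfolding A_def B_def using Cs X(1) by (auto intro!: emeasure_subadditive_finite)
  moreover have "(\<Sum>x\<in>X. emeasure \<mu> (U x)) < \<infinity>" "(\<Sum>x\<in>X. emeasure \<mu> (C x)) < \<infinity>"
    using Cs X UC by (auto simp: less_top[symmetric] subset_iff)
  ultimately have fin: "emeasure \<mu> A < \<infinity>" "emeasure \<mu> B < \<infinity>" by (auto intro: le_less_trans)
  have RM: "R \<in> sets (\<mu> \<Otimes>\<^sub>M \<mu>)" unfolding R_def using X(1) Cs by (intro sets.finite_UN) auto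
  have "c < emeasure \<mu> {y. (x, y) \<in> R}" if xK: "x \<in> K" for x
  proof -
    obtain z where z: "z \<in> X" "x \<in> U z" using xK X(3) by blast
    have "{y. (x, y) \<in> R} = Pair x -` R" by auto
    then have "{y. (x, y) \<in> R} \<in> sets \<mu>" using sets_Pair1[OF RM, of x] by simp
    then have "emeasure \<mu> (C z) \<le> emeasure \<mu> {y. (x, y) \<in> R}"
      using z by (intro emeasure_mono) (auto simp: R_def)
    then show ?thesis using UC[of z] z X by (meson less_le_trans subsetD)
  qed
  moreover have "R \<subseteq> A \<times> B" "R \<subseteq> W" "A \<in> sets \<mu>" "B \<in> sets \<mu>"
    using Cs X UC unfolding A_def B_def R_def by (blast, blast, auto intro!: sets.finite_UN)
  ultimately show ?thesis using RM fin by (intro exI[of _ A] exI[of _ B] exI[of _ R]) auto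
qed

text \<open>Approximate \<open>x \<mapsto> \<mu> W\<^sub>x\<close> from below by multiples of indicators of its superlevel sets, shrink these open
  sets to compact ones, and cover the compact sets by finitely many rectangles inside \<open>W\<close>: the order of
  integration may be changed for the finite union of rectangles.\<close>

lemma open_iterated_le:
  assumes W: "openin (prod_topology T T) W"
  shows "(\<integral>\<^sup>+x. emeasure \<mu> {y. (x, y) \<in> W} \<partial>\<mu>) \<le> (\<integral>\<^sup>+y. emeasure \<mu> {x. (x, y) \<in> W} \<partial>\<mu>)"
proof (rule dense_le)
  fix c assume "c < (\<integral>\<^sup>+x. emeasure \<mu> {y. (x, y) \<in> W} \<partial>\<mu>)"
  from nn_integral_layer_less[OF section_measure_measurable[OF W] this]
  obtain n N where nN: "n > 0"
    "c < (\<Sum>k=1..N. ennreal (1 / real n) * emeasure \<mu> {x \<in> carrier G. ennreal (real k / real n) < emeasure \<mu> {y. (x, y) \<in> W}})"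
    unfolding space_haar by blast
  define D where "D k = {K. compactin T K \<and> K \<subseteq> {x \<in> carrier G. ennreal (real k / real n) < emeasure \<mu> {y. (x, y) \<in> W}}}" for k
  \<comment> \<open>The summand 0 is the initial value of the accumulator \<open>b\<close> in
    \<open>sum_SUP_less_choice\<close>.\<close>
  have "c < 0 + (\<Sum>k=1..N. ennreal (1 / real n) * (SUP K\<in>D k. emeasure \<mu> K))"
    using nN(2) unfolding D_def by (subst (asm) inner_regular[OF section_measure_lsc[OF W]]) simp
  moreover have "D k \<noteq> {}" for k unfolding D_def by (auto intro!: exI[of _ "{}"])
  ultimately have "\<exists>K. (\<forall>k\<in>{1..N}. K k \<in> D k) \<and> c < 0 + (\<Sum>k=1..N. ennreal (1 / real n) * emeasure \<mu> (K k))"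
    by (intro sum_SUP_less_choice) auto
  then obtain K where K: "\<And>k. k \<in> {1..N} \<Longrightarrow> K k \<in> D k"
    "c < (\<Sum>k=1..N. ennreal (1 / real n) * emeasure \<mu> (K k))"
    unfolding add_0 by blast
  have "\<forall>k\<in>{1..N}. \<exists>A B R. R \<in> sets (\<mu> \<Otimes>\<^sub>M \<mu>) \<and> R \<subseteq> A \<times> B \<and> R \<subseteq> W \<and> A \<in> sets \<mu> \<and> emeasure \<mu> A < \<infinity> \<and>
    B \<in> sets \<mu> \<and> emeasure \<mu> B < \<infinity> \<and> (\<forall>x\<in>K k. ennreal (real k / real n) < emeasure \<mu> {y. (x, y) \<in> R})"
    using K(1) rectangles_inside[OF W] unfolding D_def by blast
  then obtain A B R where R': "\<forall>k\<in>{1..N}. R k \<in> sets (\<mu> \<Otimes>\<^sub>M \<mu>) \<and> R k \<subseteq> A k \<times> B k \<and> R k \<subseteq> W \<and>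
      A k \<in> sets \<mu> \<and> emeasure \<mu> (A k) < \<infinity> \<and> B k \<in> sets \<mu> \<and> emeasure \<mu> (B k) < \<infinity> \<and>
      (\<forall>x\<in>K k. ennreal (real k / real n) < emeasure \<mu> {y. (x, y) \<in> R k})"
    unfolding bchoice_iff by blast
  have R: "R k \<in> sets (\<mu> \<Otimes>\<^sub>M \<mu>)" "R k \<subseteq> A k \<times> B k" "R k \<subseteq> W"
      "A k \<in> sets \<mu>" "emeasure \<mu> (A k) < \<infinity>" "B k \<in> sets \<mu>" "emeasure \<mu> (B k) < \<infinity>"
      "\<And>x. x \<in> K k \<Longrightarrow> ennreal (real k / real n) < emeasure \<mu> {y. (x, y) \<in> R k}" if "k \<in> {1..N}" for k
    using R' that by blast+
  define A' B' R' where "A' = (\<Union>k\<in>{1..N}. A k)" and "B' = (\<Union>k\<in>{1..N}. B k)" and "R' = (\<Union>k\<in>{1..N}. R k)"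
  have "emeasure \<mu> A' \<le> (\<Sum>k\<in>{1..N}. emeasure \<mu> (A k))" "emeasure \<mu> B' \<le> (\<Sum>k\<in>{1..N}. emeasure \<mu> (B k))"
    unfolding A'_def B'_def using R(4,6) by (auto intro!: emeasure_subadditive_finite)
  moreover have "(\<Sum>k\<in>{1..N}. emeasure \<mu> (A k)) < \<infinity>" "(\<Sum>k\<in>{1..N}. emeasure \<mu> (B k)) < \<infinity>"
    using R(5,7) by (auto simp: less_top[symmetric])
  ultimately have fin: "emeasure \<mu> A' < \<infinity>" "emeasure \<mu> B' < \<infinity>" by (auto intro: le_less_trans)
  have R'M: "R' \<in> sets (\<mu> \<Otimes>\<^sub>M \<mu>)" unfolding R'_def using R(1) by (intro sets.finite_UN) auto
  have R'W: "R' \<subseteq> A' \<times> B'" "R' \<subseteq> W" "A' \<in> sets \<mu>" "B' \<in> sets \<mu>"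
    using R(2,3,4,6) unfolding A'_def B'_def R'_def by (blast, blast, auto intro!: sets.finite_UN)
  \<comment> \<open>If \<open>m\<close> is the largest index with \<open>x\<close> in
    \<open>K m\<close>, then at most \<open>m\<close> of the sets contain \<open>x\<close>, so the
    left side is at most \<open>m / n\<close>, and the section of \<open>R m\<close> alone is larger
    than that.\<close>
  have pw: "(\<Sum>k=1..N. ennreal (1 / real n) * indicator (K k) x) \<le> emeasure \<mu> {y. (x, y) \<in> R'}" for x
  proof -
    define J where "J = {k \<in> {1..N}. x \<in> K k}"
    have "finite J" unfolding J_def by auto
    have "(\<Sum>k=1..N. ennreal (1 / real n) * indicator (K k) x) = (\<Sum>k\<in>J. ennreal (1 / real n))"
      unfolding J_def by (intro sum.mono_neutral_cong_right) (auto simp: indicator_def)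
    also have "\<dots> = ennreal (real (card J) / real n)"
      by (simp add: ennreal_of_nat_eq_real_of_nat flip: ennreal_mult)
    also have "\<dots> \<le> emeasure \<mu> {y. (x, y) \<in> R'}"
    proof (cases "J = {}")
      case False
      define m where "m = Max J"
      have m: "m \<in> J" unfolding m_def using False \<open>finite J\<close> by (rule Max_in[rotated])
      have "J \<subseteq> {1..m}" using \<open>finite J\<close> unfolding m_def by (auto simp: J_def)
      then have "card J \<le> m" using card_mono[of "{1..m}" J] by simp
      then have "ennreal (real (card J) / real n) \<le> ennreal (real m / real n)"
        by (intro ennreal_leI divide_right_mono) auto
      also have "\<dots> \<le> emeasure \<mu> {y. (x, y) \<in> R m}" using R(8)[of m x] m by (auto simp: J_def intro: less_imp_le)
      also have "\<dots> \<le> emeasure \<mu> {y. (x, y) \<in> R'}"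
      proof (intro emeasure_mono)
        show "{y. (x, y) \<in> R m} \<subseteq> {y. (x, y) \<in> R'}" using m by (auto simp: R'_def J_def)
        have "{y. (x, y) \<in> R'} = Pair x -` R'" by auto
        then show "{y. (x, y) \<in> R'} \<in> sets \<mu>" using sets_Pair1[OF R'M, of x] by simp
      qed
      finally show ?thesis .
    qed simp
    finally show ?thesis .
  qed
  have Kc: "K k \<in> sets \<mu>" if "k \<in> {1..N}" for k using K(1)[OF that] compactin_sets unfolding D_def by auto
  have "c < (\<Sum>k=1..N. ennreal (1 / real n) * emeasure \<mu> (K k))" by fact
  also have "\<dots> = (\<integral>\<^sup>+x. (\<Sum>k=1..N. ennreal (1 / real n) * indicator (K k) x) \<partial>\<mu>)"
    using Kc by (subst nn_integral_sum) (auto simp: nn_integral_cmult)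
  also have "\<dots> \<le> (\<integral>\<^sup>+x. emeasure \<mu> {y. (x, y) \<in> R'} \<partial>\<mu>)" using pw by (intro nn_integral_mono) auto
  also have "\<dots> = (\<integral>\<^sup>+y. emeasure \<mu> {x. (x, y) \<in> R'} \<partial>\<mu>)"
    using R'M R'W fin by (intro rectangles_Fubini[of R' A' B']) auto
  also have "\<dots> \<le> (\<integral>\<^sup>+y. emeasure \<mu> {x. (x, y) \<in> W} \<partial>\<mu>)"
  proof (intro nn_integral_mono emeasure_mono)
    fix y
    show "{x. (x, y) \<in> W} \<in> sets \<mu>"
      using open_sets[OF section_open[OF openin_prod_swap[OF W], of y]] by simp
  qed (use R'W in auto)
  finally show "c \<le> (\<integral>\<^sup>+y. emeasure \<mu> {x. (x, y) \<in> W} \<partial>\<mu>)" by simp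
qed

lemma open_iterated_eq:
  assumes W: "openin (prod_topology T T) W"
  shows "(\<integral>\<^sup>+x. emeasure \<mu> {y. (x, y) \<in> W} \<partial>\<mu>) = (\<integral>\<^sup>+y. emeasure \<mu> {x. (x, y) \<in> W} \<partial>\<mu>)"
  using open_iterated_le[OF W] open_iterated_le[OF openin_prod_swap[OF W]] by (intro antisym) auto

end

section \<open>From nonnegative to complex integrands\<close>

lemma nn_integral_enn2real:
  fixes a :: "'a \<Rightarrow> ennreal"
  assumes a [measurable]: "a \<in> borel_measurable M" and fin: "(\<integral>\<^sup>+x. a x \<partial>M) < \<infinity>"
  shows "integrable M (\<lambda>x. enn2real (a x))" "(\<integral>x. enn2real (a x) \<partial>M) = enn2real (\<integral>\<^sup>+x. a x \<partial>M)"
proof -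
  have "AE x in M. a x \<noteq> \<infinity>" using fin by (intro nn_integral_PInf_AE) auto
  then have "(\<integral>\<^sup>+x. ennreal (enn2real (a x)) \<partial>M) = (\<integral>\<^sup>+x. a x \<partial>M)"
    by (intro nn_integral_cong_AE) (auto simp: less_top)
  then show "integrable M (\<lambda>x. enn2real (a x))" "(\<integral>x. enn2real (a x) \<partial>M) = enn2real (\<integral>\<^sup>+x. a x \<partial>M)"
    using fin by (auto intro!: integrableI_nonneg simp: integral_eq_nn_integral)
qed

text \<open>The value is expressed through four nonnegative iterated integrals, so that two orders
  of integration agree as soon as Tonelli's theorem holds for each of the four. Measurability is
  asked of the sections and partial integrals instead of \<open>F\<close>, because the integrands of
  interest need not be measurable for the product \<sigma>-algebra.\<close>

lemma iterated_complex:
  fixes F :: "'a \<Rightarrow> 'b \<Rightarrow> complex"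
  assumes sec: "\<And>y. y \<in> space M \<Longrightarrow> F y \<in> borel_measurable N"
    and n [measurable]: "(\<lambda>y. \<integral>\<^sup>+x. ennreal (cmod (F y x)) \<partial>N) \<in> borel_measurable M"
    and a1 [measurable]: "(\<lambda>y. \<integral>\<^sup>+x. ennreal (Re (F y x)) \<partial>N) \<in> borel_measurable M"
    and a2 [measurable]: "(\<lambda>y. \<integral>\<^sup>+x. ennreal (- Re (F y x)) \<partial>N) \<in> borel_measurable M"
    and a3 [measurable]: "(\<lambda>y. \<integral>\<^sup>+x. ennreal (Im (F y x)) \<partial>N) \<in> borel_measurable M"
    and a4 [measurable]: "(\<lambda>y. \<integral>\<^sup>+x. ennreal (- Im (F y x)) \<partial>N) \<in> borel_measurable M"
    and fin: "(\<integral>\<^sup>+y. \<integral>\<^sup>+x. ennreal (cmod (F y x)) \<partial>N \<partial>M) < \<infinity>"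
  shows "AE y in M. integrable N (F y)"
    and "integrable M (\<lambda>y. \<integral>x. F y x \<partial>N)"
    and "(\<integral>y. \<integral>x. F y x \<partial>N \<partial>M) =
      complex_of_real (enn2real (\<integral>\<^sup>+y. \<integral>\<^sup>+x. ennreal (Re (F y x)) \<partial>N \<partial>M) - enn2real (\<integral>\<^sup>+y. \<integral>\<^sup>+x. ennreal (- Re (F y x)) \<partial>N \<partial>M))
      + \<i> * complex_of_real (enn2real (\<integral>\<^sup>+y. \<integral>\<^sup>+x. ennreal (Im (F y x)) \<partial>N \<partial>M) - enn2real (\<integral>\<^sup>+y. \<integral>\<^sup>+x. ennreal (- Im (F y x)) \<partial>N \<partial>M))"
proof -
  let ?n = "\<lambda>y. \<integral>\<^sup>+x. ennreal (cmod (F y x)) \<partial>N"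
  let ?a1 = "\<lambda>y. \<integral>\<^sup>+x. ennreal (Re (F y x)) \<partial>N" let ?a2 = "\<lambda>y. \<integral>\<^sup>+x. ennreal (- Re (F y x)) \<partial>N"
  let ?a3 = "\<lambda>y. \<integral>\<^sup>+x. ennreal (Im (F y x)) \<partial>N" let ?a4 = "\<lambda>y. \<integral>\<^sup>+x. ennreal (- Im (F y x)) \<partial>N"
  have int_iff: "integrable N (F y) \<longleftrightarrow> ?n y < \<infinity>" if "y \<in> space M" for y
    using sec[OF that] by (auto simp: integrable_iff_bounded)
  have "AE y in M. ?n y \<noteq> \<infinity>" using fin by (intro nn_integral_PInf_AE) auto
  with AE_space have AEn: "AE y in M. ?n y < \<infinity>" by eventually_elim (simp add: less_top)
  with AE_space show AEi: "AE y in M. integrable N (F y)" by eventually_elim (simp add: int_iff)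
  have val: "(\<integral>x. F y x \<partial>N) = complex_of_real (enn2real (?a1 y) - enn2real (?a2 y)) + \<i> * complex_of_real (enn2real (?a3 y) - enn2real (?a4 y))"
    if i: "integrable N (F y)" for y
  proof -
    have "Re (\<integral>x. F y x \<partial>N) = (\<integral>x. Re (F y x) \<partial>N)" "Im (\<integral>x. F y x \<partial>N) = (\<integral>x. Im (F y x) \<partial>N)"
      using i by auto
    moreover have "integrable N (\<lambda>x. Re (F y x))" "integrable N (\<lambda>x. Im (F y x))" using i by auto
    ultimately show ?thesis by (simp add: real_lebesgue_integral_def complex_eq_iff)
  qed
  \<comment> \<open>\<open>H\<close> copies the default value 0 of the Bochner integral at the
    \<open>y\<close> where \<open>F y\<close> is not integrable. So it agrees with the inner
    integral everywhere, not just almost everywhere, and passes on its measurability.\<close>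
  define H where "H y = (if ?n y < \<infinity> then complex_of_real (enn2real (?a1 y) - enn2real (?a2 y)) + \<i> * complex_of_real (enn2real (?a3 y) - enn2real (?a4 y)) else 0)" for y
  have H_meas: "H \<in> borel_measurable M" unfolding H_def by measurable
  have H_eq: "(\<integral>x. F y x \<partial>N) = H y" if "y \<in> space M" for y
    using val[of y] int_iff[OF that] unfolding H_def by (auto simp: not_integrable_integral_eq)
  then have meas: "(\<lambda>y. \<integral>x. F y x \<partial>N) \<in> borel_measurable M"
    using H_meas by (subst measurable_cong[of M _ H]) auto
  show "integrable M (\<lambda>y. \<integral>x. F y x \<partial>N)"
  proof (rule integrableI_bounded[OF meas])
    have "ennreal (cmod (\<integral>x. F y x \<partial>N)) \<le> ?n y" for y
    proof (cases "integrable N (F y)")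
      case True
      have "cmod (\<integral>x. F y x \<partial>N) \<le> (\<integral>x. cmod (F y x) \<partial>N)" by (rule integral_norm_bound)
      also have "ennreal \<dots> = ?n y" using True by (subst nn_integral_eq_integral) auto
      finally show ?thesis by (simp add: ennreal_leI)
    qed (simp add: not_integrable_integral_eq)
    then have "(\<integral>\<^sup>+y. ennreal (cmod (\<integral>x. F y x \<partial>N)) \<partial>M) \<le> (\<integral>\<^sup>+y. ?n y \<partial>M)" by (intro nn_integral_mono)
    then show "(\<integral>\<^sup>+y. ennreal (cmod (\<integral>x. F y x \<partial>N)) \<partial>M) < \<infinity>" using fin by (rule le_less_trans)
  qed
  have le: "(\<integral>\<^sup>+y. ?a1 y \<partial>M) < \<infinity>" "(\<integral>\<^sup>+y. ?a2 y \<partial>M) < \<infinity>" "(\<integral>\<^sup>+y. ?a3 y \<partial>M) < \<infinity>" "(\<integral>\<^sup>+y. ?a4 y \<partial>M) < \<infinity>"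
  proof -
    have b: "Re z \<le> cmod z" "- Re z \<le> cmod z" "Im z \<le> cmod z" "- Im z \<le> cmod z" for z
      using abs_Re_le_cmod[of z] abs_Im_le_cmod[of z] by linarith+
    show "(\<integral>\<^sup>+y. ?a1 y \<partial>M) < \<infinity>" "(\<integral>\<^sup>+y. ?a2 y \<partial>M) < \<infinity>" "(\<integral>\<^sup>+y. ?a3 y \<partial>M) < \<infinity>" "(\<integral>\<^sup>+y. ?a4 y \<partial>M) < \<infinity>"
      by (rule le_less_trans[OF _ fin], intro nn_integral_mono ennreal_leI b)+
  qed
  have "(\<integral>y. \<integral>x. F y x \<partial>N \<partial>M) = (\<integral>y. complex_of_real (enn2real (?a1 y) - enn2real (?a2 y)) + \<i> * complex_of_real (enn2real (?a3 y) - enn2real (?a4 y)) \<partial>M)"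
    using AEi val by (intro integral_cong_AE meas) (auto elim: eventually_mono)
  also have "\<dots> = complex_of_real (enn2real (\<integral>\<^sup>+y. ?a1 y \<partial>M) - enn2real (\<integral>\<^sup>+y. ?a2 y \<partial>M))
      + \<i> * complex_of_real (enn2real (\<integral>\<^sup>+y. ?a3 y \<partial>M) - enn2real (\<integral>\<^sup>+y. ?a4 y \<partial>M))"
  proof -
    note i = nn_integral_enn2real(1)[OF a1 le(1)] nn_integral_enn2real(1)[OF a2 le(2)]
        nn_integral_enn2real(1)[OF a3 le(3)] nn_integral_enn2real(1)[OF a4 le(4)]
    note v = nn_integral_enn2real(2)[OF a1 le(1)] nn_integral_enn2real(2)[OF a2 le(2)]
        nn_integral_enn2real(2)[OF a3 le(3)] nn_integral_enn2real(2)[OF a4 le(4)]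
    have j: "integrable M (\<lambda>y. enn2real (?a1 y) - enn2real (?a2 y))" "integrable M (\<lambda>y. enn2real (?a3 y) - enn2real (?a4 y))"
      using i by (auto intro: Bochner_Integration.integrable_diff)
    have "(\<integral>y. complex_of_real (enn2real (?a1 y) - enn2real (?a2 y)) + \<i> * complex_of_real (enn2real (?a3 y) - enn2real (?a4 y)) \<partial>M)
      = (\<integral>y. complex_of_real (enn2real (?a1 y) - enn2real (?a2 y)) \<partial>M) + \<i> * (\<integral>y. complex_of_real (enn2real (?a3 y) - enn2real (?a4 y)) \<partial>M)"
      using j by (subst Bochner_Integration.integral_add) (auto intro!: integrable_of_real integrable_mult_right simp del: of_real_diff)
    also have "\<dots> = complex_of_real (\<integral>y. enn2real (?a1 y) - enn2real (?a2 y) \<partial>M) + \<i> * complex_of_real (\<integral>y. enn2real (?a3 y) - enn2real (?a4 y) \<partial>M)"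
      by (simp only: integral_complex_of_real)
    also have "(\<integral>y. enn2real (?a1 y) - enn2real (?a2 y) \<partial>M) = enn2real (\<integral>\<^sup>+y. ?a1 y \<partial>M) - enn2real (\<integral>\<^sup>+y. ?a2 y \<partial>M)"
      using i v by (subst Bochner_Integration.integral_diff) auto
    also have "(\<integral>y. enn2real (?a3 y) - enn2real (?a4 y) \<partial>M) = enn2real (\<integral>\<^sup>+y. ?a3 y \<partial>M) - enn2real (\<integral>\<^sup>+y. ?a4 y \<partial>M)"
      using i v by (subst Bochner_Integration.integral_diff) auto
    finally show ?thesis .
  qed
  finally show "(\<integral>y. \<integral>x. F y x \<partial>N \<partial>M) =
      complex_of_real (enn2real (\<integral>\<^sup>+y. ?a1 y \<partial>M) - enn2real (\<integral>\<^sup>+y. ?a2 y \<partial>M))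
      + \<i> * complex_of_real (enn2real (\<integral>\<^sup>+y. ?a3 y \<partial>M) - enn2real (\<integral>\<^sup>+y. ?a4 y \<partial>M))" .
qed

context left_haar_measure
begin

text \<open>The \<open>\<sigma>\<close>-algebra of \<open>borel2\<close> can be larger than the product \<open>\<sigma>\<close>-algebra of \<open>\<mu> \<Otimes>\<^sub>M \<mu>\<close>; multiplication
  is measurable only with respect to the former.\<close>

definition borel2 :: "('a \<times> 'a) measure" where
  "borel2 = sigma (carrier G \<times> carrier G) {W. openin (prod_topology T T) W}"

lemma open2_subset: "openin (prod_topology T T) W \<Longrightarrow> W \<subseteq> carrier G \<times> carrier G"
  using openin_subset by (fastforce simp: topspace_eq)

lemma space_borel2: "space borel2 = carrier G \<times> carrier G"
  unfolding borel2_def by (rule space_measure_of) (use open2_subset in auto)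

lemma sets_borel2: "sets borel2 = sigma_sets (carrier G \<times> carrier G) {W. openin (prod_topology T T) W}"
  unfolding borel2_def by (rule sets_measure_of) (use open2_subset in auto)

lemma measurable_Pair1_borel2: "y \<in> carrier G \<Longrightarrow> Pair y \<in> measurable \<mu> borel2"
  unfolding borel2_def
proof (rule measurable_measure_of)
  fix W assume y: "y \<in> carrier G" and "W \<in> {W. openin (prod_topology T T) W}"
  then have W: "openin (prod_topology T T) W" by simp
  have "Pair y -` W \<inter> space \<mu> = {x. (y, x) \<in> W}" using open2_subset[OF W] by (auto simp: space_haar)
  then show "Pair y -` W \<inter> space \<mu> \<in> sets \<mu>" using open_sets[OF section_open[OF W]] by simp
qed (use open2_subset in \<open>auto simp: space_haar\<close>)

lemma measurable_Pair2_borel2: "x \<in> carrier G \<Longrightarrow> (\<lambda>y. (y, x)) \<in> measurable \<mu> borel2"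
  unfolding borel2_def
proof (rule measurable_measure_of)
  fix W assume x: "x \<in> carrier G" and "W \<in> {W. openin (prod_topology T T) W}"
  then have W: "openin (prod_topology T T) W" by simp
  have "(\<lambda>y. (y, x)) -` W \<inter> space \<mu> = {y. (x, y) \<in> {(x, y). (y, x) \<in> W}}"
    using open2_subset[OF W] by (auto simp: space_haar)
  then show "(\<lambda>y. (y, x)) -` W \<inter> space \<mu> \<in> sets \<mu>" using open_sets[OF section_open[OF openin_prod_swap[OF W]]] by simp
qed (use open2_subset in \<open>auto simp: space_haar\<close>)

lemma measurable_from_borel2:
  assumes "continuous_map (prod_topology T T) T h"
  shows "h \<in> measurable borel2 \<mu>"
proof -
  have \<mu>: "sets \<mu> = sets (sigma (carrier G) {U. openin T U})" "space (sigma (carrier G) {U. openin T U}) = carrier G"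
    using openin_subset topspace_eq by (auto simp: sets_haar sets_measure_of_conv space_measure_of_conv)
  have "h \<in> measurable borel2 (sigma (carrier G) {U. openin T U})"
  proof (rule measurable_measure_of)
    show "{U. openin T U} \<subseteq> Pow (carrier G)" using openin_subset topspace_eq by auto
    show "h \<in> space borel2 \<rightarrow> carrier G"
      using assms by (auto simp: space_borel2 continuous_map_def topspace_eq)
    fix U assume "U \<in> {U. openin T U}"
    then have "openin (prod_topology T T) {p \<in> topspace (prod_topology T T). h p \<in> U}"
      using openin_continuous_map_preimage[OF assms] by simp
    moreover have "h -` U \<inter> space borel2 = {p \<in> topspace (prod_topology T T). h p \<in> U}"
      by (auto simp: space_borel2 topspace_eq)
    ultimately show "h -` U \<inter> space borel2 \<in> sets borel2" by (auto simp: sets_borel2)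
  qed
  then show ?thesis using measurable_cong_sets[OF refl \<mu>(1)] by blast
qed

lemma section1_measurable: "u \<in> measurable borel2 N \<Longrightarrow> y \<in> carrier G \<Longrightarrow> (\<lambda>x. u (y, x)) \<in> measurable \<mu> N"
  using measurable_compose[OF measurable_Pair1_borel2] by blast

lemma section2_measurable: "u \<in> measurable borel2 N \<Longrightarrow> x \<in> carrier G \<Longrightarrow> (\<lambda>y. u (y, x)) \<in> measurable \<mu> N"
  using measurable_compose[OF measurable_Pair2_borel2] by blast

text \<open>A bundle that is stable under the steps of an induction over sets and functions. It
  includes the measurability of both partial integrals, which does not follow from that of
  \<open>u\<close> by the usual theorems when \<open>\<mu>\<close> is not \<sigma>-finite.\<close>

definition Tonelli :: "('a \<times> 'a \<Rightarrow> ennreal) \<Rightarrow> bool" where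
  "Tonelli u \<longleftrightarrow> u \<in> borel_measurable borel2 \<and> (\<lambda>y. \<integral>\<^sup>+x. u (y, x) \<partial>\<mu>) \<in> borel_measurable \<mu> \<and>
     (\<lambda>x. \<integral>\<^sup>+y. u (y, x) \<partial>\<mu>) \<in> borel_measurable \<mu> \<and>
     (\<integral>\<^sup>+y. \<integral>\<^sup>+x. u (y, x) \<partial>\<mu> \<partial>\<mu>) = (\<integral>\<^sup>+x. \<integral>\<^sup>+y. u (y, x) \<partial>\<mu> \<partial>\<mu>)"

lemma Tonelli_cong:
  assumes "Tonelli u" and eq: "\<And>y x. y \<in> carrier G \<Longrightarrow> x \<in> carrier G \<Longrightarrow> v (y, x) = u (y, x)"
  shows "Tonelli v"
proof -
  have 1: "v \<in> borel_measurable borel2 \<longleftrightarrow> u \<in> borel_measurable borel2"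
    by (rule measurable_cong) (auto simp: space_borel2 eq)
  have 2: "(\<integral>\<^sup>+x. v (y, x) \<partial>\<mu>) = (\<integral>\<^sup>+x. u (y, x) \<partial>\<mu>)" if "y \<in> space \<mu>" for y
    using that by (intro nn_integral_cong) (auto simp: space_haar eq)
  have 3: "(\<integral>\<^sup>+y. v (y, x) \<partial>\<mu>) = (\<integral>\<^sup>+y. u (y, x) \<partial>\<mu>)" if "x \<in> space \<mu>" for x
    using that by (intro nn_integral_cong) (auto simp: space_haar eq)
  show ?thesis using assms(1) unfolding Tonelli_def 1
    by (simp add: 2 3 cong: measurable_cong nn_integral_cong)
qed

lemma Tonelli_add:
  assumes "Tonelli u" "Tonelli v"
  shows "Tonelli (\<lambda>p. u p + v p)"
proof -
  have m [measurable]: "u \<in> borel_measurable borel2" "v \<in> borel_measurable borel2" using assms by (auto simp: Tonelli_def)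
  have 2: "(\<integral>\<^sup>+x. u (y, x) + v (y, x) \<partial>\<mu>) = (\<integral>\<^sup>+x. u (y, x) \<partial>\<mu>) + (\<integral>\<^sup>+x. v (y, x) \<partial>\<mu>)" if "y \<in> space \<mu>" for y
    using that section1_measurable[OF m(1), of y] section1_measurable[OF m(2), of y] by (intro nn_integral_add) (auto simp: space_haar)
  have 3: "(\<integral>\<^sup>+y. u (y, x) + v (y, x) \<partial>\<mu>) = (\<integral>\<^sup>+y. u (y, x) \<partial>\<mu>) + (\<integral>\<^sup>+y. v (y, x) \<partial>\<mu>)" if "x \<in> space \<mu>" for x
    using that section2_measurable[OF m(1), of x] section2_measurable[OF m(2), of x] by (intro nn_integral_add) (auto simp: space_haar)
  show ?thesis using assms unfolding Tonelli_def
    by (auto simp: 2 3 nn_integral_add cong: measurable_cong nn_integral_cong)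
qed

lemma Tonelli_cmult:
  assumes "Tonelli u"
  shows "Tonelli (\<lambda>p. c * u p)"
proof -
  have m [measurable]: "u \<in> borel_measurable borel2" using assms by (auto simp: Tonelli_def)
  have 2: "(\<integral>\<^sup>+x. c * u (y, x) \<partial>\<mu>) = c * (\<integral>\<^sup>+x. u (y, x) \<partial>\<mu>)" if "y \<in> space \<mu>" for y
    using that section1_measurable[OF m(1), of y] by (intro nn_integral_cmult) (auto simp: space_haar)
  have 3: "(\<integral>\<^sup>+y. c * u (y, x) \<partial>\<mu>) = c * (\<integral>\<^sup>+y. u (y, x) \<partial>\<mu>)" if "x \<in> space \<mu>" for x
    using that section2_measurable[OF m(1), of x] by (intro nn_integral_cmult) (auto simp: space_haar)
  show ?thesis using assms unfolding Tonelli_def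
    by (auto simp: 2 3 nn_integral_cmult cong: measurable_cong nn_integral_cong)
qed

text \<open>In \<open>ennreal\<close> an integral commutes with a difference only if the subtracted
  integral is finite. This has to hold for every section, not almost every one, as the partial
  integrals are computed pointwise.\<close>

lemma Tonelli_diff:
  assumes T: "Tonelli u" "Tonelli v" and le: "\<And>p. v p \<le> u p"
    and fin: "(\<integral>\<^sup>+y. \<integral>\<^sup>+x. u (y, x) \<partial>\<mu> \<partial>\<mu>) < \<infinity>"
    and fin1: "\<And>y. y \<in> carrier G \<Longrightarrow> (\<integral>\<^sup>+x. u (y, x) \<partial>\<mu>) < \<infinity>"
    and fin2: "\<And>x. x \<in> carrier G \<Longrightarrow> (\<integral>\<^sup>+y. u (y, x) \<partial>\<mu>) < \<infinity>"
  shows "Tonelli (\<lambda>p. u p - v p)"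
proof -
  note M = T[unfolded Tonelli_def]
  have m: "u \<in> borel_measurable borel2" "v \<in> borel_measurable borel2" using M by auto
  have le1: "(\<integral>\<^sup>+x. v (y, x) \<partial>\<mu>) \<le> (\<integral>\<^sup>+x. u (y, x) \<partial>\<mu>)" and le2: "(\<integral>\<^sup>+x. v (x, y) \<partial>\<mu>) \<le> (\<integral>\<^sup>+x. u (x, y) \<partial>\<mu>)" for y
    by (intro nn_integral_mono le)+
  have le0: "(\<integral>\<^sup>+y. \<integral>\<^sup>+x. v (y, x) \<partial>\<mu> \<partial>\<mu>) \<noteq> \<infinity>" "(\<integral>\<^sup>+x. \<integral>\<^sup>+y. v (y, x) \<partial>\<mu> \<partial>\<mu>) \<noteq> \<infinity>"
    using le_less_trans[OF nn_integral_mono[OF le1] fin] M(2) by (auto simp: less_top)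
  have 2: "(\<integral>\<^sup>+x. u (y, x) - v (y, x) \<partial>\<mu>) = (\<integral>\<^sup>+x. u (y, x) \<partial>\<mu>) - (\<integral>\<^sup>+x. v (y, x) \<partial>\<mu>)" if "y \<in> space \<mu>" for y
    using that section1_measurable[OF m(1), of y] section1_measurable[OF m(2), of y] le le_less_trans[OF le1 fin1, of y]
    by (intro nn_integral_diff) (auto simp: space_haar less_top)
  have 3: "(\<integral>\<^sup>+y. u (y, x) - v (y, x) \<partial>\<mu>) = (\<integral>\<^sup>+y. u (y, x) \<partial>\<mu>) - (\<integral>\<^sup>+y. v (y, x) \<partial>\<mu>)" if "x \<in> space \<mu>" for x
    using that section2_measurable[OF m(1), of x] section2_measurable[OF m(2), of x] le le_less_trans[OF le2 fin2, of x]
    by (intro nn_integral_diff) (auto simp: space_haar less_top)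
  have "(\<integral>\<^sup>+y. (\<integral>\<^sup>+x. u (y, x) \<partial>\<mu>) - (\<integral>\<^sup>+x. v (y, x) \<partial>\<mu>) \<partial>\<mu>) = (\<integral>\<^sup>+y. \<integral>\<^sup>+x. u (y, x) \<partial>\<mu> \<partial>\<mu>) - (\<integral>\<^sup>+y. \<integral>\<^sup>+x. v (y, x) \<partial>\<mu> \<partial>\<mu>)"
    using M le0 le1 by (intro nn_integral_diff) auto
  moreover have "(\<integral>\<^sup>+x. (\<integral>\<^sup>+y. u (y, x) \<partial>\<mu>) - (\<integral>\<^sup>+y. v (y, x) \<partial>\<mu>) \<partial>\<mu>) = (\<integral>\<^sup>+x. \<integral>\<^sup>+y. u (y, x) \<partial>\<mu> \<partial>\<mu>) - (\<integral>\<^sup>+x. \<integral>\<^sup>+y. v (y, x) \<partial>\<mu> \<partial>\<mu>)"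
    using M le0 le2 by (intro nn_integral_diff) auto
  ultimately show ?thesis using M unfolding Tonelli_def
    by (auto simp: 2 3 intro!: borel_measurable_minus_ennreal cong: measurable_cong nn_integral_cong)
qed

lemma Tonelli_SUP:
  assumes u: "\<And>i::nat. Tonelli (u i)" and inc: "incseq u"
  shows "Tonelli (\<lambda>p. SUP i. u i p)"
proof -
  have m [measurable]: "u i \<in> borel_measurable borel2" for i using u by (auto simp: Tonelli_def)
  have 2: "(\<integral>\<^sup>+x. (SUP i. u i (y, x)) \<partial>\<mu>) = (SUP i. \<integral>\<^sup>+x. u i (y, x) \<partial>\<mu>)" if "y \<in> space \<mu>" for y
    using that section1_measurable[OF m, of y] inc
    by (intro nn_integral_monotone_convergence_SUP) (auto simp: space_haar incseq_def le_fun_def)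
  have 3: "(\<integral>\<^sup>+y. (SUP i. u i (y, x)) \<partial>\<mu>) = (SUP i. \<integral>\<^sup>+y. u i (y, x) \<partial>\<mu>)" if "x \<in> space \<mu>" for x
    using that section2_measurable[OF m, of x] inc
    by (intro nn_integral_monotone_convergence_SUP) (auto simp: space_haar incseq_def le_fun_def)
  have m1: "(\<lambda>y. \<integral>\<^sup>+x. u i (y, x) \<partial>\<mu>) \<in> borel_measurable \<mu>" "(\<lambda>x. \<integral>\<^sup>+y. u i (y, x) \<partial>\<mu>) \<in> borel_measurable \<mu>" for i
    using u[of i] by (auto simp: Tonelli_def)
  have "(\<integral>\<^sup>+y. (SUP i. \<integral>\<^sup>+x. u i (y, x) \<partial>\<mu>) \<partial>\<mu>) = (SUP i. \<integral>\<^sup>+y. \<integral>\<^sup>+x. u i (y, x) \<partial>\<mu> \<partial>\<mu>)"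
    using inc m1 by (intro nn_integral_monotone_convergence_SUP) (auto simp: incseq_def le_fun_def intro!: nn_integral_mono)
  moreover have "(\<integral>\<^sup>+x. (SUP i. \<integral>\<^sup>+y. u i (y, x) \<partial>\<mu>) \<partial>\<mu>) = (SUP i. \<integral>\<^sup>+x. \<integral>\<^sup>+y. u i (y, x) \<partial>\<mu> \<partial>\<mu>)"
    using inc m1 by (intro nn_integral_monotone_convergence_SUP) (auto simp: incseq_def le_fun_def intro!: nn_integral_mono)
  moreover have "(\<integral>\<^sup>+y. \<integral>\<^sup>+x. u i (y, x) \<partial>\<mu> \<partial>\<mu>) = (\<integral>\<^sup>+x. \<integral>\<^sup>+y. u i (y, x) \<partial>\<mu> \<partial>\<mu>)" for i
    using u[of i] by (auto simp: Tonelli_def)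
  ultimately show ?thesis using m1 unfolding Tonelli_def
    by (simp add: 2 3 cong: measurable_cong nn_integral_cong)
qed


section \<open>Left translations\<close>

lemma measurable_quot: "(\<lambda>p. inv (fst p) \<otimes> snd p) \<in> measurable borel2 \<mu>"
proof (rule measurable_from_borel2)
  have "continuous_map (prod_topology T T) (prod_topology T T) (\<lambda>p. (inv (fst p), snd p))"
    using continuous_map_compose[OF continuous_map_fst continuous_inv]
    by (auto simp: continuous_map_pairwise o_def continuous_map_snd)
  from continuous_map_compose[OF this continuous_mult]
  show "continuous_map (prod_topology T T) T (\<lambda>p. inv (fst p) \<otimes> snd p)" by (simp add: o_def)
qed

lemma measurable_fst2: "fst \<in> measurable borel2 \<mu>" and measurable_snd2: "snd \<in> measurable borel2 \<mu>"
  by (auto intro: measurable_from_borel2 continuous_map_fst continuous_map_snd)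

lemma measurable_lmult: "y \<in> carrier G \<Longrightarrow> (\<lambda>x. y \<otimes> x) \<in> measurable \<mu> \<mu>"
  using section1_measurable[OF measurable_from_borel2[OF continuous_mult]] by simp

text \<open>The preimage of \<open>A\<close> under multiplication by \<open>y\<close> is the image
  of \<open>A\<close> under multiplication by \<open>inv y\<close>. In this form invariance passes
  from sets to integrals and null sets.\<close>

lemma distr_lmult:
  assumes y: "y \<in> carrier G"
  shows "distr \<mu> \<mu> (\<lambda>x. y \<otimes> x) = \<mu>"
proof (rule measure_eqI)
  fix A assume "A \<in> sets (distr \<mu> \<mu> (\<lambda>x. y \<otimes> x))"
  then have A: "A \<in> sets \<mu>" by simp
  have AG: "A \<subseteq> carrier G" using sets.sets_into_space[OF A] by (simp add: space_haar)
  have "(\<lambda>x. y \<otimes> x) -` A \<inter> space \<mu> = (\<lambda>x. inv y \<otimes> x) ` A"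
  proof (intro equalityI subsetI)
    fix x assume "x \<in> (\<lambda>x. y \<otimes> x) -` A \<inter> space \<mu>"
    then have "x \<in> carrier G" "y \<otimes> x \<in> A" by (auto simp: space_haar)
    then show "x \<in> (\<lambda>x. inv y \<otimes> x) ` A" using y by (intro image_eqI[of _ _ "y \<otimes> x"]) (auto simp flip: m_assoc)
  next
    fix x assume "x \<in> (\<lambda>x. inv y \<otimes> x) ` A"
    then obtain z where "z \<in> A" "x = inv y \<otimes> z" by auto
    then show "x \<in> (\<lambda>x. y \<otimes> x) -` A \<inter> space \<mu>" using y AG by (auto simp: space_haar simp flip: m_assoc)
  qed
  then show "emeasure (distr \<mu> \<mu> (\<lambda>x. y \<otimes> x)) A = emeasure \<mu> A"
    using A y left_invariant[of "inv y" A] by (simp add: emeasure_distr measurable_lmult)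
qed simp

lemma nn_integral_lmult:
  "y \<in> carrier G \<Longrightarrow> f \<in> borel_measurable \<mu> \<Longrightarrow> (\<integral>\<^sup>+x. f (y \<otimes> x) \<partial>\<mu>) = (\<integral>\<^sup>+x. f x \<partial>\<mu>)"
  using nn_integral_distr[OF measurable_lmult, of y f] by (simp add: distr_lmult)

lemma integral_lmult:
  fixes f :: "'a \<Rightarrow> complex"
  shows "y \<in> carrier G \<Longrightarrow> f \<in> borel_measurable \<mu> \<Longrightarrow> (\<integral>x. f (y \<otimes> x) \<partial>\<mu>) = (\<integral>x. f x \<partial>\<mu>)"
  using integral_distr[OF measurable_lmult, of y f] by (simp add: distr_lmult)

lemma integrable_lmult:
  fixes f :: "'a \<Rightarrow> complex"
  shows "y \<in> carrier G \<Longrightarrow> integrable \<mu> f \<Longrightarrow> integrable \<mu> (\<lambda>x. f (y \<otimes> x))"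
  using integrable_distr[OF measurable_lmult, of y f] by (simp add: distr_lmult)

lemma AE_lmult:
  assumes y: "y \<in> carrier G" and P: "AE x in \<mu>. P x"
  shows "AE x in \<mu>. P (y \<otimes> x)"
proof -
  have "AE x in distr \<mu> \<mu> (\<lambda>x. y \<otimes> x). P x" by (subst distr_lmult[OF y]) (rule P)
  then show ?thesis by (rule AE_distrD[OF measurable_lmult[OF y]])
qed

section \<open>Interchange of integrals on the strips that carry convolution integrands\<close>

definition strip :: "'a set \<Rightarrow> 'a set \<Rightarrow> ('a \<times> 'a) set" where
  "strip U V = {(y, x). y \<in> U \<and> x \<in> carrier G \<and> inv y \<otimes> x \<in> V}"

lemma strip_open:
  assumes "openin T U" "openin T V"
  shows "openin (prod_topology T T) (strip U V)"
proof -
  have "continuous_map (prod_topology T T) (prod_topology T T) (\<lambda>p. (inv (fst p), snd p))"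
    using continuous_map_compose[OF continuous_map_fst continuous_inv]
    by (auto simp: continuous_map_pairwise o_def continuous_map_snd)
  from continuous_map_compose[OF this continuous_mult]
  have "continuous_map (prod_topology T T) T (\<lambda>p. inv (fst p) \<otimes> snd p)" by (simp add: o_def)
  then have "openin (prod_topology T T) ({p \<in> topspace (prod_topology T T). fst p \<in> U} \<inter>
      {p \<in> topspace (prod_topology T T). inv (fst p) \<otimes> snd p \<in> V})"
    using assms by (intro openin_Int openin_continuous_map_preimage[OF continuous_map_fst] openin_continuous_map_preimage) auto
  also have "\<dots> = strip U V"
    using openin_subset[OF assms(1)] by (auto simp: strip_def topspace_eq)
  finally show ?thesis .
qed

text \<open>The section is the translate of \<open>V\<close> by \<open>y\<close>, so left invariance
  makes its measure independent of \<open>y\<close>. Consequently a strip over sets of finite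
  measure has finite iterated integral.\<close>

lemma strip_section1:
  assumes "openin T V" "y \<in> carrier G"
  shows "emeasure \<mu> {x. (y, x) \<in> strip U V} = indicator U y * emeasure \<mu> V"
proof (cases "y \<in> U")
  case True
  have VG: "V \<subseteq> carrier G" using openin_subset[OF assms(1)] by (simp add: topspace_eq)
  have "{x. (y, x) \<in> strip U V} = (\<lambda>x. y \<otimes> x) ` V"
  proof (intro equalityI subsetI)
    fix x assume "x \<in> {x. (y, x) \<in> strip U V}"
    then have "x \<in> carrier G" "inv y \<otimes> x \<in> V" by (auto simp: strip_def)
    then show "x \<in> (\<lambda>x. y \<otimes> x) ` V" using assms by (intro image_eqI[of _ _ "inv y \<otimes> x"]) (auto simp flip: m_assoc)
  next
    fix x assume "x \<in> (\<lambda>x. y \<otimes> x) ` V"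
    then obtain z where "z \<in> V" "x = y \<otimes> z" by auto
    then show "x \<in> {x. (y, x) \<in> strip U V}" using assms VG True by (auto simp: strip_def simp flip: m_assoc)
  qed
  then show ?thesis using True left_invariant[OF assms(2) open_sets[OF assms(1)]] by simp
qed (simp add: strip_def)

text \<open>As \<open>\<mu>\<close> need not be \<open>\<sigma>\<close>-finite, the Dynkin system argument is run inside an open set with finite
  sections and finite iterated integral.\<close>

lemma Tonelli_strip_set:
  assumes U: "openin T U" "emeasure \<mu> U < \<infinity>" and V: "openin T V" "emeasure \<mu> V < \<infinity>"
    and W: "W \<in> sets borel2"
  shows "Tonelli (indicator (W \<inter> strip U V))"
proof -
  let ?W0 = "strip U V"
  note W0 = strip_open[OF U(1) V(1)]
  have sW0: "?W0 \<in> sets borel2" using W0 unfolding sets_borel2 by (auto intro: sigma_sets.Basic)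
  have ind1: "(\<integral>\<^sup>+x. indicator A (y, x) \<partial>\<mu>) = emeasure \<mu> {x. (y, x) \<in> A}"
    and ind1s: "{x. (y, x) \<in> A} \<in> sets \<mu>" if "A \<in> sets borel2" "y \<in> carrier G" for A y
  proof -
    have "A \<subseteq> carrier G \<times> carrier G" using sets.sets_into_space[OF that(1)] by (simp add: space_borel2)
    then have "Pair y -` A \<inter> space \<mu> = {x. (y, x) \<in> A}" by (auto simp: space_haar)
    then show "{x. (y, x) \<in> A} \<in> sets \<mu>" using measurable_sets[OF measurable_Pair1_borel2[OF that(2)] that(1)] by simp
    moreover have "(\<lambda>x. indicator A (y, x) :: ennreal) = indicator {x. (y, x) \<in> A}" by (auto simp: indicator_def)
    ultimately show "(\<integral>\<^sup>+x. indicator A (y, x) \<partial>\<mu>) = emeasure \<mu> {x. (y, x) \<in> A}" by simp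
  qed
  have ind2: "(\<integral>\<^sup>+y. indicator A (y, x) \<partial>\<mu>) = emeasure \<mu> {y. (y, x) \<in> A}"
    and ind2s: "{y. (y, x) \<in> A} \<in> sets \<mu>" if "A \<in> sets borel2" "x \<in> carrier G" for A x
  proof -
    have "A \<subseteq> carrier G \<times> carrier G" using sets.sets_into_space[OF that(1)] by (simp add: space_borel2)
    then have "(\<lambda>y. (y, x)) -` A \<inter> space \<mu> = {y. (y, x) \<in> A}" by (auto simp: space_haar)
    then show "{y. (y, x) \<in> A} \<in> sets \<mu>" using measurable_sets[OF measurable_Pair2_borel2[OF that(2)] that(1)] by simp
    moreover have "(\<lambda>y. indicator A (y, x) :: ennreal) = indicator {y. (y, x) \<in> A}" by (auto simp: indicator_def)
    ultimately show "(\<integral>\<^sup>+y. indicator A (y, x) \<partial>\<mu>) = emeasure \<mu> {y. (y, x) \<in> A}" by simp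
  qed
  have fin: "(\<integral>\<^sup>+y. emeasure \<mu> {x. (y, x) \<in> ?W0} \<partial>\<mu>) < \<infinity>"
  proof -
    have "(\<integral>\<^sup>+y. emeasure \<mu> {x. (y, x) \<in> ?W0} \<partial>\<mu>) = (\<integral>\<^sup>+y. emeasure \<mu> V * indicator U y \<partial>\<mu>)"
      using strip_section1[OF V(1)] by (intro nn_integral_cong) (simp add: space_haar mult.commute)
    also have "\<dots> = emeasure \<mu> V * emeasure \<mu> U" using open_sets[OF U(1)] by (subst nn_integral_cmult) auto
    also have "\<dots> < \<infinity>" using U V by (simp add: ennreal_mult_less_top)
    finally show ?thesis .
  qed
  have fin1: "emeasure \<mu> {x. (y, x) \<in> ?W0} < \<infinity>" if "y \<in> carrier G" for y
    using that V strip_section1[OF V(1) that, of U] by (simp add: indicator_def)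
  \<comment> \<open>The sections in the other direction lie in \<open>U\<close>, so no right
    translation and no modular function enters.\<close>
  have fin2: "emeasure \<mu> {y. (y, x) \<in> ?W0} < \<infinity>" for x
  proof -
    have "emeasure \<mu> {y. (y, x) \<in> ?W0} \<le> emeasure \<mu> U" using open_sets[OF U(1)] by (intro emeasure_mono) (auto simp: strip_def)
    then show ?thesis using U(2) by (rule le_less_trans)
  qed
  have open_Tonelli: "Tonelli (indicator A)" if A: "openin (prod_topology T T) A" for A
  proof -
    have sA: "A \<in> sets borel2" using A unfolding sets_borel2 by (auto intro: sigma_sets.Basic)
    have "(\<lambda>y. emeasure \<mu> {x. (y, x) \<in> A}) \<in> borel_measurable \<mu>" "(\<lambda>x. emeasure \<mu> {y. (y, x) \<in> A}) \<in> borel_measurable \<mu>"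
      using section_measure_measurable[OF A] section_measure_measurable[OF openin_prod_swap[OF A]] by auto
    then show ?thesis unfolding Tonelli_def using sA open_iterated_eq[OF A]
      by (simp add: ind1[OF sA] ind2[OF sA] space_haar[symmetric] cong: measurable_cong nn_integral_cong)
  qed
  show ?thesis using W unfolding sets_borel2
  proof (induction rule: sigma_sets_induct_disjoint[rotated 2, consumes 1, case_names basic empty compl union Int_stable Pow])
    case (basic A) then show ?case using W0 by (intro open_Tonelli openin_Int) auto
  next
    case empty then show ?case by (simp add: Tonelli_def)
  next
    \<comment> \<open>Complements are taken inside the strip, where finiteness makes the subtraction
      legitimate; on the whole of \<open>G \<times> G\<close> it could be infinity minus
      infinity.\<close>
    case (compl A)
    have fin': "(\<integral>\<^sup>+y. \<integral>\<^sup>+x. indicator ?W0 (y, x) \<partial>\<mu> \<partial>\<mu>) < \<infinity>"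
      using fin by (simp add: ind1[OF sW0] space_haar[symmetric] cong: nn_integral_cong)
    have "Tonelli (\<lambda>p. indicator ?W0 p - indicator (A \<inter> ?W0) p)"
      using fin1 fin2 by (intro Tonelli_diff[OF open_Tonelli[OF W0] compl(2) _ fin']) (auto simp: ind1[OF sW0] ind2[OF sW0] split: split_indicator)
    then show ?case by (rule Tonelli_cong) (auto simp: indicator_def)
  next
    case (union A)
    let ?A = "\<lambda>i. A i \<inter> ?W0"
    let ?u = "\<lambda>i p. \<Sum>j<i. indicator (?A j) p :: ennreal"
    have "Tonelli (?u i)" for i
    proof (induction i)
      case 0 show ?case by (simp add: Tonelli_def)
    next
      case (Suc i) then show ?case using Tonelli_add[OF Suc union(3)[of i]] by (simp add: add.commute)
    qed
    moreover have "incseq ?u" by (auto simp: incseq_def le_fun_def intro!: sum_mono2)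
    ultimately have "Tonelli (\<lambda>p. SUP i. ?u i p)" by (rule Tonelli_SUP)
    moreover have "(SUP i. ?u i p) = indicator (\<Union>(range A) \<inter> ?W0) p" for p
    proof -
      have "disjoint_family ?A" using union(1) by (auto simp: disjoint_family_on_def)
      then have "(\<Sum>i. indicator (?A i) p :: ennreal) = indicator (\<Union>i. ?A i) p" by (rule suminf_indicator)
      moreover have "(\<Union>i. ?A i) = \<Union>(range A) \<inter> ?W0" by auto
      ultimately show ?thesis by (simp add: suminf_eq_SUP)
    qed
    ultimately show ?case by simp
  next
    case Int_stable then show ?case by (auto intro!: Int_stableI openin_Int)
  next
    case Pow then show ?case using open2_subset by auto
  qed
qed

lemma Tonelli_strip:
  assumes U: "openin T U" "emeasure \<mu> U < \<infinity>" and V: "openin T V" "emeasure \<mu> V < \<infinity>"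
    and u: "u \<in> borel_measurable borel2"
  shows "Tonelli (\<lambda>p. u p * indicator (strip U V) p)"
  using u
proof (induction rule: borel_measurable_induct)
  case (cong f g)
  then show ?case by (elim Tonelli_cong) (auto simp: space_borel2)
next
  case (set A)
  show ?case by (rule Tonelli_cong[OF Tonelli_strip_set[OF U V set]]) (simp add: indicator_inter_arith)
next
  case (mult u c)
  then show ?case using Tonelli_cmult[of _ c] by (simp add: mult.assoc)
next
  case (add u v)
  then show ?case using Tonelli_add by (simp add: distrib_right)
next
  case (seq u')
  have "Tonelli (\<lambda>p. SUP i. u' i p * indicator (strip U V) p)"
    using seq by (intro Tonelli_SUP) (auto simp: incseq_def le_fun_def intro!: mult_right_mono)
  then show ?case by (simp add: SUP_mult_right_ennreal image_comp)
qed

text \<open>Markov's inequality bounds the measure of the set where \<open>f\<close> is at least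
  \<open>1 / (n + 1)\<close> in modulus, and outer regularity encloses this set in an open set of
  finite measure. So an integrable function lives on a \<sigma>-finite open set even if
  \<open>\<mu>\<close> is not \<sigma>-finite.\<close>

lemma integrable_support:
  fixes f :: "'a \<Rightarrow> complex"
  assumes f: "integrable \<mu> f"
  shows "\<exists>U::nat \<Rightarrow> 'a set. incseq U \<and> (\<forall>n. openin T (U n) \<and> emeasure \<mu> (U n) < \<infinity>) \<and> (\<forall>y\<in>carrier G. f y \<noteq> 0 \<longrightarrow> (\<exists>n. y \<in> U n))"
proof -
  have "\<exists>U. openin T U \<and> emeasure \<mu> U < \<infinity> \<and> {y \<in> carrier G. cmod (f y) \<ge> 1 / real (Suc n)} \<subseteq> U" for n
  proof -
    let ?E = "{y \<in> space \<mu>. cmod (f y) \<ge> 1 / real (Suc n)}"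
    have "emeasure \<mu> ?E \<le> (1 / (1 / real (Suc n))) * (\<integral>x. cmod (f x) \<partial>\<mu>)"
      using f by (intro integral_Markov_inequality) auto
    then have "emeasure \<mu> ?E < \<infinity>" by (rule le_less_trans) simp
    moreover have "?E \<in> sets \<mu>" using f by measurable
    ultimately have "(INF U \<in> {U. openin T U \<and> ?E \<subseteq> U}. emeasure \<mu> U) < \<infinity>" using outer_regular by simp
    then show ?thesis by (auto simp: INF_less_iff space_haar)
  qed
  then obtain U where U: "\<And>n. openin T (U n) \<and> emeasure \<mu> (U n) < \<infinity> \<and> {y \<in> carrier G. cmod (f y) \<ge> 1 / real (Suc n)} \<subseteq> U n"
    by metis
  show ?thesis
  proof (intro exI[of _ "\<lambda>n. \<Union>i\<le>n. U i"] conjI allI ballI impI)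
    show "incseq (\<lambda>n. \<Union>i\<le>n. U i)" by (fastforce simp: incseq_def)
    fix n show "openin T (\<Union>i\<le>n. U i)" using U by (intro openin_Union) auto
    have "emeasure \<mu> (\<Union>i\<le>n. U i) \<le> (\<Sum>i\<le>n. emeasure \<mu> (U i))"
      using U open_sets by (intro emeasure_subadditive_finite) auto
    moreover have "(\<Sum>i\<le>n. emeasure \<mu> (U i)) < \<infinity>" using U by (auto simp: less_top[symmetric])
    ultimately show "emeasure \<mu> (\<Union>i\<le>n. U i) < \<infinity>" by (rule le_less_trans)
  next
    fix y assume y: "y \<in> carrier G" "f y \<noteq> 0"
    then obtain n where "1 / real (Suc n) < cmod (f y)" using nat_approx_posE[of "cmod (f y)"] by auto
    then have "y \<in> U n" using U[of n] y by auto
    then show "\<exists>n. y \<in> (\<Union>i\<le>n. U i)" by blast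
  qed
qed

text \<open>The strips built from the exhausting sets for \<open>f\<close> and for \<open>g\<close>
  cover the points where \<open>u\<close> does not vanish, and increase; the supremum of the
  truncated functions is \<open>u\<close>. Since \<open>f\<close> and \<open>g\<close> merely locate
  \<open>u\<close>, the lemma also covers real and imaginary parts and the integrand with three
  factors in the proof of associativity.\<close>

lemma Tonelli_convolution:
  fixes f g :: "'a \<Rightarrow> complex"
  assumes u: "u \<in> borel_measurable borel2" and f: "integrable \<mu> f" and g: "integrable \<mu> g"
    and supp: "\<And>y x. y \<in> carrier G \<Longrightarrow> x \<in> carrier G \<Longrightarrow> u (y, x) \<noteq> 0 \<Longrightarrow> f y \<noteq> 0 \<and> g (inv y \<otimes> x) \<noteq> 0"
  shows "Tonelli u"
proof -
  obtain U :: "nat \<Rightarrow> 'a set" where U: "incseq U" "\<And>n. openin T (U n)" "\<And>n. emeasure \<mu> (U n) < \<infinity>"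
    "\<And>y. y \<in> carrier G \<Longrightarrow> f y \<noteq> 0 \<Longrightarrow> \<exists>n. y \<in> U n" using integrable_support[OF f] by blast
  obtain V :: "nat \<Rightarrow> 'a set" where V: "incseq V" "\<And>n. openin T (V n)" "\<And>n. emeasure \<mu> (V n) < \<infinity>"
    "\<And>y. y \<in> carrier G \<Longrightarrow> g y \<noteq> 0 \<Longrightarrow> \<exists>n. y \<in> V n" using integrable_support[OF g] by blast
  define v where "v n p = u p * indicator (strip (U n) (V n)) p" for n p
  have v: "Tonelli (v n)" for n unfolding v_def using U V u by (intro Tonelli_strip) auto
  have inc: "incseq v"
    using U(1) V(1) unfolding v_def
    by (fastforce simp: incseq_def le_fun_def indicator_def strip_def intro!: mult_left_mono)
  show ?thesis
  proof (rule Tonelli_cong[OF Tonelli_SUP[OF v inc]])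
    fix y x assume yx: "y \<in> carrier G" "x \<in> carrier G"
    have le: "v n (y, x) \<le> u (y, x)" for n unfolding v_def by (auto simp: indicator_def)
    show "u (y, x) = (SUP n. v n (y, x))"
    proof (rule antisym)
      show "u (y, x) \<le> (SUP n. v n (y, x))"
      proof (cases "u (y, x) = 0")
        case False
        then have "f y \<noteq> 0" "g (inv y \<otimes> x) \<noteq> 0" using supp yx by auto
        then obtain n m where "y \<in> U n" "inv y \<otimes> x \<in> V m" using U(4) V(4) yx by (meson inv_closed m_closed)
        then have "y \<in> U (max n m)" "inv y \<otimes> x \<in> V (max n m)"
          using incseqD[OF U(1), of n "max n m"] incseqD[OF V(1), of m "max n m"] by auto
        then have "v (max n m) (y, x) = u (y, x)" using yx by (simp add: v_def strip_def)
        then show ?thesis by (metis SUP_upper UNIV_I)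
      qed simp
    qed (use le in \<open>auto intro: SUP_least\<close>)
  qed
qed

lemma Fubini_convolution:
  fixes f g :: "'a \<Rightarrow> complex" and F :: "'a \<times> 'a \<Rightarrow> complex"
  assumes F: "F \<in> borel_measurable borel2" and f: "integrable \<mu> f" and g: "integrable \<mu> g"
    and supp: "\<And>y x. y \<in> carrier G \<Longrightarrow> x \<in> carrier G \<Longrightarrow> F (y, x) \<noteq> 0 \<Longrightarrow> f y \<noteq> 0 \<and> g (inv y \<otimes> x) \<noteq> 0"
    and fin: "(\<integral>\<^sup>+y. \<integral>\<^sup>+x. ennreal (cmod (F (y, x))) \<partial>\<mu> \<partial>\<mu>) < \<infinity>"
  shows "AE y in \<mu>. integrable \<mu> (\<lambda>x. F (y, x))" "AE x in \<mu>. integrable \<mu> (\<lambda>y. F (y, x))"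
    and "integrable \<mu> (\<lambda>y. \<integral>x. F (y, x) \<partial>\<mu>)" "integrable \<mu> (\<lambda>x. \<integral>y. F (y, x) \<partial>\<mu>)"
    and "(\<integral>y. \<integral>x. F (y, x) \<partial>\<mu> \<partial>\<mu>) = (\<integral>x. \<integral>y. F (y, x) \<partial>\<mu> \<partial>\<mu>)"
proof -
  have To: "Tonelli (\<lambda>p. ennreal (cmod (F p)))" "Tonelli (\<lambda>p. ennreal (Re (F p)))" "Tonelli (\<lambda>p. ennreal (- Re (F p)))"
    "Tonelli (\<lambda>p. ennreal (Im (F p)))" "Tonelli (\<lambda>p. ennreal (- Im (F p)))"
    by (rule Tonelli_convolution[OF _ f g], use F in measurable, rule supp, auto)+
  note M = To[unfolded Tonelli_def]
  note eq = conjunct2[OF conjunct2[OF conjunct2[OF M(1)]]] conjunct2[OF conjunct2[OF conjunct2[OF M(2)]]]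
    conjunct2[OF conjunct2[OF conjunct2[OF M(3)]]] conjunct2[OF conjunct2[OF conjunct2[OF M(4)]]]
    conjunct2[OF conjunct2[OF conjunct2[OF M(5)]]]
  have s1: "\<And>y. y \<in> space \<mu> \<Longrightarrow> (\<lambda>x. F (y, x)) \<in> borel_measurable \<mu>" using section1_measurable[OF F] by (simp add: space_haar)
  have s2: "\<And>x. x \<in> space \<mu> \<Longrightarrow> (\<lambda>y. F (y, x)) \<in> borel_measurable \<mu>" using section2_measurable[OF F] by (simp add: space_haar)
  have fin2: "(\<integral>\<^sup>+x. \<integral>\<^sup>+y. ennreal (cmod (F (y, x))) \<partial>\<mu> \<partial>\<mu>) < \<infinity>" using fin eq(1) by simp
  note I1 = iterated_complex[of \<mu> "\<lambda>y x. F (y, x)" \<mu>, OF s1 _ _ _ _ _ fin]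
  note I2 = iterated_complex[of \<mu> "\<lambda>x y. F (y, x)" \<mu>, OF s2 _ _ _ _ _ fin2]
  show "AE y in \<mu>. integrable \<mu> (\<lambda>x. F (y, x))" "integrable \<mu> (\<lambda>y. \<integral>x. F (y, x) \<partial>\<mu>)"
    by (rule I1; use M in auto)+
  show "AE x in \<mu>. integrable \<mu> (\<lambda>y. F (y, x))" "integrable \<mu> (\<lambda>x. \<integral>y. F (y, x) \<partial>\<mu>)"
    by (rule I2; use M in auto)+
  show "(\<integral>y. \<integral>x. F (y, x) \<partial>\<mu> \<partial>\<mu>) = (\<integral>x. \<integral>y. F (y, x) \<partial>\<mu> \<partial>\<mu>)"
    by (subst I1(3), (use M in auto)[6], subst I2(3), (use M in auto)[6]) (simp add: eq)
qed

end

section \<open>Convolution\<close>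

context left_haar_measure
begin

abbreviation conv :: "('a \<Rightarrow> complex) \<Rightarrow> ('a \<Rightarrow> complex) \<Rightarrow> 'a \<Rightarrow> complex" where
  "conv \<equiv> convolution G \<mu>"

lemma conv_integrand_measurable:
  fixes f g :: "'a \<Rightarrow> complex"
  assumes "f \<in> borel_measurable \<mu>" "g \<in> borel_measurable \<mu>"
  shows "(\<lambda>p. f (fst p) * g (inv (fst p) \<otimes> snd p)) \<in> borel_measurable borel2"
  using measurable_compose[OF measurable_fst2 assms(1)] measurable_compose[OF measurable_quot assms(2)]
  by (rule borel_measurable_times)

lemma conv_integrand_section:
  fixes f g :: "'a \<Rightarrow> complex"
  assumes "f \<in> borel_measurable \<mu>" "g \<in> borel_measurable \<mu>" "x \<in> carrier G"
  shows "(\<lambda>y. f y * g (inv y \<otimes> x)) \<in> borel_measurable \<mu>"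
  using section2_measurable[OF conv_integrand_measurable[OF assms(1,2)] assms(3)] by simp

text \<open>Integrate over \<open>x\<close> first: by left invariance the inner integral is
  \<open>cmod (f y)\<close> times the norm of \<open>g\<close>.\<close>

lemma conv_integrand_finite:
  fixes f g :: "'a \<Rightarrow> complex"
  assumes f: "integrable \<mu> f" and g: "integrable \<mu> g"
  shows "(\<integral>\<^sup>+y. \<integral>\<^sup>+x. ennreal (cmod (f y * g (inv y \<otimes> x))) \<partial>\<mu> \<partial>\<mu>) < \<infinity>"
proof -
  have mg: "(\<lambda>x. ennreal (cmod (g x))) \<in> borel_measurable \<mu>" using g by measurable
  have mf: "(\<lambda>x. ennreal (cmod (f x))) \<in> borel_measurable \<mu>" using f by measurable
  have "(\<integral>\<^sup>+x. ennreal (cmod (f y * g (inv y \<otimes> x))) \<partial>\<mu>) = (\<integral>\<^sup>+x. ennreal (cmod (g x)) \<partial>\<mu>) * ennreal (cmod (f y))"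
    if "y \<in> space \<mu>" for y
  proof -
    have y: "inv y \<in> carrier G" using that by (simp add: space_haar)
    have "(\<integral>\<^sup>+x. ennreal (cmod (f y * g (inv y \<otimes> x))) \<partial>\<mu>) = (\<integral>\<^sup>+x. ennreal (cmod (f y)) * ennreal (cmod (g (inv y \<otimes> x))) \<partial>\<mu>)"
      by (simp add: norm_mult ennreal_mult)
    also have "\<dots> = ennreal (cmod (f y)) * (\<integral>\<^sup>+x. ennreal (cmod (g (inv y \<otimes> x))) \<partial>\<mu>)"
      by (rule nn_integral_cmult) (rule measurable_compose[OF measurable_lmult[OF y] mg])
    also have "(\<integral>\<^sup>+x. ennreal (cmod (g (inv y \<otimes> x))) \<partial>\<mu>) = (\<integral>\<^sup>+x. ennreal (cmod (g x)) \<partial>\<mu>)"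
      by (rule nn_integral_lmult[OF y mg])
    finally show ?thesis by (simp add: mult.commute)
  qed
  then have "(\<integral>\<^sup>+y. \<integral>\<^sup>+x. ennreal (cmod (f y * g (inv y \<otimes> x))) \<partial>\<mu> \<partial>\<mu>) =
      (\<integral>\<^sup>+y. (\<integral>\<^sup>+x. ennreal (cmod (g x)) \<partial>\<mu>) * ennreal (cmod (f y)) \<partial>\<mu>)" by (rule nn_integral_cong)
  also have "\<dots> = (\<integral>\<^sup>+x. ennreal (cmod (g x)) \<partial>\<mu>) * (\<integral>\<^sup>+y. ennreal (cmod (f y)) \<partial>\<mu>)"
    by (rule nn_integral_cmult[OF mf])
  also have "\<dots> < \<infinity>" using f g by (auto simp: integrable_iff_bounded ennreal_mult_less_top)
  finally show ?thesis .
qed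

text \<open>In the order with \<open>x\<close> inside, left invariance pulls the integral of
  \<open>g\<close> out for each \<open>y\<close>. The product formula obtained in this way is what
  makes \<open>aug\<close> a character.\<close>

lemma convolution_Fubini:
  fixes f g :: "'a \<Rightarrow> complex"
  assumes f: "integrable \<mu> f" and g: "integrable \<mu> g"
  shows "AE x in \<mu>. integrable \<mu> (\<lambda>y. f y * g (inv y \<otimes> x))" (is ?A)
    and "integrable \<mu> (conv f g)" (is ?B)
    and "(\<integral>x. conv f g x \<partial>\<mu>) = (\<integral>x. f x \<partial>\<mu>) * (\<integral>x. g x \<partial>\<mu>)" (is ?C)
proof -
  let ?F = "\<lambda>p. f (fst p) * g (inv (fst p) \<otimes> snd p)"
  have m: "?F \<in> borel_measurable borel2" using f g by (intro conv_integrand_measurable) auto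
  have fin: "(\<integral>\<^sup>+y. \<integral>\<^sup>+x. ennreal (cmod (?F (y, x))) \<partial>\<mu> \<partial>\<mu>) < \<infinity>"
    using conv_integrand_finite[OF f g] by simp
  have supp: "\<And>y x. y \<in> carrier G \<Longrightarrow> x \<in> carrier G \<Longrightarrow> ?F (y, x) \<noteq> 0 \<Longrightarrow> f y \<noteq> 0 \<and> g (inv y \<otimes> x) \<noteq> 0" by simp
  note Fub = Fubini_convolution[of ?F f g, OF m f g supp fin, simplified]
  show ?A using Fub(2) by simp
  show ?B using Fub(4) by (simp add: convolution_def)
  have "(\<integral>x. conv f g x \<partial>\<mu>) = (\<integral>y. \<integral>x. f y * g (inv y \<otimes> x) \<partial>\<mu> \<partial>\<mu>)"
    using Fub(5) by (simp add: convolution_def)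
  also have "\<dots> = (\<integral>y. f y * (\<integral>x. g x \<partial>\<mu>) \<partial>\<mu>)"
    using g by (intro Bochner_Integration.integral_cong) (auto simp: space_haar integral_lmult)
  finally show ?C by simp
qed

text \<open>Pointwise, \<open>conv f g\<close> is dominated by the convolution of the moduli, whose
  integral is the product of the two norms by the product formula.\<close>

lemma convolution_norm_le:
  fixes f g :: "'a \<Rightarrow> complex"
  assumes f: "integrable \<mu> f" and g: "integrable \<mu> g"
  shows "(\<integral>x. cmod (conv f g x) \<partial>\<mu>) \<le> (\<integral>x. cmod (f x) \<partial>\<mu>) * (\<integral>x. cmod (g x) \<partial>\<mu>)"
proof -
  let ?f = "\<lambda>x. complex_of_real (cmod (f x))" and ?g = "\<lambda>x. complex_of_real (cmod (g x))"
  have i: "integrable \<mu> ?f" "integrable \<mu> ?g" using f g by (auto intro: integrable_of_real)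
  have e: "conv ?f ?g x = complex_of_real (\<integral>y. cmod (f y) * cmod (g (inv y \<otimes> x)) \<partial>\<mu>)" for x
    unfolding convolution_def by (simp flip: of_real_mult add: integral_complex_of_real)
  have "cmod (conv f g x) \<le> Re (conv ?f ?g x)" for x
    unfolding e using integral_norm_bound[of \<mu> "\<lambda>y. f y * g (inv y \<otimes> x)"]
    by (simp add: convolution_def norm_mult)
  then have "(\<integral>x. cmod (conv f g x) \<partial>\<mu>) \<le> (\<integral>x. Re (conv ?f ?g x) \<partial>\<mu>)"
    using convolution_Fubini(2)[OF f g] convolution_Fubini(2)[OF i]
    by (intro integral_mono) auto
  also have "\<dots> = Re (\<integral>x. conv ?f ?g x \<partial>\<mu>)"
    using convolution_Fubini(2)[OF i] by simp
  also have "\<dots> = (\<integral>x. cmod (f x) \<partial>\<mu>) * (\<integral>x. cmod (g x) \<partial>\<mu>)"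
    unfolding convolution_Fubini(3)[OF i] integral_complex_of_real by simp
  finally show ?thesis .
qed

lemma convolution_cong_left:
  fixes f g :: "'a \<Rightarrow> complex"
  assumes f: "f \<in> borel_measurable \<mu>" "f' \<in> borel_measurable \<mu>" "AE x in \<mu>. f x = f' x" and g: "g \<in> borel_measurable \<mu>"
    and x: "x \<in> carrier G"
  shows "conv f g x = conv f' g x"
  unfolding convolution_def using f(3)
  by (intro integral_cong_AE conv_integrand_section f g x) (auto elim: eventually_mono)

lemma convolution_add_left:
  fixes f f' g :: "'a \<Rightarrow> complex"
  assumes f: "integrable \<mu> f" "integrable \<mu> f'" and g: "integrable \<mu> g"
  shows "AE x in \<mu>. conv (\<lambda>x. f x + f' x) g x = conv f g x + conv f' g x"
  using convolution_Fubini(1)[OF f(1) g] convolution_Fubini(1)[OF f(2) g]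
  by eventually_elim (simp add: convolution_def distrib_right)

lemma convolution_add_right:
  fixes f g g' :: "'a \<Rightarrow> complex"
  assumes f: "integrable \<mu> f" and g: "integrable \<mu> g" "integrable \<mu> g'"
  shows "AE x in \<mu>. conv f (\<lambda>x. g x + g' x) x = conv f g x + conv f g' x"
  using convolution_Fubini(1)[OF f g(1)] convolution_Fubini(1)[OF f g(2)]
  by eventually_elim (simp add: convolution_def distrib_left)

lemma convolution_scale_left: "conv (\<lambda>x. c * f x) g x = c * conv f g x"
  by (simp add: convolution_def mult.assoc)

lemma convolution_scale_right: "conv f (\<lambda>x. c * g x) x = c * conv f g x"
  by (simp add: convolution_def mult.left_commute)

text \<open>A change of \<open>g\<close> on a null set affects the integrand at the \<open>y\<close>
  for which \<open>inv y \<otimes> x\<close> is in that set, and left invariance does not directly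
  control inversion. The norm inequality avoids the question: the difference of \<open>g\<close> and
  \<open>g'\<close> has norm 0, so its convolution with \<open>f\<close> vanishes almost
  everywhere.\<close>

lemma convolution_cong_right:
  fixes f g :: "'a \<Rightarrow> complex"
  assumes f: "integrable \<mu> f" and g: "integrable \<mu> g" "integrable \<mu> g'" "AE x in \<mu>. g x = g' x"
  shows "AE x in \<mu>. conv f g x = conv f g' x"
proof -
  have sc: "conv f (\<lambda>x. (- 1) * g' x) x = (- 1) * conv f g' x" for x
    by (rule convolution_scale_right)
  define d where "d = (\<lambda>x. g x + (- 1) * g' x)"
  have d: "integrable \<mu> d" using g unfolding d_def by auto
  have "(\<integral>x. cmod (d x) \<partial>\<mu>) = (\<integral>x. 0 \<partial>\<mu>)"
    using g unfolding d_def by (intro integral_cong_AE) (auto elim: eventually_mono)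
  then have "(\<integral>x. cmod (conv f d x) \<partial>\<mu>) \<le> 0" using convolution_norm_le[OF f d] by simp
  moreover have i: "integrable \<mu> (\<lambda>x. cmod (conv f d x))" using convolution_Fubini(2)[OF f d] by simp
  ultimately have "(\<integral>x. cmod (conv f d x) \<partial>\<mu>) = 0" by (simp add: antisym)
  then have "AE x in \<mu>. cmod (conv f d x) = 0"
    using integral_nonneg_eq_0_iff_AE[OF i] by simp
  moreover have "AE x in \<mu>. conv f d x = conv f g x + conv f (\<lambda>x. (- 1) * g' x) x"
    unfolding d_def using g by (intro convolution_add_right f) auto
  ultimately show ?thesis by eventually_elim (simp only: sc norm_eq_zero, simp)
qed

text \<open>For almost every \<open>x\<close>, Fubini's theorem applies to \<open>(z, y) \<mapsto> f z * g (z\<inverse> y) * h (y\<inverse> x)\<close>.\<close>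

lemma convolution_assoc:
  fixes f g h :: "'a \<Rightarrow> complex"
  assumes f: "integrable \<mu> f" and g: "integrable \<mu> g" and h: "integrable \<mu> h"
  shows "AE x in \<mu>. conv (conv f g) h x = conv f (conv g h) x"
proof -
  let ?f = "\<lambda>x. complex_of_real (cmod (f x))" and ?g = "\<lambda>x. complex_of_real (cmod (g x))" and ?h = "\<lambda>x. complex_of_real (cmod (h x))"
  have i: "integrable \<mu> ?f" "integrable \<mu> ?g" "integrable \<mu> ?h" using f g h by (auto intro: integrable_of_real)
  let ?k = "conv ?f ?g"
  have k: "integrable \<mu> ?k" using convolution_Fubini(2)[OF i(1,2)] .
  \<comment> \<open>The exceptional \<open>x\<close> are those at which the triple convolution of
    the moduli fails to converge.\<close>
  have "AE x in \<mu>. integrable \<mu> (\<lambda>y. ?k y * ?h (inv y \<otimes> x))" by (rule convolution_Fubini(1)[OF k i(3)])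
  with AE_space show ?thesis
  proof eventually_elim
    fix x assume "x \<in> space \<mu>" and ik: "integrable \<mu> (\<lambda>y. ?k y * ?h (inv y \<otimes> x))"
    then have x: "x \<in> carrier G" by (simp add: space_haar)
    let ?F = "\<lambda>p. f (fst p) * g (inv (fst p) \<otimes> snd p) * h (inv (snd p) \<otimes> x)"
    have hx: "(\<lambda>y. h (inv y \<otimes> x)) \<in> borel_measurable \<mu>"
      using conv_integrand_section[of "\<lambda>_. 1" h x] h x by simp
    have m: "?F \<in> borel_measurable borel2"
      using f g by (intro borel_measurable_times[OF conv_integrand_measurable] measurable_compose[OF measurable_snd2 hx]) auto
    have supp: "\<And>z y. z \<in> carrier G \<Longrightarrow> y \<in> carrier G \<Longrightarrow> ?F (z, y) \<noteq> 0 \<Longrightarrow> f z \<noteq> 0 \<and> g (inv z \<otimes> y) \<noteq> 0" by simp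
    have mn: "(\<lambda>p. ennreal (cmod (F p))) \<in> borel_measurable borel2"
      if "F \<in> borel_measurable borel2" for F :: "'a \<times> 'a \<Rightarrow> complex" using that by measurable
    \<comment> \<open>Tonelli is used to see absolute integrability: in the other order, the inner
      integral is the convolution of the moduli of \<open>f\<close> and \<open>g\<close>, and the
      outer one is finite by the choice of \<open>x\<close>.\<close>
    have "Tonelli (\<lambda>p. ennreal (cmod (?F p)))"
      by (rule Tonelli_convolution[OF mn[OF m] f g]) auto
    then have "(\<integral>\<^sup>+z. \<integral>\<^sup>+y. ennreal (cmod (?F (z, y))) \<partial>\<mu> \<partial>\<mu>) = (\<integral>\<^sup>+y. \<integral>\<^sup>+z. ennreal (cmod (?F (z, y))) \<partial>\<mu> \<partial>\<mu>)"
      by (simp add: Tonelli_def)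
    also have "\<dots> = (\<integral>\<^sup>+y. ennreal (cmod (?k y * ?h (inv y \<otimes> x))) \<partial>\<mu>)"
    proof (rule nn_integral_cong_AE)
      have "AE y in \<mu>. integrable \<mu> (\<lambda>z. ?f z * ?g (inv z \<otimes> y))" by (rule convolution_Fubini(1)[OF i(1,2)])
      then show "AE y in \<mu>. (\<integral>\<^sup>+z. ennreal (cmod (?F (z, y))) \<partial>\<mu>) = ennreal (cmod (?k y * ?h (inv y \<otimes> x)))"
      proof eventually_elim
        fix y assume iy: "integrable \<mu> (\<lambda>z. ?f z * ?g (inv z \<otimes> y))"
        then have iy': "integrable \<mu> (\<lambda>z. cmod (f z) * cmod (g (inv z \<otimes> y)))"
          using integrable_norm[OF iy] by (simp add: norm_mult)
        have ky: "?k y = complex_of_real (\<integral>z. cmod (f z) * cmod (g (inv z \<otimes> y)) \<partial>\<mu>)"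
          unfolding convolution_def by (simp flip: of_real_mult add: integral_complex_of_real)
        have "(\<integral>\<^sup>+z. ennreal (cmod (?F (z, y))) \<partial>\<mu>) = (\<integral>\<^sup>+z. ennreal (cmod (f z) * cmod (g (inv z \<otimes> y)) * cmod (h (inv y \<otimes> x))) \<partial>\<mu>)"
          by (simp add: norm_mult)
        also have "\<dots> = ennreal (\<integral>z. cmod (f z) * cmod (g (inv z \<otimes> y)) * cmod (h (inv y \<otimes> x)) \<partial>\<mu>)"
          using iy' by (intro nn_integral_eq_integral) auto
        also have "(\<integral>z. cmod (f z) * cmod (g (inv z \<otimes> y)) * cmod (h (inv y \<otimes> x)) \<partial>\<mu>) = cmod (?k y * ?h (inv y \<otimes> x))"
          unfolding ky by (simp add: norm_mult abs_of_nonneg integral_nonneg)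
        finally show "(\<integral>\<^sup>+z. ennreal (cmod (?F (z, y))) \<partial>\<mu>) = ennreal (cmod (?k y * ?h (inv y \<otimes> x)))" .
      qed
    qed
    also have "\<dots> < \<infinity>" using ik by (auto simp: integrable_iff_bounded)
    finally have fin: "(\<integral>\<^sup>+z. \<integral>\<^sup>+y. ennreal (cmod (?F (z, y))) \<partial>\<mu> \<partial>\<mu>) < \<infinity>" .
    have "conv (conv f g) h x = (\<integral>y. \<integral>z. ?F (z, y) \<partial>\<mu> \<partial>\<mu>)"
      unfolding convolution_def by simp
    also have "\<dots> = (\<integral>z. \<integral>y. ?F (z, y) \<partial>\<mu> \<partial>\<mu>)"
      by (rule Fubini_convolution(5)[of ?F f g, OF m f g supp fin, symmetric]) auto
    also have "\<dots> = (\<integral>z. f z * conv g h (inv z \<otimes> x) \<partial>\<mu>)"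
    proof (rule Bochner_Integration.integral_cong[OF refl])
      fix z assume "z \<in> space \<mu>"
      then have z: "z \<in> carrier G" by (simp add: space_haar)
      let ?\<phi> = "\<lambda>y. g (inv z \<otimes> y) * h (inv y \<otimes> x)"
      have gm: "g \<in> borel_measurable \<mu>" using g by simp
      have "?\<phi> \<in> borel_measurable \<mu>"
        using measurable_compose[OF measurable_lmult[OF inv_closed[OF z]] gm] hx by (rule borel_measurable_times)
      from integral_lmult[OF z this] have "(\<integral>y. ?\<phi> y \<partial>\<mu>) = (\<integral>y. ?\<phi> (z \<otimes> y) \<partial>\<mu>)" by simp
      also have "\<dots> = conv g h (inv z \<otimes> x)"
        unfolding convolution_def
      proof (rule Bochner_Integration.integral_cong[OF refl])
        fix y assume "y \<in> space \<mu>"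
        then have y: "y \<in> carrier G" by (simp add: space_haar)
        show "?\<phi> (z \<otimes> y) = g y * h (inv y \<otimes> (inv z \<otimes> x))"
          using x y z by (simp add: inv_mult_group m_assoc flip: m_assoc[of "inv z" z y])
      qed
      finally show "(\<integral>y. ?F (z, y) \<partial>\<mu>) = f z * conv g h (inv z \<otimes> x)"
        by (simp add: mult.assoc)
    qed
    also have "\<dots> = conv f (conv g h) x" by (simp add: convolution_def)
    finally show "conv (conv f g) h x = conv f (conv g h) x" .
  qed
qed

lemma ltrans_integrable:
  assumes "x \<in> carrier G" "integrable \<mu> f"
  shows "integrable \<mu> (ltrans G x f)" "(\<integral>y. ltrans G x f y \<partial>\<mu>) = (\<integral>y. f y \<partial>\<mu>)"
    "(\<integral>y. cmod (ltrans G x f y) \<partial>\<mu>) = (\<integral>y. cmod (f y) \<partial>\<mu>)"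
proof -
  have x: "inv x \<in> carrier G" using assms(1) by simp
  show "integrable \<mu> (ltrans G x f)" "(\<integral>y. ltrans G x f y \<partial>\<mu>) = (\<integral>y. f y \<partial>\<mu>)"
    using integrable_lmult[OF x assms(2)] integral_lmult[OF x, of f] assms(2) by (auto simp: ltrans_def)
  have "(\<integral>y. complex_of_real (cmod (f (inv x \<otimes> y))) \<partial>\<mu>) = (\<integral>y. complex_of_real (cmod (f y)) \<partial>\<mu>)"
    by (rule integral_lmult[OF x, of "\<lambda>y. complex_of_real (cmod (f y))"]) (use assms(2) in measurable)
  then show "(\<integral>y. cmod (ltrans G x f y) \<partial>\<mu>) = (\<integral>y. cmod (f y) \<partial>\<mu>)"
    by (simp add: ltrans_def integral_complex_of_real)
qed

text \<open>The substitution of \<open>x \<otimes> y\<close> for \<open>y\<close>. A translate of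
  \<open>a * n\<close> thereby becomes the convolution of a translate of \<open>a\<close> with the
  same \<open>n\<close>.\<close>

lemma ltrans_convolution:
  assumes x: "x \<in> carrier G" and z: "z \<in> carrier G" and f: "f \<in> borel_measurable \<mu>" and g: "g \<in> borel_measurable \<mu>"
  shows "conv (ltrans G x f) g z = ltrans G x (conv f g) z"
proof -
  let ?\<phi> = "\<lambda>y. f (inv x \<otimes> y) * g (inv y \<otimes> z)"
  have fm: "(\<lambda>y. f (inv x \<otimes> y)) \<in> borel_measurable \<mu>" using measurable_compose[OF measurable_lmult f] x by simp
  have m: "?\<phi> \<in> borel_measurable \<mu>" by (rule conv_integrand_section[OF fm g z])
  have "conv (ltrans G x f) g z = (\<integral>y. ?\<phi> y \<partial>\<mu>)" by (simp add: convolution_def ltrans_def)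
  also have "\<dots> = (\<integral>y. ?\<phi> (x \<otimes> y) \<partial>\<mu>)" using integral_lmult[OF x m] by simp
  also have "\<dots> = (\<integral>y. f y * g (inv y \<otimes> (inv x \<otimes> z)) \<partial>\<mu>)"
  proof (rule Bochner_Integration.integral_cong[OF refl])
    fix y assume "y \<in> space \<mu>"
    then have y: "y \<in> carrier G" by (simp add: space_haar)
    show "?\<phi> (x \<otimes> y) = f y * g (inv y \<otimes> (inv x \<otimes> z))"
      using x y z by (simp add: inv_mult_group m_assoc flip: m_assoc[of "inv x" x y])
  qed
  finally show ?thesis by (simp add: convolution_def ltrans_def)
qed

end

section \<open>Normed spaces and \<open>L\<^sup>1(G)\<close>\<close>

lemma complex_field_simps [simp]:
  "carrier complex_field = UNIV" "mult complex_field = (*)" "one complex_field = 1"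
  "zero complex_field = 0" "add complex_field = (+)"
  by (auto simp: ring_of_type_algebra_def)

context normed_space
begin

lemma scale_closed [simp]: "x \<in> carrier V \<Longrightarrow> c \<odot> x \<in> carrier V"
  by (rule smult_closed) auto

lemma scale_add_left: "x \<in> carrier V \<Longrightarrow> (a + b) \<odot> x = a \<odot> x \<oplus> b \<odot> x"
  using smult_l_distr[of a b x] by simp

lemma scale_add_right: "x \<in> carrier V \<Longrightarrow> y \<in> carrier V \<Longrightarrow> a \<odot> (x \<oplus> y) = a \<odot> x \<oplus> a \<odot> y"
  using smult_r_distr[of a x y] by simp

lemma scale_scale: "x \<in> carrier V \<Longrightarrow> a \<odot> (b \<odot> x) = (a * b) \<odot> x"
  using smult_assoc1[of a b x] by simp

lemma scale_one [simp]: "x \<in> carrier V \<Longrightarrow> 1 \<odot> x = x"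
  using smult_one[of x] by simp

lemma scale_zero [simp]: "x \<in> carrier V \<Longrightarrow> 0 \<odot> x = \<zero>"
  using smult_l_null[of x] by simp

lemma uminus_eq_scale: "x \<in> carrier V \<Longrightarrow> \<ominus> x = (- 1) \<odot> x"
proof -
  assume x: "x \<in> carrier V"
  have "(- 1) \<odot> x \<oplus> x = ((- 1) + 1) \<odot> x" using x by (subst scale_add_left) auto
  then have "(- 1) \<odot> x \<oplus> x = \<zero>" using x by simp
  then show ?thesis using x by (intro M.minus_equality) auto
qed

lemma minus_eq_scale: "x \<in> carrier V \<Longrightarrow> y \<in> carrier V \<Longrightarrow> x \<ominus> y = x \<oplus> (- 1) \<odot> y"
  by (simp add: a_minus_def uminus_eq_scale)

lemma vnorm_zero [simp]: "vnorm V \<zero> = 0"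
  using vnorm_eq_0[of \<zero>] by simp

lemma vnorm_minus_commute: "x \<in> carrier V \<Longrightarrow> y \<in> carrier V \<Longrightarrow> vnorm V (x \<ominus> y) = vnorm V (y \<ominus> x)"
proof -
  assume xy: "x \<in> carrier V" "y \<in> carrier V"
  have "y \<ominus> x = (- 1) \<odot> (x \<ominus> y)"
    using xy by (simp add: minus_eq_scale scale_add_right scale_scale M.a_comm)
  then show ?thesis using xy by (simp add: vnorm_smult)
qed

lemma vnorm_nonneg: "x \<in> carrier V \<Longrightarrow> 0 \<le> vnorm V x"
proof -
  assume x: "x \<in> carrier V"
  have "vnorm V (x \<oplus> (- 1) \<odot> x) \<le> vnorm V x + vnorm V ((- 1) \<odot> x)" using x by (intro vnorm_add) auto
  moreover have "x \<oplus> (- 1) \<odot> x = \<zero>" using x by (simp flip: uminus_eq_scale add: M.r_neg)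
  ultimately show ?thesis using x by (simp add: vnorm_smult)
qed

lemma minus_closed' [simp]: "x \<in> carrier V \<Longrightarrow> y \<in> carrier V \<Longrightarrow> x \<ominus> y \<in> carrier V"
  by (rule M.minus_closed)

lemma minus_split: "x \<in> carrier V \<Longrightarrow> y \<in> carrier V \<Longrightarrow> z \<in> carrier V \<Longrightarrow> x \<ominus> z = (x \<ominus> y) \<oplus> (y \<ominus> z)"
  by (simp add: a_minus_def M.a_assoc M.r_neg1)

lemma minus_triangle: "x \<in> carrier V \<Longrightarrow> y \<in> carrier V \<Longrightarrow> z \<in> carrier V \<Longrightarrow>
    vnorm V (x \<ominus> z) \<le> vnorm V (x \<ominus> y) + vnorm V (y \<ominus> z)"
  using vnorm_add[of "x \<ominus> y" "y \<ominus> z"] by (simp add: minus_split[of x y z])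

lemma minus_eq_zero_iff: "x \<in> carrier V \<Longrightarrow> y \<in> carrier V \<Longrightarrow> x \<ominus> y = \<zero> \<longleftrightarrow> x = y"
proof
  assume xy: "x \<in> carrier V" "y \<in> carrier V" and "x \<ominus> y = \<zero>"
  then have "\<ominus> (\<ominus> y) = x" by (intro M.minus_equality) (auto simp: a_minus_def)
  then show "x = y" using xy by simp
qed (simp add: a_minus_def M.r_neg)

lemma Metric_space_ndist: "Metric_space (carrier V) (ndist V)"
proof
  show "0 \<le> ndist V x y" for x y by (simp add: ndist_def vnorm_nonneg)
  show "ndist V x y = ndist V y x" for x y by (simp add: ndist_def vnorm_minus_commute)
  show "ndist V x y = 0 \<longleftrightarrow> x = y" if "x \<in> carrier V" "y \<in> carrier V" for x y
    using that by (simp add: ndist_def vnorm_eq_0 minus_eq_zero_iff)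
  show "ndist V x z \<le> ndist V x y + ndist V y z" if "x \<in> carrier V" "y \<in> carrier V" "z \<in> carrier V" for x y z
    using that by (simp add: ndist_def minus_triangle)
qed

end

section \<open>Integrals over measurable sets determine a function almost everywhere\<close>

lemma integrable_times_indicator:
  fixes f :: "'a \<Rightarrow> complex"
  assumes "E \<in> sets M" "integrable M f"
  shows "integrable M (\<lambda>x. f x * indicator E x)"
proof -
  have "(\<lambda>x. indicator E x *\<^sub>R f x) = (\<lambda>x. f x * indicator E x)" by (auto simp: indicator_def)
  then show ?thesis using integrable_mult_indicator[OF assms] by simp
qed

text \<open>Test on the set where the function is positive, then do the same with its
  negative.\<close>

lemma integral_indicators_zero_imp_AE_real:
  fixes f :: "'a \<Rightarrow> real"
  assumes f: "integrable M f" and z: "\<And>E. E \<in> sets M \<Longrightarrow> (\<integral>x. f x * indicator E x \<partial>M) = 0"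
  shows "AE x in M. f x = 0"
proof -
  have half: "AE x in M. h x \<le> 0" if h: "integrable M h" "\<And>E. E \<in> sets M \<Longrightarrow> (\<integral>x. h x * indicator E x \<partial>M) = 0"
    for h :: "'a \<Rightarrow> real"
  proof -
    let ?E = "{x \<in> space M. h x > 0}"
    have E: "?E \<in> sets M" using h(1) by measurable
    have i: "integrable M (\<lambda>x. h x * indicator ?E x)" using h(1) E by (simp add: integrable_real_mult_indicator)
    have "AE x in M. h x * indicator ?E x = 0"
      using integral_nonneg_eq_0_iff_AE[OF i] h(2)[OF E] by (auto simp: indicator_def)
    with AE_space show ?thesis by eventually_elim (auto simp: indicator_def split: if_splits)
  qed
  have "AE x in M. f x \<le> 0" using half[OF f z] .
  moreover have "AE x in M. - f x \<le> 0" using f z by (intro half) auto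
  ultimately show ?thesis by eventually_elim simp
qed

lemma integral_indicators_zero_imp_AE:
  fixes f :: "'a \<Rightarrow> complex"
  assumes f: "integrable M f" and z: "\<And>E. E \<in> sets M \<Longrightarrow> (\<integral>x. f x * indicator E x \<partial>M) = 0"
  shows "AE x in M. f x = 0"
proof -
  have i: "integrable M (\<lambda>x. f x * indicator E x)" if "E \<in> sets M" for E
    using that f by (rule integrable_times_indicator)
  have e: "(\<lambda>x. Re (f x * indicator E x)) = (\<lambda>x. Re (f x) * indicator E x)"
    "(\<lambda>x. Im (f x * indicator E x)) = (\<lambda>x. Im (f x) * indicator E x)" for E by (auto simp: indicator_def)
  have "AE x in M. Re (f x) = 0"
  proof (rule integral_indicators_zero_imp_AE_real)
    fix E assume E: "E \<in> sets M"
    have "(\<integral>x. Re (f x * indicator E x) \<partial>M) = 0" by (simp only: integral_Re[OF i[OF E]] z[OF E] zero_complex.simps)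
    then show "(\<integral>x. Re (f x) * indicator E x \<partial>M) = 0" unfolding e .
  qed (use f in simp)
  moreover have "AE x in M. Im (f x) = 0"
  proof (rule integral_indicators_zero_imp_AE_real)
    fix E assume E: "E \<in> sets M"
    have "(\<integral>x. Im (f x * indicator E x) \<partial>M) = 0" by (simp only: integral_Im[OF i[OF E]] z[OF E] zero_complex.simps)
    then show "(\<integral>x. Im (f x) * indicator E x \<partial>M) = 0" unfolding e .
  qed (use f in simp)
  ultimately show ?thesis by eventually_elim (simp add: complex_eq_iff)
qed

context left_haar_measure
begin

lemma equiv_ae_rel: "equiv {f. integrable \<mu> f} (ae_rel \<mu>)"
proof (rule equivI)
  show "ae_rel \<mu> \<subseteq> {f. integrable \<mu> f} \<times> {f. integrable \<mu> f}" by (auto simp: ae_rel_def)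
  show "refl_on {f. integrable \<mu> f} (ae_rel \<mu>)" by (auto simp: refl_on_def ae_rel_def)
  show "sym (ae_rel \<mu>)" by (auto simp: sym_def ae_rel_def elim: eventually_mono)
  show "trans (ae_rel \<mu>)" by (auto simp: trans_def ae_rel_def elim: eventually_elim2)
qed

abbreviation ae_class :: "('a \<Rightarrow> complex) \<Rightarrow> ('a \<Rightarrow> complex) set" where
  "ae_class f \<equiv> ae_rel \<mu> `` {f}"

abbreviation "LG \<equiv> L1 G \<mu>"

lemma carrier_L1: "carrier LG = {f. integrable \<mu> f} // ae_rel \<mu>"
  by (simp add: L1_def)

lemma ae_class_in_L1: "integrable \<mu> f \<Longrightarrow> ae_class f \<in> carrier LG"
  unfolding carrier_L1 by (rule quotientI) simp

lemma rep_L1: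
  assumes "X \<in> carrier LG"
  shows "integrable \<mu> (rep X)" "ae_class (rep X) = X"
proof -
  obtain f where f: "integrable \<mu> f" "X = ae_class f" using assms unfolding carrier_L1 by (auto elim!: quotientE)
  have "f \<in> X" using f equiv_class_self[OF equiv_ae_rel, of f] by simp
  then have r: "rep X \<in> X" unfolding rep_def by (rule someI[of "\<lambda>x. x \<in> X"])
  then show "integrable \<mu> (rep X)" using f by (auto simp: ae_rel_def)
  show "ae_class (rep X) = X" using r f equiv_class_eq[OF equiv_ae_rel, of f "rep X"] by auto
qed

lemma rep_ae_class: "integrable \<mu> f \<Longrightarrow> AE x in \<mu>. rep (ae_class f) x = f x"
proof -
  assume f: "integrable \<mu> f"
  have "f \<in> ae_class f" using f by (auto simp: ae_rel_def)
  then have "rep (ae_class f) \<in> ae_class f" unfolding rep_def by (rule someI[of "\<lambda>x. x \<in> ae_class f"])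
  then show ?thesis by (auto simp: ae_rel_def elim: eventually_mono)
qed

lemma ae_class_eqI: "integrable \<mu> f \<Longrightarrow> integrable \<mu> g \<Longrightarrow> AE x in \<mu>. f x = g x \<Longrightarrow> ae_class f = ae_class g"
  by (rule equiv_class_eq[OF equiv_ae_rel]) (simp add: ae_rel_def)

lemma L1_eqI:
  assumes "X \<in> carrier LG" "Y \<in> carrier LG" "AE x in \<mu>. rep X x = rep Y x"
  shows "X = Y"
  using ae_class_eqI[of "rep X" "rep Y"] rep_L1[OF assms(1)] rep_L1[OF assms(2)] assms(3) by simp

text \<open>Operations in \<open>L\<^sup>1(G)\<close> go through chosen representatives, which are
  known only almost everywhere. Algebraic laws are therefore verified by bringing both sides to one
  explicit function \<open>h\<close>.\<close>

lemma L1_eqI':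
  assumes "X \<in> carrier LG" "Y \<in> carrier LG"
    "AE x in \<mu>. rep X x = h x" "AE x in \<mu>. rep Y x = h x"
  shows "X = Y"
  using assms(3,4) by (intro L1_eqI assms(1,2)) (auto elim: eventually_elim2)

lemma L1_zero: "\<zero>\<^bsub>LG\<^esub> \<in> carrier LG" "AE x in \<mu>. rep \<zero>\<^bsub>LG\<^esub> x = 0"
  using ae_class_in_L1[of "\<lambda>_. 0"] rep_ae_class[of "\<lambda>_. 0"] by (auto simp: L1_def)

lemma L1_add:
  assumes "X \<in> carrier LG" "Y \<in> carrier LG"
  shows "X \<oplus>\<^bsub>LG\<^esub> Y \<in> carrier LG" "AE x in \<mu>. rep (X \<oplus>\<^bsub>LG\<^esub> Y) x = rep X x + rep Y x"
  using ae_class_in_L1[of "\<lambda>x. rep X x + rep Y x"] rep_ae_class[of "\<lambda>x. rep X x + rep Y x"]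
    rep_L1(1)[OF assms(1)] rep_L1(1)[OF assms(2)] by (auto simp: L1_def)

lemma L1_scale:
  assumes "X \<in> carrier LG"
  shows "c \<odot>\<^bsub>LG\<^esub> X \<in> carrier LG" "AE x in \<mu>. rep (c \<odot>\<^bsub>LG\<^esub> X) x = c * rep X x"
  using ae_class_in_L1[of "\<lambda>x. c * rep X x"] rep_ae_class[of "\<lambda>x. c * rep X x"]
    rep_L1(1)[OF assms(1)] by (auto simp: L1_def)

lemma L1_mult:
  assumes "X \<in> carrier LG" "Y \<in> carrier LG"
  shows "X \<otimes>\<^bsub>LG\<^esub> Y \<in> carrier LG"
    "AE x in \<mu>. rep (X \<otimes>\<^bsub>LG\<^esub> Y) x = conv (rep X) (rep Y) x"
  using ae_class_in_L1[of "conv (rep X) (rep Y)"] rep_ae_class[of "conv (rep X) (rep Y)"]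
    convolution_Fubini(2)[OF rep_L1(1)[OF assms(1)] rep_L1(1)[OF assms(2)]] by (auto simp: L1_def)

lemma L1_ltrans:
  assumes "X \<in> carrier LG" "x \<in> carrier G"
  shows "L1_ltrans G \<mu> x X \<in> carrier LG"
    "AE y in \<mu>. rep (L1_ltrans G \<mu> x X) y = ltrans G x (rep X) y"
  unfolding L1_ltrans_def using ae_class_in_L1 rep_ae_class ltrans_integrable(1)[OF assms(2) rep_L1(1)[OF assms(1)]] by auto

lemma L1_vnorm: "vnorm LG X = (\<integral>x. cmod (rep X x) \<partial>\<mu>)"
  by (simp add: L1_def)

lemma L1_normed_space: "normed_space LG"
proof -
  have ab: "abelian_group LG"
  proof (rule abelian_groupI)
    fix X Y Z assume X: "X \<in> carrier LG" and Y: "Y \<in> carrier LG" and Z: "Z \<in> carrier LG"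
    note a = L1_add(2)[OF L1_add(1)[OF X Y] Z] L1_add(2)[OF X Y] L1_add(2)[OF X L1_add(1)[OF Y Z]] L1_add(2)[OF Y Z]
    show "X \<oplus>\<^bsub>LG\<^esub> Y \<oplus>\<^bsub>LG\<^esub> Z = X \<oplus>\<^bsub>LG\<^esub> (Y \<oplus>\<^bsub>LG\<^esub> Z)"
      by (rule L1_eqI, (intro L1_add(1) X Y Z)[1], (intro L1_add(1) X Y Z)[1],
        use a in eventually_elim, simp)
  next
    fix X Y assume X: "X \<in> carrier LG" and Y: "Y \<in> carrier LG"
    show "X \<oplus>\<^bsub>LG\<^esub> Y = Y \<oplus>\<^bsub>LG\<^esub> X"
      by (rule L1_eqI, (intro L1_add(1) X Y)[1], (intro L1_add(1) X Y)[1],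
        use L1_add(2)[OF X Y] L1_add(2)[OF Y X] in eventually_elim, simp)
  next
    fix X assume X: "X \<in> carrier LG"
    show "\<zero>\<^bsub>LG\<^esub> \<oplus>\<^bsub>LG\<^esub> X = X"
      by (rule L1_eqI, (intro L1_add(1) X L1_zero(1))[1], (intro L1_add(1) X L1_zero(1))[1],
        use L1_add(2)[OF L1_zero(1) X] L1_zero(2) in eventually_elim, simp)
    have "(- 1) \<odot>\<^bsub>LG\<^esub> X \<oplus>\<^bsub>LG\<^esub> X = \<zero>\<^bsub>LG\<^esub>"
      by (rule L1_eqI, (intro L1_add(1) X L1_zero(1) L1_scale(1))[1], (intro L1_add(1) X L1_zero(1) L1_scale(1))[1],
        use L1_add(2)[OF L1_scale(1)[OF X, of "- 1"] X] L1_zero(2) L1_scale(2)[OF X, of "- 1"] in eventually_elim, simp)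
    then show "\<exists>Y\<in>carrier LG. Y \<oplus>\<^bsub>LG\<^esub> X = \<zero>\<^bsub>LG\<^esub>" using L1_scale(1)[OF X] by blast
  qed (auto intro: L1_add L1_zero)
  have mo: "module complex_field LG"
  proof (rule moduleI)
    fix a b and X assume X: "X \<in> carrier LG"
    show "(a \<oplus>\<^bsub>complex_field\<^esub> b) \<odot>\<^bsub>LG\<^esub> X = a \<odot>\<^bsub>LG\<^esub> X \<oplus>\<^bsub>LG\<^esub> b \<odot>\<^bsub>LG\<^esub> X"
      by (rule L1_eqI, (intro L1_add(1) X L1_scale(1))[1], (intro L1_add(1) X L1_scale(1))[1],
        use L1_add(2)[OF L1_scale(1)[OF X, of a] L1_scale(1)[OF X, of b]] L1_scale(2)[OF X, of a] L1_scale(2)[OF X, of b] L1_scale(2)[OF X, of "a + b"] in eventually_elim, simp add: distrib_right)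
    show "(a \<otimes>\<^bsub>complex_field\<^esub> b) \<odot>\<^bsub>LG\<^esub> X = a \<odot>\<^bsub>LG\<^esub> (b \<odot>\<^bsub>LG\<^esub> X)"
      by (rule L1_eqI, (intro L1_add(1) X L1_scale(1))[1], (intro L1_add(1) X L1_scale(1))[1],
        use L1_scale(2)[OF L1_scale(1)[OF X, of b], of a] L1_scale(2)[OF X, of b] L1_scale(2)[OF X, of "a * b"] in eventually_elim, simp add: mult.assoc)
    show "\<one>\<^bsub>complex_field\<^esub> \<odot>\<^bsub>LG\<^esub> X = X"
      by (rule L1_eqI, (intro X L1_scale(1))[1], (intro X L1_scale(1))[1],
        use L1_scale(2)[OF X, of 1] in eventually_elim, simp)
  next
    fix a X Y assume X: "X \<in> carrier LG" and Y: "Y \<in> carrier LG"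
    show "a \<odot>\<^bsub>LG\<^esub> (X \<oplus>\<^bsub>LG\<^esub> Y) = a \<odot>\<^bsub>LG\<^esub> X \<oplus>\<^bsub>LG\<^esub> a \<odot>\<^bsub>LG\<^esub> Y"
      by (rule L1_eqI, (intro L1_add(1) X Y L1_scale(1))[1], (intro L1_add(1) X Y L1_scale(1))[1],
        use L1_add(2)[OF X Y] L1_scale(2)[OF L1_add(1)[OF X Y], of a] L1_scale(2)[OF X, of a] L1_scale(2)[OF Y, of a] L1_add(2)[OF L1_scale(1)[OF X, of a] L1_scale(1)[OF Y, of a]] in eventually_elim, simp add: distrib_left)
  qed (auto intro: L1_scale ab cring_from_type_algebra)
  show ?thesis
  proof (intro normed_space.intro mo normed_space_axioms.intro)
    fix X assume X: "X \<in> carrier LG"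
    have n: "integrable \<mu> (\<lambda>x. cmod (rep X x))" using rep_L1(1)[OF X] by simp
    show "vnorm LG X = 0 \<longleftrightarrow> X = \<zero>\<^bsub>LG\<^esub>"
    proof
      assume "vnorm LG X = 0"
      then have "AE x in \<mu>. rep X x = 0"
        using integral_nonneg_eq_0_iff_AE[OF n] by (simp add: L1_vnorm)
      then show "X = \<zero>\<^bsub>LG\<^esub>" using L1_zero(2) by (intro L1_eqI' X L1_zero(1)) auto
    next
      assume "X = \<zero>\<^bsub>LG\<^esub>"
      then have "AE x in \<mu>. cmod (rep X x) = 0" using L1_zero(2) by (auto elim: eventually_mono)
      then show "vnorm LG X = 0" using integral_nonneg_eq_0_iff_AE[OF n] by (simp add: L1_vnorm)
    qed
    fix c
    have "(\<integral>x. cmod (rep (c \<odot>\<^bsub>LG\<^esub> X) x) \<partial>\<mu>) = (\<integral>x. cmod c * cmod (rep X x) \<partial>\<mu>)"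
      using L1_scale(2)[OF X, of c] rep_L1(1)[OF X] rep_L1(1)[OF L1_scale(1)[OF X, of c]]
      by (intro integral_cong_AE) (auto elim!: eventually_mono simp: norm_mult)
    then show "vnorm LG (c \<odot>\<^bsub>LG\<^esub> X) = cmod c * vnorm LG X" by (simp add: L1_vnorm)
  next
    fix X Y assume X: "X \<in> carrier LG" and Y: "Y \<in> carrier LG"
    have "(\<integral>x. cmod (rep (X \<oplus>\<^bsub>LG\<^esub> Y) x) \<partial>\<mu>) \<le> (\<integral>x. cmod (rep X x) + cmod (rep Y x) \<partial>\<mu>)"
      using L1_add(2)[OF X Y] rep_L1(1)[OF X] rep_L1(1)[OF Y] rep_L1(1)[OF L1_add(1)[OF X Y]]
      by (intro integral_mono_AE) (auto elim!: eventually_mono simp: norm_triangle_ineq)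
    then show "vnorm LG (X \<oplus>\<^bsub>LG\<^esub> Y) \<le> vnorm LG X + vnorm LG Y"
      using rep_L1(1)[OF X] rep_L1(1)[OF Y] by (simp add: L1_vnorm)
  qed
qed

text \<open>These functionals stand in for the dual of \<open>L\<^sup>1(G)\<close>. They are
  contractive and separate points, so neither the Hahn-Banach theorem nor a description of the dual
  has to be invoked.\<close>

definition tau :: "'a set \<Rightarrow> ('a \<Rightarrow> complex) set \<Rightarrow> complex" where
  "tau E X = (\<integral>x. rep X x * indicator E x \<partial>\<mu>)"

lemma tau_eq:
  assumes "E \<in> sets \<mu>" "X \<in> carrier LG" "integrable \<mu> h" "AE x in \<mu>. rep X x = h x"
  shows "tau E X = (\<integral>x. h x * indicator E x \<partial>\<mu>)"
  unfolding tau_def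
  using assms integrable_times_indicator[OF assms(1)] rep_L1(1)[OF assms(2)]
  by (intro integral_cong_AE) (auto elim: eventually_mono)

lemma tau_add:
  assumes "E \<in> sets \<mu>" "X \<in> carrier LG" "Y \<in> carrier LG"
  shows "tau E (X \<oplus>\<^bsub>LG\<^esub> Y) = tau E X + tau E Y"
proof -
  note i = rep_L1(1)[OF assms(2)] rep_L1(1)[OF assms(3)]
  have "tau E (X \<oplus>\<^bsub>LG\<^esub> Y) = (\<integral>x. (rep X x + rep Y x) * indicator E x \<partial>\<mu>)"
    using assms i by (intro tau_eq L1_add) auto
  also have "\<dots> = tau E X + tau E Y"
    unfolding tau_def distrib_right using i integrable_times_indicator[OF assms(1)]
    by (intro Bochner_Integration.integral_add) auto
  finally show ?thesis .
qed

lemma tau_scale: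
  assumes "E \<in> sets \<mu>" "X \<in> carrier LG"
  shows "tau E (c \<odot>\<^bsub>LG\<^esub> X) = c * tau E X"
proof -
  have "tau E (c \<odot>\<^bsub>LG\<^esub> X) = (\<integral>x. (c * rep X x) * indicator E x \<partial>\<mu>)"
    using assms rep_L1(1)[OF assms(2)] by (intro tau_eq L1_scale) auto
  then show ?thesis by (simp add: tau_def mult.assoc)
qed

lemma tau_bound:
  assumes "E \<in> sets \<mu>" "X \<in> carrier LG"
  shows "cmod (tau E X) \<le> vnorm LG X"
proof -
  have "cmod (tau E X) \<le> (\<integral>x. cmod (rep X x * indicator E x) \<partial>\<mu>)" unfolding tau_def by (rule integral_norm_bound)
  also have "\<dots> \<le> (\<integral>x. cmod (rep X x) \<partial>\<mu>)"
    using rep_L1(1)[OF assms(2)] integrable_times_indicator[OF assms(1)]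
    by (intro integral_mono) (auto simp: indicator_def)
  finally show ?thesis by (simp add: L1_vnorm)
qed

lemma tau_separating:
  assumes "X \<in> carrier LG" "\<And>E. E \<in> sets \<mu> \<Longrightarrow> tau E X = 0"
  shows "X = \<zero>\<^bsub>LG\<^esub>"
proof -
  have "AE x in \<mu>. rep X x = 0"
    using assms rep_L1(1) unfolding tau_def by (intro integral_indicators_zero_imp_AE) auto
  then show ?thesis using L1_zero by (intro L1_eqI' assms(1)) auto
qed

text \<open>The augmentation character, i.e. the trivial character of the group integrated up.
  Written as a \<open>tau\<close>, it inherits linearity and contractivity and belongs to the
  separating family used for tensors.\<close>

definition aug :: "('a \<Rightarrow> complex) set \<Rightarrow> complex" where
  "aug X = tau (carrier G) X"

lemma carrier_sets: "carrier G \<in> sets \<mu>"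
  using sets.top[of \<mu>] by (simp add: space_haar)

lemma aug_eq: "aug X = (\<integral>x. rep X x \<partial>\<mu>)"
  unfolding aug_def tau_def by (intro Bochner_Integration.integral_cong) (auto simp: space_haar)

lemma aug_mult:
  assumes "X \<in> carrier LG" "Y \<in> carrier LG"
  shows "aug (X \<otimes>\<^bsub>LG\<^esub> Y) = aug X * aug Y"
proof -
  note i = rep_L1(1)[OF assms(1)] rep_L1(1)[OF assms(2)]
  have "aug (X \<otimes>\<^bsub>LG\<^esub> Y) = (\<integral>x. conv (rep X) (rep Y) x \<partial>\<mu>)"
    unfolding aug_eq using L1_mult[OF assms] rep_L1(1)[OF L1_mult(1)[OF assms]] convolution_Fubini(2)[OF i]
    by (intro integral_cong_AE) auto
  then show ?thesis unfolding convolution_Fubini(3)[OF i] aug_eq .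
qed

lemma aug_ltrans:
  assumes "X \<in> carrier LG" "x \<in> carrier G"
  shows "aug (L1_ltrans G \<mu> x X) = aug X"
proof -
  note i = ltrans_integrable[OF assms(2) rep_L1(1)[OF assms(1)]]
  have "aug (L1_ltrans G \<mu> x X) = (\<integral>y. ltrans G x (rep X) y \<partial>\<mu>)"
    unfolding aug_eq using L1_ltrans[OF assms] rep_L1(1)[OF L1_ltrans(1)[OF assms]] i(1)
    by (intro integral_cong_AE) auto
  then show ?thesis by (simp add: i(2) aug_eq)
qed

end

section \<open>The completion of a normed space\<close>

lemma tendsto_0_leI:
  assumes "g \<longlonglongrightarrow> 0" "\<And>n. 0 \<le> f n" "\<And>n. f n \<le> (g n :: real)"
  shows "f \<longlonglongrightarrow> 0"
  using assms by (intro tendsto_sandwich[of "\<lambda>_. 0" f sequentially g]) auto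

context normed_space
begin

lemma cauchy_seqs_iff:
  "s \<in> cauchy_seqs V \<longleftrightarrow> (\<forall>n. s n \<in> carrier V) \<and> (\<forall>e>0. \<exists>N. \<forall>m\<ge>N. \<forall>n\<ge>N. vnorm V (s m \<ominus> s n) < e)"
proof -
  interpret Metric_space "carrier V" "ndist V" by (rule Metric_space_ndist)
  show ?thesis unfolding cauchy_seqs_def MCauchy_def by (auto simp: ndist_def image_subset_iff)
qed

lemma cauchy_seqs_closed: "s \<in> cauchy_seqs V \<Longrightarrow> s n \<in> carrier V"
  by (simp add: cauchy_seqs_iff)

lemma null_rel_iff:
  "(s, t) \<in> null_rel V \<longleftrightarrow> s \<in> cauchy_seqs V \<and> t \<in> cauchy_seqs V \<and> (\<lambda>n. vnorm V (s n \<ominus> t n)) \<longlonglongrightarrow> 0"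
  by (simp add: null_rel_def)

lemma equiv_null_rel: "equiv (cauchy_seqs V) (null_rel V)"
proof (rule equivI)
  show "null_rel V \<subseteq> cauchy_seqs V \<times> cauchy_seqs V" by (auto simp: null_rel_def)
  show "refl_on (cauchy_seqs V) (null_rel V)"
    by (auto simp: refl_on_def null_rel_iff cauchy_seqs_closed minus_eq_zero_iff a_minus_def M.r_neg)
  show "sym (null_rel V)"
    by (auto simp: sym_def null_rel_iff vnorm_minus_commute cauchy_seqs_closed)
  show "trans (null_rel V)"
  proof (rule transI)
    fix s t u assume st: "(s, t) \<in> null_rel V" "(t, u) \<in> null_rel V"
    then have c: "s \<in> cauchy_seqs V" "t \<in> cauchy_seqs V" "u \<in> cauchy_seqs V" by (auto simp: null_rel_iff)
    have "(\<lambda>n. vnorm V (s n \<ominus> t n) + vnorm V (t n \<ominus> u n)) \<longlonglongrightarrow> 0"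
      using st by (auto simp: null_rel_iff intro: tendsto_add_zero)
    then have "(\<lambda>n. vnorm V (s n \<ominus> u n)) \<longlonglongrightarrow> 0"
      by (rule tendsto_0_leI) (use c in \<open>auto intro!: vnorm_nonneg minus_triangle simp: cauchy_seqs_closed\<close>)
    then show "(s, u) \<in> null_rel V" using c by (simp add: null_rel_iff)
  qed
qed

lemma norm_diff_le: "x \<in> carrier V \<Longrightarrow> y \<in> carrier V \<Longrightarrow> \<bar>vnorm V x - vnorm V y\<bar> \<le> vnorm V (x \<ominus> y)"
proof -
  assume xy: "x \<in> carrier V" "y \<in> carrier V"
  have "vnorm V (x \<ominus> y \<oplus> y) \<le> vnorm V (x \<ominus> y) + vnorm V y" "vnorm V (y \<ominus> x \<oplus> x) \<le> vnorm V (y \<ominus> x) + vnorm V x"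
    using xy by (auto intro: vnorm_add)
  moreover have "x \<ominus> y \<oplus> y = x" "y \<ominus> x \<oplus> x = y" using xy by (auto simp: a_minus_def M.a_assoc M.l_neg)
  ultimately show ?thesis using vnorm_minus_commute[OF xy] by auto
qed

lemma cauchy_norm_convergent:
  assumes s: "s \<in> cauchy_seqs V"
  shows "convergent (\<lambda>n. vnorm V (s n))"
proof -
  have "Cauchy (\<lambda>n. vnorm V (s n))"
  proof (rule CauchyI)
    fix e :: real assume "0 < e"
    then obtain N where "\<forall>m\<ge>N. \<forall>n\<ge>N. vnorm V (s m \<ominus> s n) < e" using s unfolding cauchy_seqs_iff by blast
    then have "norm (vnorm V (s m) - vnorm V (s n)) < e" if "m \<ge> N" "n \<ge> N" for m n
      using that norm_diff_le[OF cauchy_seqs_closed[OF s, of m] cauchy_seqs_closed[OF s, of n]]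
      by (auto intro: le_less_trans)
    then show "\<exists>N. \<forall>m\<ge>N. \<forall>n\<ge>N. norm (vnorm V (s m) - vnorm V (s n)) < e" by blast
  qed
  then show ?thesis by (rule Cauchy_convergent)
qed

lemma minus_add_minus: "\<lbrakk>x \<in> carrier V; y \<in> carrier V; x' \<in> carrier V; y' \<in> carrier V\<rbrakk> \<Longrightarrow>
    (x \<oplus> y) \<ominus> (x' \<oplus> y') = (x \<ominus> x') \<oplus> (y \<ominus> y')"
  by (simp add: a_minus_def M.minus_add M.a_ac)

lemma cauchy_add:
  assumes s: "s \<in> cauchy_seqs V" and t: "t \<in> cauchy_seqs V"
  shows "(\<lambda>n. s n \<oplus> t n) \<in> cauchy_seqs V"
  unfolding cauchy_seqs_iff
proof (intro conjI allI impI)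
  fix e :: real assume "0 < e"
  then have "0 < e / 2" by simp
  then obtain N1 N2 where N: "\<forall>m\<ge>N1. \<forall>n\<ge>N1. vnorm V (s m \<ominus> s n) < e / 2" "\<forall>m\<ge>N2. \<forall>n\<ge>N2. vnorm V (t m \<ominus> t n) < e / 2"
    using s t unfolding cauchy_seqs_iff by meson
  have "vnorm V ((s m \<oplus> t m) \<ominus> (s n \<oplus> t n)) < e" if "m \<ge> max N1 N2" "n \<ge> max N1 N2" for m n
  proof -
    have "vnorm V ((s m \<ominus> s n) \<oplus> (t m \<ominus> t n)) \<le> vnorm V (s m \<ominus> s n) + vnorm V (t m \<ominus> t n)"
      using s t by (intro vnorm_add) (auto simp: cauchy_seqs_closed)
    moreover have "vnorm V (s m \<ominus> s n) < e / 2" "vnorm V (t m \<ominus> t n) < e / 2" using N that by auto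
    ultimately show ?thesis using s t by (simp add: minus_add_minus cauchy_seqs_closed)
  qed
  then show "\<exists>N. \<forall>m\<ge>N. \<forall>n\<ge>N. vnorm V ((s m \<oplus> t m) \<ominus> (s n \<oplus> t n)) < e" by blast
qed (use s t in \<open>simp add: cauchy_seqs_closed\<close>)

lemma null_rel_add:
  assumes "(s, s') \<in> null_rel V" "(t, t') \<in> null_rel V"
  shows "(\<lambda>n. s n \<oplus> t n, \<lambda>n. s' n \<oplus> t' n) \<in> null_rel V"
proof -
  have c: "s \<in> cauchy_seqs V" "t \<in> cauchy_seqs V" "s' \<in> cauchy_seqs V" "t' \<in> cauchy_seqs V" using assms by (auto simp: null_rel_iff)
  have "(\<lambda>n. vnorm V (s n \<ominus> s' n) + vnorm V (t n \<ominus> t' n)) \<longlonglongrightarrow> 0"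
    using assms by (auto simp: null_rel_iff intro: tendsto_add_zero)
  then have "(\<lambda>n. vnorm V ((s n \<oplus> t n) \<ominus> (s' n \<oplus> t' n))) \<longlonglongrightarrow> 0"
    by (rule tendsto_0_leI) (use c in \<open>auto intro!: vnorm_nonneg vnorm_add simp: cauchy_seqs_closed minus_add_minus\<close>)
  then show ?thesis using c by (simp add: null_rel_iff cauchy_add)
qed

lemma cauchy_lipschitz:
  assumes W: "normed_space W" and s: "s \<in> cauchy_seqs V" and f: "\<And>x. x \<in> carrier V \<Longrightarrow> f x \<in> carrier W"
    and lip: "\<And>x y. x \<in> carrier V \<Longrightarrow> y \<in> carrier V \<Longrightarrow> vnorm W (f x \<ominus>\<^bsub>W\<^esub> f y) \<le> C * vnorm V (x \<ominus> y)"
  shows "(\<lambda>n. f (s n)) \<in> cauchy_seqs W"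
  unfolding normed_space.cauchy_seqs_iff[OF W]
proof (intro conjI allI impI)
  fix e :: real assume e: "0 < e"
  \<comment> \<open>The maximum with 1 makes the division by \<open>D\<close> possible for every
    \<open>C\<close>.\<close>
  define D where "D = max C 1"
  have D: "D > 0" "C \<le> D" by (auto simp: D_def)
  obtain N where N: "\<forall>m\<ge>N. \<forall>n\<ge>N. vnorm V (s m \<ominus> s n) < e / D"
    using s e D unfolding cauchy_seqs_iff by (meson divide_pos_pos)
  have "vnorm W (f (s m) \<ominus>\<^bsub>W\<^esub> f (s n)) < e" if "m \<ge> N" "n \<ge> N" for m n
  proof -
    have "vnorm W (f (s m) \<ominus>\<^bsub>W\<^esub> f (s n)) \<le> C * vnorm V (s m \<ominus> s n)" using s by (intro lip) (auto simp: cauchy_seqs_closed)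
    also have "\<dots> \<le> D * vnorm V (s m \<ominus> s n)" using D s by (intro mult_right_mono vnorm_nonneg) (auto simp: cauchy_seqs_closed)
    also have "\<dots> < e" using N that D by (auto simp: pos_less_divide_eq mult.commute)
    finally show ?thesis .
  qed
  then show "\<exists>N. \<forall>m\<ge>N. \<forall>n\<ge>N. vnorm W (f (s m) \<ominus>\<^bsub>W\<^esub> f (s n)) < e" by blast
qed (use s f in \<open>simp add: cauchy_seqs_closed\<close>)

lemma cauchy_uminus: "s \<in> cauchy_seqs V \<Longrightarrow> (\<lambda>n. \<ominus> s n) \<in> cauchy_seqs V"
proof (rule cauchy_lipschitz[OF normed_space_axioms, of s "\<lambda>x. \<ominus> x" 1])
  fix x y assume xy: "x \<in> carrier V" "y \<in> carrier V"
  then have "\<ominus> x \<ominus> \<ominus> y = y \<ominus> x" by (simp add: a_minus_def M.a_comm)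
  then show "vnorm V (\<ominus> x \<ominus> \<ominus> y) \<le> 1 * vnorm V (x \<ominus> y)" using xy by (simp add: vnorm_minus_commute)
qed auto

lemma cauchy_const: "x \<in> carrier V \<Longrightarrow> (\<lambda>n. x) \<in> cauchy_seqs V"
  by (simp add: cauchy_seqs_iff a_minus_def M.r_neg)

lemma carrier_completion: "carrier (completion V) = cauchy_seqs V // null_rel V"
  by (simp add: completion_def)

abbreviation cls where "cls s \<equiv> null_rel V `` {s}"

lemma cls_carrier: "s \<in> cauchy_seqs V \<Longrightarrow> cls s \<in> carrier (completion V)"
  unfolding carrier_completion by (rule quotientI)

lemma rep_completion:
  assumes "X \<in> carrier (completion V)"
  shows "rep X \<in> cauchy_seqs V" "cls (rep X) = X"
proof -
  obtain s where s: "s \<in> cauchy_seqs V" "X = cls s" using assms unfolding carrier_completion by (auto elim!: quotientE)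
  have "s \<in> X" using s equiv_class_self[OF equiv_null_rel] by simp
  then have r: "rep X \<in> X" unfolding rep_def by (rule someI[of "\<lambda>s. s \<in> X"])
  then have "(s, rep X) \<in> null_rel V" using s by simp
  then show "rep X \<in> cauchy_seqs V" "cls (rep X) = X"
    using s equiv_class_eq[OF equiv_null_rel, of s "rep X"] by (auto simp: null_rel_iff)
qed

lemma cls_eq_iff: "s \<in> cauchy_seqs V \<Longrightarrow> t \<in> cauchy_seqs V \<Longrightarrow> cls s = cls t \<longleftrightarrow> (s, t) \<in> null_rel V"
  by (rule eq_equiv_class_iff[OF equiv_null_rel])

lemma rep_cls: "s \<in> cauchy_seqs V \<Longrightarrow> (rep (cls s), s) \<in> null_rel V"
  using rep_completion[OF cls_carrier] cls_eq_iff by simp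

lemma cls_add:
  assumes "s \<in> cauchy_seqs V" "t \<in> cauchy_seqs V"
  shows "cls s \<oplus>\<^bsub>completion V\<^esub> cls t = cls (\<lambda>n. s n \<oplus> t n)"
proof -
  have "cls s \<oplus>\<^bsub>completion V\<^esub> cls t = cls (\<lambda>n. rep (cls s) n \<oplus> rep (cls t) n)" by (simp add: completion_def)
  also have "\<dots> = cls (\<lambda>n. s n \<oplus> t n)"
    by (rule equiv_class_eq[OF equiv_null_rel null_rel_add[OF rep_cls[OF assms(1)] rep_cls[OF assms(2)]]])
  finally show ?thesis .
qed

text \<open>The negative is a definite description in the additive monoid of the record, so its
  uniqueness is shown directly, without first making the completion an abelian group.\<close>

lemma completion_uminus:
  assumes t: "t \<in> cauchy_seqs V"
  shows "\<ominus>\<^bsub>completion V\<^esub> (cls t) = cls (\<lambda>n. \<ominus> t n)"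
proof -
  have zero: "\<zero>\<^bsub>completion V\<^esub> = cls (\<lambda>n. \<zero>)" by (simp add: completion_def)
  note tm = cauchy_uminus[OF t]
  have a: "cls (\<lambda>n. \<ominus> t n) \<oplus>\<^bsub>completion V\<^esub> cls t = \<zero>\<^bsub>completion V\<^esub>"
    "cls t \<oplus>\<^bsub>completion V\<^esub> cls (\<lambda>n. \<ominus> t n) = \<zero>\<^bsub>completion V\<^esub>"
    unfolding zero cls_add[OF tm t] cls_add[OF t tm] using t by (simp_all add: M.l_neg M.r_neg cauchy_seqs_closed)
  have u: "Y = cls (\<lambda>n. \<ominus> t n)" if Y: "Y \<in> carrier (completion V)" "Y \<oplus>\<^bsub>completion V\<^esub> cls t = \<zero>\<^bsub>completion V\<^esub>" for Y
  proof -
    note r = rep_completion[OF Y(1)]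
    have "cls (\<lambda>n. rep Y n \<oplus> t n) = cls (\<lambda>n. \<zero>)" using Y(2) cls_add[OF r(1) t] r(2) zero by simp
    then have "(\<lambda>n. vnorm V ((rep Y n \<oplus> t n) \<ominus> \<zero>)) \<longlonglongrightarrow> 0"
      using cls_eq_iff[OF cauchy_add[OF r(1) t] cauchy_const[of \<zero>]] by (simp add: null_rel_iff)
    moreover have "(rep Y n \<oplus> t n) \<ominus> \<zero> = rep Y n \<ominus> \<ominus> t n" for n
      using r(1) t by (simp add: a_minus_def cauchy_seqs_closed)
    ultimately have "(rep Y, \<lambda>n. \<ominus> t n) \<in> null_rel V" using r(1) tm by (simp add: null_rel_iff)
    then show ?thesis using cls_eq_iff[OF r(1) tm] r(2) by simp
  qed
  have "(THE Y. Y \<in> carrier (completion V) \<and> cls t \<oplus>\<^bsub>completion V\<^esub> Y = \<zero>\<^bsub>completion V\<^esub> \<and>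
      Y \<oplus>\<^bsub>completion V\<^esub> cls t = \<zero>\<^bsub>completion V\<^esub>) = cls (\<lambda>n. \<ominus> t n)"
    by (rule the_equality, intro conjI cls_carrier tm a, elim conjE, rule u)
  then show ?thesis by (simp add: a_inv_def m_inv_def)
qed

text \<open>The norm in the completion is computed from a chosen representative; here any Cauchy
  sequences will do, because representatives of one class have asymptotically equal norms. A strict
  inequality between elements of the completion can thus be read off far out in a sequence.\<close>

lemma completion_norm_minus:
  assumes s: "s \<in> cauchy_seqs V" and t: "t \<in> cauchy_seqs V"
  shows "(\<lambda>n. vnorm V (s n \<ominus> t n)) \<longlonglongrightarrow> vnorm (completion V) (cls s \<ominus>\<^bsub>completion V\<^esub> cls t)"
proof -
  have e: "cls s \<ominus>\<^bsub>completion V\<^esub> cls t = cls (\<lambda>n. s n \<ominus> t n)"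
    unfolding a_minus_def completion_uminus[OF t] cls_add[OF s cauchy_uminus[OF t]] ..
  have c: "(\<lambda>n. s n \<ominus> t n) \<in> cauchy_seqs V" using cauchy_add[OF s cauchy_uminus[OF t]] by (simp add: a_minus_def)
  let ?r = "rep (cls (\<lambda>n. s n \<ominus> t n))"
  have r: "(?r, \<lambda>n. s n \<ominus> t n) \<in> null_rel V" by (rule rep_cls[OF c])
  then have rc: "?r \<in> cauchy_seqs V" by (simp add: null_rel_iff)
  have 1: "(\<lambda>n. vnorm V (?r n)) \<longlonglongrightarrow> vnorm (completion V) (cls (\<lambda>n. s n \<ominus> t n))"
    using cauchy_norm_convergent[OF rc] by (simp add: completion_def convergent_LIMSEQ_iff)
  have "(\<lambda>n. \<bar>vnorm V (?r n) - vnorm V (s n \<ominus> t n)\<bar>) \<longlonglongrightarrow> 0"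
  proof (rule tendsto_0_leI)
    show "(\<lambda>n. vnorm V (?r n \<ominus> (s n \<ominus> t n))) \<longlonglongrightarrow> 0" using r by (simp add: null_rel_iff)
    show "\<bar>vnorm V (?r n) - vnorm V (s n \<ominus> t n)\<bar> \<le> vnorm V (?r n \<ominus> (s n \<ominus> t n))" for n
      using norm_diff_le[OF cauchy_seqs_closed[OF rc] cauchy_seqs_closed[OF c]] .
  qed auto
  then have "(\<lambda>n. vnorm V (?r n) - vnorm V (s n \<ominus> t n)) \<longlonglongrightarrow> 0" by (simp add: tendsto_rabs_zero_iff)
  from tendsto_diff[OF 1 this] show ?thesis unfolding e by simp
qed

end

lemma (in banach_space) limit_cauchy:
  assumes s: "s \<in> cauchy_seqs V"
  shows "(THE y. limitin (ntopology V) s y sequentially) \<in> carrier V"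
    "(\<lambda>n. vnorm V (s n \<ominus> (THE y. limitin (ntopology V) s y sequentially))) \<longlonglongrightarrow> 0"
proof -
  interpret Metric_space "carrier V" "ndist V" by (rule Metric_space_ndist)
  have "\<exists>y. limitin mtopology s y sequentially"
    using complete s unfolding mcomplete_def cauchy_seqs_def by blast
  then obtain y where y: "limitin mtopology s y sequentially" by blast
  have the: "(THE y. limitin (ntopology V) s y sequentially) = y"
    unfolding ntopology_def
  proof (rule the_equality)
    show "limitin mtopology s y sequentially" by (rule y)
    show "z = y" if "limitin mtopology s z sequentially" for z
      using limitin_metric_unique[OF that y] by simp
  qed
  show "(THE y. limitin (ntopology V) s y sequentially) \<in> carrier V" unfolding the using y by (simp add: limitin_metric)
  moreover have "(\<lambda>n. ndist V (s n) y) \<longlonglongrightarrow> 0" using y by (simp add: limitin_metric_dist_null)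
  ultimately show "(\<lambda>n. vnorm V (s n \<ominus> (THE y. limitin (ntopology V) s y sequentially))) \<longlonglongrightarrow> 0"
    unfolding the using cauchy_seqs_closed[OF s] by (simp add: ndist_def)
qed

section \<open>The projective tensor product\<close>

text \<open>The pairing of a formal sum with a map on pairs. The general codomain covers values of
  bilinear forms as well as costs and function values.\<close>

definition sum_pairs :: "('b \<Rightarrow> 'b \<Rightarrow> 'c::comm_monoid_add) \<Rightarrow> ('b \<times> 'b) list \<Rightarrow> 'c" where
  "sum_pairs \<phi> xs = (\<Sum>(b, c)\<leftarrow>xs. \<phi> b c)"

lemma sum_pairs_simps [simp]:
  "sum_pairs \<phi> [] = 0" "sum_pairs \<phi> ((b, c) # xs) = \<phi> b c + sum_pairs \<phi> xs"
  "sum_pairs \<phi> (xs @ ys) = sum_pairs \<phi> xs + sum_pairs \<phi> ys"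
  by (simp_all add: sum_pairs_def)

lemma sum_pairs_map: "sum_pairs \<phi> (map (\<lambda>(b, c). (f b c, g b c)) xs) = sum_pairs (\<lambda>b c. \<phi> (f b c) (g b c)) xs"
  by (induction xs) auto

lemma sum_pairs_mult: "sum_pairs (\<lambda>b c. k * \<phi> b c) xs = (k :: 'c :: comm_semiring_0) * sum_pairs \<phi> xs"
  by (induction xs) (auto simp: distrib_left)

lemma sum_pairs_add: "sum_pairs (\<lambda>b c. \<phi> b c + \<psi> b c) xs = sum_pairs \<phi> xs + sum_pairs \<psi> xs"
  by (induction xs) (auto simp: ac_simps)

lemma sum_pairs_zero: "sum_pairs (\<lambda>b c. 0) xs = 0"
  by (induction xs) auto

lemma sum_pairs_cong: "(\<And>b c. (b, c) \<in> set xs \<Longrightarrow> \<phi> b c = \<psi> b c) \<Longrightarrow> sum_pairs \<phi> xs = sum_pairs \<psi> xs"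
  by (induction xs) auto

lemma norm_sum_pairs_le:
  fixes \<phi> :: "'b \<Rightarrow> 'b \<Rightarrow> 'c::real_normed_vector"
  shows "(\<And>b c. (b, c) \<in> set xs \<Longrightarrow> norm (\<phi> b c) \<le> \<psi> b c) \<Longrightarrow> norm (sum_pairs \<phi> xs) \<le> sum_pairs \<psi> xs"
  by (induction xs) (auto intro!: norm_triangle_le add_mono)

text \<open>\<open>\<Psi>\<close> plays the part of the unit ball of the dual. Separation of points
  yields definiteness of the projective norm and the independence of the product from the formal sum
  that represents a tensor.\<close>

locale separated_banach_algebra = banach_algebra A for A :: "('b, 'm) normed_space_scheme" (structure) +
  fixes \<Psi> :: "('b \<Rightarrow> complex) set"
  assumes \<Psi>_add: "\<psi> \<in> \<Psi> \<Longrightarrow> x \<in> carrier A \<Longrightarrow> y \<in> carrier A \<Longrightarrow> \<psi> (x \<oplus> y) = \<psi> x + \<psi> y"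
    and \<Psi>_scale: "\<psi> \<in> \<Psi> \<Longrightarrow> x \<in> carrier A \<Longrightarrow> \<psi> (c \<odot> x) = c * \<psi> x"
    and \<Psi>_bound: "\<psi> \<in> \<Psi> \<Longrightarrow> x \<in> carrier A \<Longrightarrow> cmod (\<psi> x) \<le> vnorm A x"
    and \<Psi>_separating: "x \<in> carrier A \<Longrightarrow> (\<And>\<psi>. \<psi> \<in> \<Psi> \<Longrightarrow> \<psi> x = 0) \<Longrightarrow> x = \<zero>"
begin

abbreviation "FS \<equiv> formal_sums A"

definition cost :: "('b \<times> 'b) list \<Rightarrow> real" where
  "cost xs = sum_pairs (\<lambda>b c. vnorm A b * vnorm A c) xs"

text \<open>It repeats the fold of \<open>prod_alg\<close>, whose zero and addition are those of the
  record and not of a type class.\<close>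

definition vsum :: "('b \<Rightarrow> 'b \<Rightarrow> 'b) \<Rightarrow> ('b \<times> 'b) list \<Rightarrow> 'b" where
  "vsum w xs = foldr (\<lambda>(b, c) s. w b c \<oplus> s) xs \<zero>"

lemma FS_iff: "xs \<in> FS \<longleftrightarrow> (\<forall>(b, c)\<in>set xs. b \<in> carrier A \<and> c \<in> carrier A)"
  by (auto simp: formal_sums_def)

lemma FS_simps [simp]: "[] \<in> FS" "(b, c) # xs \<in> FS \<longleftrightarrow> b \<in> carrier A \<and> c \<in> carrier A \<and> xs \<in> FS"
  "xs @ ys \<in> FS \<longleftrightarrow> xs \<in> FS \<and> ys \<in> FS"
  by (auto simp: FS_iff)

lemma FS_map: "xs \<in> FS \<Longrightarrow> (\<And>b c. b \<in> carrier A \<Longrightarrow> c \<in> carrier A \<Longrightarrow> f b c \<in> carrier A \<and> g b c \<in> carrier A) \<Longrightarrow>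
    map (\<lambda>(b, c). (f b c, g b c)) xs \<in> FS"
  by (fastforce simp: FS_iff)

lemma cost_nonneg: "xs \<in> FS \<Longrightarrow> 0 \<le> cost xs"
  unfolding cost_def by (induction xs) (auto intro!: add_nonneg_nonneg mult_nonneg_nonneg vnorm_nonneg)

lemma vsum_closed: "xs \<in> FS \<Longrightarrow> (\<And>b c. b \<in> carrier A \<Longrightarrow> c \<in> carrier A \<Longrightarrow> w b c \<in> carrier A) \<Longrightarrow> vsum w xs \<in> carrier A"
  by (induction xs) (auto simp: vsum_def)

lemma vsum_linear:
  assumes "xs \<in> FS" "\<And>b c. b \<in> carrier A \<Longrightarrow> c \<in> carrier A \<Longrightarrow> w b c \<in> carrier A"
    and L: "\<And>x y. x \<in> carrier A \<Longrightarrow> y \<in> carrier A \<Longrightarrow> L (x \<oplus> y) = L x + L y" "L \<zero> = (0::complex)"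
  shows "L (vsum w xs) = sum_pairs (\<lambda>b c. L (w b c)) xs"
  using assms(1)
proof (induction xs)
  case Nil then show ?case by (simp add: vsum_def L)
next
  case (Cons p xs)
  obtain b c where p: "p = (b, c)" by fastforce
  then have c: "b \<in> carrier A" "c \<in> carrier A" "xs \<in> FS" using Cons.prems by auto
  have "L (vsum w (p # xs)) = L (w b c) + L (vsum w xs)"
    using L(1)[OF assms(2)[OF c(1,2)] vsum_closed[OF c(3) assms(2)]] by (simp add: vsum_def p)
  then show ?case using Cons.IH[OF c(3)] p by simp
qed

lemma vnorm_vsum:
  assumes "xs \<in> FS" "\<And>b c. b \<in> carrier A \<Longrightarrow> c \<in> carrier A \<Longrightarrow> w b c \<in> carrier A"
  shows "vnorm A (vsum w xs) \<le> sum_pairs (\<lambda>b c. vnorm A (w b c)) xs"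
  using assms(1)
proof (induction xs)
  case Nil then show ?case by (simp add: vsum_def)
next
  case (Cons p xs)
  obtain b c where p: "p = (b, c)" by fastforce
  then have c: "b \<in> carrier A" "c \<in> carrier A" "xs \<in> FS" using Cons.prems by auto
  have "vnorm A (vsum w (p # xs)) \<le> vnorm A (w b c) + vnorm A (vsum w xs)"
    using vnorm_add[OF assms(2)[OF c(1,2)] vsum_closed[OF c(3) assms(2)]] by (simp add: vsum_def p)
  then show ?case using Cons.IH[OF c(3)] p by simp
qed

lemma \<Psi>_zero: "\<psi> \<in> \<Psi> \<Longrightarrow> \<psi> \<zero> = 0"
  using \<Psi>_bound[of \<psi> \<zero>] by simp

lemma bilinear_formD:
  assumes "bilinear_form A \<phi>" "x \<in> carrier A" "y \<in> carrier A" "z \<in> carrier A"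
  shows "\<phi> (x \<oplus> y) z = \<phi> x z + \<phi> y z" "\<phi> z (x \<oplus> y) = \<phi> z x + \<phi> z y"
    "\<phi> (k \<odot> x) z = k * \<phi> x z" "\<phi> z (k \<odot> x) = k * \<phi> z x"
  using assms unfolding bilinear_form_def by blast+

lemma bilinear_form_zero:
  assumes "bilinear_form A \<phi>" "z \<in> carrier A"
  shows "\<phi> \<zero> z = 0" "\<phi> z \<zero> = 0"
  using bilinear_formD(3,4)[OF assms(1) M.zero_closed M.zero_closed assms(2), of 0] by simp_all

lemma bilinear_form_\<Psi>: "\<psi> \<in> \<Psi> \<Longrightarrow> \<eta> \<in> \<Psi> \<Longrightarrow> bilinear_form A (\<lambda>b c. \<psi> b * \<eta> c)"
  by (simp add: bilinear_form_def \<Psi>_add \<Psi>_scale distrib_left distrib_right)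

lemma bilinear_form_mult: "\<psi> \<in> \<Psi> \<Longrightarrow> bilinear_form A (\<lambda>b c. \<psi> (b \<otimes> c))"
  by (simp add: bilinear_form_def \<Psi>_add \<Psi>_scale mult_distr_l mult_distr_r mult_smult_l mult_smult_r mult_closed)

lemma bilinear_form_lact: "bilinear_form A \<phi> \<Longrightarrow> a \<in> carrier A \<Longrightarrow> bilinear_form A (\<lambda>b c. \<phi> (a \<otimes> b) c)"
  by (auto simp: bilinear_form_def mult_distr_r mult_smult_r mult_closed)

lemma bilinear_form_ract: "bilinear_form A \<phi> \<Longrightarrow> a \<in> carrier A \<Longrightarrow> bilinear_form A (\<lambda>b c. \<phi> b (c \<otimes> a))"
  by (auto simp: bilinear_form_def mult_distr_l mult_smult_l mult_closed)

lemma tens_apply: "tens A xs \<phi> = (if bilinear_form A \<phi> then sum_pairs \<phi> xs else 0)"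
  by (simp add: tens_def sum_pairs_def)

lemma tens_eq_iff: "tens A xs = tens A ys \<longleftrightarrow> (\<forall>\<phi>. bilinear_form A \<phi> \<longrightarrow> sum_pairs \<phi> xs = sum_pairs \<phi> ys)"
  by (auto simp: fun_eq_iff tens_apply)

text \<open>If \<open>\<psi>\<close> does not vanish on a left factor \<open>b\<^sub>0\<close>, then evaluating \<open>\<psi>\<close> on the left factors gives a linear
  relation among the right factors that expresses \<open>c\<^sub>0\<close> by the others, so the sum can be shortened.\<close>

lemma formal_sum_zero:
  assumes "xs \<in> FS" "\<And>\<psi> \<eta>. \<psi> \<in> \<Psi> \<Longrightarrow> \<eta> \<in> \<Psi> \<Longrightarrow> sum_pairs (\<lambda>b c. \<psi> b * \<eta> c) xs = 0" "bilinear_form A \<phi>"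
  shows "sum_pairs \<phi> xs = 0"
  using assms
proof (induction "length xs" arbitrary: xs rule: less_induct)
  case less
  note xs = less.prems(1) and z = less.prems(2) and \<phi> = less.prems(3)
  show ?case
  proof (cases "\<forall>\<psi>\<in>\<Psi>. \<forall>(b, c)\<in>set xs. \<psi> b = 0")
    \<comment> \<open>Here separation forces every left factor to be zero. This is also the end of
      the recursion, as it includes the empty sum.\<close>
    case True
    have "sum_pairs \<phi> xs = sum_pairs (\<lambda>b c. 0) xs"
    proof (rule sum_pairs_cong)
      fix b c assume bc: "(b, c) \<in> set xs"
      then have "b \<in> carrier A" "c \<in> carrier A" using xs by (auto simp: FS_iff)
      moreover from this have "b = \<zero>" using True bc by (intro \<Psi>_separating) auto
      ultimately show "\<phi> b c = 0" using bilinear_form_zero[OF \<phi>] by simp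
    qed
    then show ?thesis by (simp only: sum_pairs_zero)
  next
    case False
    then obtain \<psi> b0 c0 where \<psi>: "\<psi> \<in> \<Psi>" "(b0, c0) \<in> set xs" "\<psi> b0 \<noteq> 0" by auto
    then obtain ys zs where split: "xs = ys @ (b0, c0) # zs" by (meson split_list)
    have c0: "b0 \<in> carrier A" "c0 \<in> carrier A" and yz: "ys @ zs \<in> FS" using xs split by auto
    let ?v = "vsum (\<lambda>b c. \<psi> b \<odot> c) xs"
    have v: "?v \<in> carrier A" using xs by (intro vsum_closed) auto
    have v0: "?v = \<zero>"
    proof (rule \<Psi>_separating[OF v])
      fix \<eta> assume \<eta>: "\<eta> \<in> \<Psi>"
      have "\<eta> ?v = sum_pairs (\<lambda>b c. \<eta> (\<psi> b \<odot> c)) xs"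
        using xs \<eta> by (intro vsum_linear) (auto simp: \<Psi>_add \<Psi>_zero)
      also have "\<dots> = sum_pairs (\<lambda>b c. \<psi> b * \<eta> c) xs"
        using xs \<eta> by (intro sum_pairs_cong) (auto simp: FS_iff \<Psi>_scale)
      finally show "\<eta> ?v = 0" using z[OF \<psi>(1) \<eta>] by simp
    qed
    \<comment> \<open>Subtracting this multiple of \<open>b0\<close> brings each left factor into
      the kernel of \<open>\<psi>\<close>; the pair \<open>(b0, c0)\<close> itself would become zero
      on the left and is dropped.\<close>
    define k where "k b = - (\<psi> b / \<psi> b0)" for b
    define ws where "ws = map (\<lambda>(b, c). (b \<oplus> k b \<odot> b0, c)) (ys @ zs)"
    have ws: "ws \<in> FS" unfolding ws_def using yz c0 by (intro FS_map) auto
    \<comment> \<open>Invariance is shown for an arbitrary form, because it is used twice: for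
      \<open>\<phi>\<close>, and for the product forms on which the induction hypothesis requires
      the shortened sum to vanish.\<close>
    have eq: "sum_pairs \<theta> xs = sum_pairs \<theta> ws" if \<theta>: "bilinear_form A \<theta>" for \<theta>
    proof -
      have "\<theta> b0 ?v = sum_pairs (\<lambda>b c. \<theta> b0 (\<psi> b \<odot> c)) xs"
        using xs c0 \<theta> bilinear_form_zero[OF \<theta>] by (intro vsum_linear) (auto simp: bilinear_formD[OF \<theta>])
      also have "\<dots> = sum_pairs (\<lambda>b c. \<psi> b * \<theta> b0 c) xs"
        using xs c0 by (intro sum_pairs_cong) (auto simp: FS_iff bilinear_formD[OF \<theta>])
      finally have "sum_pairs (\<lambda>b c. \<psi> b * \<theta> b0 c) xs = 0" using v0 bilinear_form_zero[OF \<theta> c0(1)] by simp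
      then have r: "\<psi> b0 * \<theta> b0 c0 + sum_pairs (\<lambda>b c. \<psi> b * \<theta> b0 c) (ys @ zs) = 0" by (simp add: split algebra_simps)
      have "sum_pairs \<theta> ws = sum_pairs (\<lambda>b c. \<theta> (b \<oplus> k b \<odot> b0) c) (ys @ zs)" unfolding ws_def by (rule sum_pairs_map)
      also have "\<dots> = sum_pairs (\<lambda>b c. \<theta> b c + (- 1 / \<psi> b0) * (\<psi> b * \<theta> b0 c)) (ys @ zs)"
      proof (rule sum_pairs_cong)
        fix b c assume "(b, c) \<in> set (ys @ zs)"
        then have "b \<in> carrier A" "c \<in> carrier A" using yz by (auto simp: FS_iff)
        then show "\<theta> (b \<oplus> k b \<odot> b0) c = \<theta> b c + (- 1 / \<psi> b0) * (\<psi> b * \<theta> b0 c)"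
          using c0 by (simp add: bilinear_formD[OF \<theta>] k_def)
      qed
      also have "\<dots> = sum_pairs \<theta> (ys @ zs) + (- 1 / \<psi> b0) * sum_pairs (\<lambda>b c. \<psi> b * \<theta> b0 c) (ys @ zs)"
        by (simp only: sum_pairs_add sum_pairs_mult)
      also have "sum_pairs (\<lambda>b c. \<psi> b * \<theta> b0 c) (ys @ zs) = - (\<psi> b0 * \<theta> b0 c0)" using r by (simp add: eq_neg_iff_add_eq_0 add.commute)
      also have "sum_pairs \<theta> (ys @ zs) + (- 1 / \<psi> b0) * - (\<psi> b0 * \<theta> b0 c0) = sum_pairs \<theta> xs"
        using \<psi>(3) by (simp add: split)
      finally show ?thesis by simp
    qed
    have "sum_pairs \<phi> ws = 0"
    proof (rule less.hyps[OF _ ws _ \<phi>])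
      show "length ws < length xs" by (simp add: ws_def split)
      show "sum_pairs (\<lambda>b c. \<psi>' b * \<eta> c) ws = 0" if "\<psi>' \<in> \<Psi>" "\<eta> \<in> \<Psi>" for \<psi>' \<eta>
        using eq[OF bilinear_form_\<Psi>[OF that]] z[OF that] by simp
    qed
    then show ?thesis using eq[OF \<phi>] by simp
  qed
qed

section \<open>The projective norm on the algebraic tensor product\<close>

abbreviation "AT \<equiv> alg_tensor A"

lemma AT_simps:
  "carrier AT = tens A ` FS" "\<zero>\<^bsub>AT\<^esub> = (\<lambda>\<phi>. 0)" "u \<oplus>\<^bsub>AT\<^esub> v = (\<lambda>\<phi>. u \<phi> + v \<phi>)" "k \<odot>\<^bsub>AT\<^esub> u = (\<lambda>\<phi>. k * u \<phi>)"
  "vnorm AT u = Inf {cost xs | xs. xs \<in> FS \<and> tens A xs = u}"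
  by (simp_all add: alg_tensor_def cost_def sum_pairs_def)

lemma tens_carrier: "xs \<in> FS \<Longrightarrow> tens A xs \<in> carrier AT"
  by (simp add: AT_simps)

lemma tens_add: "tens A xs \<oplus>\<^bsub>AT\<^esub> tens A ys = tens A (xs @ ys)"
  by (auto simp: AT_simps fun_eq_iff tens_apply)

lemma tens_zero: "\<zero>\<^bsub>AT\<^esub> = tens A []"
  by (auto simp: AT_simps fun_eq_iff tens_apply)

lemma tens_scale: "xs \<in> FS \<Longrightarrow> k \<odot>\<^bsub>AT\<^esub> tens A xs = tens A (map (\<lambda>(b, c). (k \<odot> b, c)) xs)"
proof -
  assume xs: "xs \<in> FS"
  have "sum_pairs \<phi> (map (\<lambda>(b, c). (k \<odot> b, c)) xs) = k * sum_pairs \<phi> xs" if "bilinear_form A \<phi>" for \<phi>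
  proof -
    have "sum_pairs \<phi> (map (\<lambda>(b, c). (k \<odot> b, c)) xs) = sum_pairs (\<lambda>b c. \<phi> (k \<odot> b) c) xs" by (rule sum_pairs_map)
    also have "\<dots> = sum_pairs (\<lambda>b c. k * \<phi> b c) xs"
      using xs by (intro sum_pairs_cong) (auto simp: FS_iff bilinear_formD[OF that])
    finally show ?thesis by (simp only: sum_pairs_mult)
  qed
  then show ?thesis by (auto simp: AT_simps fun_eq_iff tens_apply)
qed

lemma FS_scale: "xs \<in> FS \<Longrightarrow> map (\<lambda>(b, c). (k \<odot> b, c)) xs \<in> FS"
  by (rule FS_map) auto

lemma cost_scale: "xs \<in> FS \<Longrightarrow> cost (map (\<lambda>(b, c). (k \<odot> b, c)) xs) = cmod k * cost xs"
proof -
  assume xs: "xs \<in> FS"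
  have "cost (map (\<lambda>(b, c). (k \<odot> b, c)) xs) = sum_pairs (\<lambda>b c. vnorm A (k \<odot> b) * vnorm A c) xs"
    unfolding cost_def by (rule sum_pairs_map)
  also have "\<dots> = sum_pairs (\<lambda>b c. cmod k * (vnorm A b * vnorm A c)) xs"
    using xs by (intro sum_pairs_cong) (auto simp: FS_iff vnorm_smult)
  finally show ?thesis by (simp only: sum_pairs_mult cost_def)
qed

lemma AT_norm_le: "xs \<in> FS \<Longrightarrow> vnorm AT (tens A xs) \<le> cost xs"
  unfolding AT_simps by (rule cInf_lower) (auto intro!: bdd_belowI[of _ 0] cost_nonneg)

lemma AT_norm_less:
  assumes "u \<in> carrier AT" "vnorm AT u < e"
  shows "\<exists>xs\<in>FS. tens A xs = u \<and> cost xs < e"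
proof -
  have "{cost xs | xs. xs \<in> FS \<and> tens A xs = u} \<noteq> {}" using assms(1) by (auto simp: AT_simps)
  then have "\<exists>z\<in>{cost xs | xs. xs \<in> FS \<and> tens A xs = u}. z < e"
    using assms(2) unfolding AT_simps by (rule cInf_lessD)
  then show ?thesis by auto
qed

lemma AT_norm_nonneg: "u \<in> carrier AT \<Longrightarrow> 0 \<le> vnorm AT u"
proof (rule ccontr)
  assume "u \<in> carrier AT" "\<not> 0 \<le> vnorm AT u"
  then obtain xs where "xs \<in> FS" "cost xs < 0" using AT_norm_less[of u 0] by auto
  then show False using cost_nonneg by fastforce
qed

lemma AT_norm_scale_le: "u \<in> carrier AT \<Longrightarrow> vnorm AT (k \<odot>\<^bsub>AT\<^esub> u) \<le> cmod k * vnorm AT u"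
proof (rule field_le_epsilon)
  fix e :: real assume u: "u \<in> carrier AT" and e: "0 < e"
  define d where "d = e / (cmod k + 1)"
  have d: "d > 0" "cmod k * d \<le> e" using e unfolding d_def
    by (auto simp: divide_simps add_pos_nonneg add_nonneg_pos mult_left_mono)
  obtain xs where xs: "xs \<in> FS" "tens A xs = u" "cost xs < vnorm AT u + d" using AT_norm_less[OF u, of "vnorm AT u + d"] d by auto
  have "vnorm AT (k \<odot>\<^bsub>AT\<^esub> u) \<le> cost (map (\<lambda>(b, c). (k \<odot> b, c)) xs)"
    using AT_norm_le[OF FS_scale[OF xs(1)]] tens_scale[OF xs(1)] xs(2) by simp
  also have "\<dots> = cmod k * cost xs" by (rule cost_scale[OF xs(1)])
  also have "\<dots> \<le> cmod k * (vnorm AT u + d)" using xs by (intro mult_left_mono) auto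
  also have "\<dots> \<le> cmod k * vnorm AT u + e" using d by (simp add: distrib_left)
  finally show "vnorm AT (k \<odot>\<^bsub>AT\<^esub> u) \<le> cmod k * vnorm AT u + e" .
qed

text \<open>The point is definiteness. If the norm of \<open>u\<close> is 0, there are representing
  sums of arbitrarily small cost, so all forms built from two members of \<open>\<Psi>\<close>
  vanish on \<open>u\<close>, and \<open>formal_sum_zero\<close> carries this over to all bilinear
  forms, including unbounded ones.\<close>

lemma AT_normed_space: "normed_space AT"
proof -
  have ab: "abelian_group AT"
  proof (rule abelian_groupI)
    fix u v w assume "u \<in> carrier AT" "v \<in> carrier AT"
    then obtain xs ys where "xs \<in> FS" "u = tens A xs" "ys \<in> FS" "v = tens A ys" by (auto simp: AT_simps)
    then show "u \<oplus>\<^bsub>AT\<^esub> v \<in> carrier AT" by (simp add: tens_add tens_carrier)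
  next
    fix u assume "u \<in> carrier AT"
    then obtain xs where xs: "xs \<in> FS" "u = tens A xs" by (auto simp: AT_simps)
    have "(- 1) \<odot>\<^bsub>AT\<^esub> u \<in> carrier AT" using xs by (simp add: tens_scale FS_scale tens_carrier)
    moreover have "(- 1) \<odot>\<^bsub>AT\<^esub> u \<oplus>\<^bsub>AT\<^esub> u = \<zero>\<^bsub>AT\<^esub>" by (simp add: AT_simps)
    ultimately show "\<exists>v\<in>carrier AT. v \<oplus>\<^bsub>AT\<^esub> u = \<zero>\<^bsub>AT\<^esub>" by blast
  qed (auto simp: AT_simps(2-4) fun_eq_iff tens_zero[symmetric, unfolded AT_simps] intro: tens_carrier[of "[]", folded tens_zero, unfolded AT_simps(2)])
  have mo: "module complex_field AT"
  proof (rule moduleI)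
    fix a :: complex and u assume "u \<in> carrier AT"
    then obtain xs where xs: "xs \<in> FS" "u = tens A xs" by (auto simp: AT_simps)
    then show "a \<odot>\<^bsub>AT\<^esub> u \<in> carrier AT" by (simp add: tens_scale FS_scale tens_carrier)
  qed (auto simp: AT_simps(2-4) fun_eq_iff algebra_simps intro: ab cring_from_type_algebra)
  show ?thesis
  proof (intro normed_space.intro mo normed_space_axioms.intro)
    fix u assume u: "u \<in> carrier AT"
    then obtain xs where xs: "xs \<in> FS" "u = tens A xs" by (auto simp: AT_simps)
    show "vnorm AT u = 0 \<longleftrightarrow> u = \<zero>\<^bsub>AT\<^esub>"
    proof
      assume 0: "vnorm AT u = 0"
      have "sum_pairs (\<lambda>b c. \<psi> b * \<eta> c) xs = 0" if \<psi>: "\<psi> \<in> \<Psi>" "\<eta> \<in> \<Psi>" for \<psi> \<eta>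
      proof -
        have "cmod (sum_pairs (\<lambda>b c. \<psi> b * \<eta> c) xs) \<le> 0 + e" if e: "e > 0" for e
        proof -
          obtain ys where ys: "ys \<in> FS" "tens A ys = u" "cost ys < e" using AT_norm_less[OF u, of e] 0 e by auto
          have "sum_pairs (\<lambda>b c. \<psi> b * \<eta> c) xs = sum_pairs (\<lambda>b c. \<psi> b * \<eta> c) ys"
            using ys(2) xs(2) bilinear_form_\<Psi>[OF \<psi>] by (auto simp: tens_eq_iff)
          also have "cmod \<dots> \<le> cost ys" unfolding cost_def
            using ys(1) \<psi> by (intro norm_sum_pairs_le) (auto simp: norm_mult FS_iff intro!: mult_mono \<Psi>_bound vnorm_nonneg)
          finally show ?thesis using ys(3) by simp
        qed
        then have "cmod (sum_pairs (\<lambda>b c. \<psi> b * \<eta> c) xs) \<le> 0" by (rule field_le_epsilon)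
        then show ?thesis by simp
      qed
      then have "tens A xs = tens A []" unfolding tens_eq_iff using formal_sum_zero[OF xs(1)] by simp
      then show "u = \<zero>\<^bsub>AT\<^esub>" using xs by (simp add: tens_zero)
    next
      assume "u = \<zero>\<^bsub>AT\<^esub>"
      then have "vnorm AT u \<le> cost []" using AT_norm_le[of "[]"] by (simp add: tens_zero)
      then show "vnorm AT u = 0" using AT_norm_nonneg[OF u] by (simp add: cost_def)
    qed
    fix k
    show "vnorm AT (k \<odot>\<^bsub>AT\<^esub> u) = cmod k * vnorm AT u"
    proof (cases "k = 0")
      case True
      have "0 \<odot>\<^bsub>AT\<^esub> u \<in> carrier AT" using xs by (simp add: tens_scale FS_scale tens_carrier)
      then show ?thesis using AT_norm_scale_le[OF u, of k] AT_norm_nonneg[of "0 \<odot>\<^bsub>AT\<^esub> u"] True by simp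
    next
      case False
      have ku: "k \<odot>\<^bsub>AT\<^esub> u \<in> carrier AT" using xs by (simp add: tens_scale FS_scale tens_carrier)
      have "(1 / k) \<odot>\<^bsub>AT\<^esub> (k \<odot>\<^bsub>AT\<^esub> u) = u" using False by (simp add: AT_simps)
      then have "vnorm AT u \<le> cmod (1 / k) * vnorm AT (k \<odot>\<^bsub>AT\<^esub> u)" using AT_norm_scale_le[OF ku, of "1 / k"] by simp
      then have "cmod k * vnorm AT u \<le> vnorm AT (k \<odot>\<^bsub>AT\<^esub> u)" using False by (simp add: norm_divide field_simps)
      then show ?thesis using AT_norm_scale_le[OF u, of k] by simp
    qed
  next
    fix u v assume u: "u \<in> carrier AT" and v: "v \<in> carrier AT"
    show "vnorm AT (u \<oplus>\<^bsub>AT\<^esub> v) \<le> vnorm AT u + vnorm AT v"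
    proof (rule field_le_epsilon)
      fix e :: real assume e: "0 < e"
      obtain xs where xs: "xs \<in> FS" "tens A xs = u" "cost xs < vnorm AT u + e / 2" using AT_norm_less[OF u, of "vnorm AT u + e / 2"] e by auto
      obtain ys where ys: "ys \<in> FS" "tens A ys = v" "cost ys < vnorm AT v + e / 2" using AT_norm_less[OF v, of "vnorm AT v + e / 2"] e by auto
      have "vnorm AT (u \<oplus>\<^bsub>AT\<^esub> v) \<le> cost (xs @ ys)" using AT_norm_le[of "xs @ ys"] xs ys by (simp add: tens_add flip: xs(2) ys(2))
      also have "\<dots> = cost xs + cost ys" by (simp add: cost_def)
      finally show "vnorm AT (u \<oplus>\<^bsub>AT\<^esub> v) \<le> vnorm AT u + vnorm AT v + e" using xs(3) ys(3) by simp
    qed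
  qed
qed


section \<open>The module actions and the product map\<close>

lemma some_sum:
  assumes "xs \<in> FS"
  shows "some_sum A (tens A xs) \<in> FS" "tens A (some_sum A (tens A xs)) = tens A xs"
  using someI[of "\<lambda>ys. ys \<in> FS \<and> tens A ys = tens A xs" xs] assms unfolding some_sum_def by auto

text \<open>Independence of the chosen formal sum: a bilinear form composed with multiplication by
  \<open>a\<close> in its first argument is again bilinear.\<close>

lemma lact_alg_tens:
  assumes "xs \<in> FS" "a \<in> carrier A"
  shows "lact_alg A a (tens A xs) = tens A (map (\<lambda>(b, c). (a \<otimes> b, c)) xs)"
  using some_sum[OF assms(1)] bilinear_form_lact[OF _ assms(2)]
  unfolding lact_alg_def tens_eq_iff sum_pairs_map by blast

lemma ract_alg_tens:
  assumes "xs \<in> FS" "a \<in> carrier A"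
  shows "ract_alg A (tens A xs) a = tens A (map (\<lambda>(b, c). (b, c \<otimes> a)) xs)"
  using some_sum[OF assms(1)] bilinear_form_ract[OF _ assms(2)]
  unfolding ract_alg_def tens_eq_iff sum_pairs_map by blast

lemma \<Psi>_eqI:
  assumes "x \<in> carrier A" "y \<in> carrier A" "\<And>\<psi>. \<psi> \<in> \<Psi> \<Longrightarrow> \<psi> x = \<psi> y"
  shows "x = y"
proof -
  have "x \<ominus> y = \<zero>" using assms by (intro \<Psi>_separating) (auto simp: minus_eq_scale \<Psi>_add \<Psi>_scale)
  then show ?thesis using assms minus_eq_zero_iff by simp
qed

lemma \<Psi>_vsum_mult: "xs \<in> FS \<Longrightarrow> \<psi> \<in> \<Psi> \<Longrightarrow> \<psi> (vsum (\<otimes>) xs) = sum_pairs (\<lambda>b c. \<psi> (b \<otimes> c)) xs"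
  by (rule vsum_linear) (auto simp: mult_closed \<Psi>_add \<Psi>_zero)

text \<open>For \<open>\<psi>\<close> in \<open>\<Psi>\<close> the map
  \<open>(b, c) \<mapsto> \<psi> (b \<otimes> c)\<close> is a bilinear form, so two formal sums of
  the same tensor have products that no \<open>\<psi>\<close> distinguishes; separation makes them
  equal.\<close>

lemma prod_alg_tens:
  assumes "xs \<in> FS"
  shows "prod_alg A (tens A xs) = vsum (\<otimes>) xs"
proof -
  note s = some_sum[OF assms]
  have "vsum (\<otimes>) (some_sum A (tens A xs)) = vsum (\<otimes>) xs"
  proof (rule \<Psi>_eqI)
    fix \<psi> assume \<psi>: "\<psi> \<in> \<Psi>"
    show "\<psi> (vsum (\<otimes>) (some_sum A (tens A xs))) = \<psi> (vsum (\<otimes>) xs)"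
      using s(2) bilinear_form_mult[OF \<psi>] unfolding \<Psi>_vsum_mult[OF s(1) \<psi>] \<Psi>_vsum_mult[OF assms \<psi>] tens_eq_iff by blast
  qed (use s assms in \<open>auto intro: vsum_closed mult_closed\<close>)
  then show ?thesis by (simp add: prod_alg_def vsum_def)
qed

lemma AT_minus:
  assumes "xs \<in> FS" "ys \<in> FS"
  shows "tens A xs \<ominus>\<^bsub>AT\<^esub> tens A ys = tens A (xs @ map (\<lambda>(b, c). ((- 1) \<odot> b, c)) ys)"
  using normed_space.minus_eq_scale[OF AT_normed_space] assms
  by (simp add: tens_carrier tens_scale tens_add)

text \<open>The common core of the left and the right action. Compatibility with the scalar -1 is
  asked of \<open>f\<close> alone, as scalars are absorbed in the left factor.\<close>

lemma pair_map_lipschitz: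
  fixes f g :: "'b \<Rightarrow> 'b"
  assumes M: "\<And>xs. xs \<in> FS \<Longrightarrow> M (tens A xs) = tens A (map (\<lambda>(b, c). (f b, g c)) xs)"
    and f: "\<And>b. b \<in> carrier A \<Longrightarrow> f b \<in> carrier A" and g: "\<And>c. c \<in> carrier A \<Longrightarrow> g c \<in> carrier A"
    and scale: "\<And>b. b \<in> carrier A \<Longrightarrow> f ((- 1) \<odot> b) = (- 1) \<odot> f b"
    and C: "0 \<le> C" "\<And>b c. b \<in> carrier A \<Longrightarrow> c \<in> carrier A \<Longrightarrow> vnorm A (f b) * vnorm A (g c) \<le> C * (vnorm A b * vnorm A c)"
    and u: "u \<in> carrier AT" and v: "v \<in> carrier AT"
  shows "M u \<in> carrier AT" "vnorm AT (M u \<ominus>\<^bsub>AT\<^esub> M v) \<le> C * vnorm AT (u \<ominus>\<^bsub>AT\<^esub> v)"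
proof -
  let ?L = "map (\<lambda>(b, c). (f b, g c))"
  obtain xs ys where x: "xs \<in> FS" "u = tens A xs" and y: "ys \<in> FS" "v = tens A ys" using u v by (auto simp: AT_simps)
  have LF: "?L zs \<in> FS" if "zs \<in> FS" for zs using that f g by (intro FS_map) auto
  show "M u \<in> carrier AT" using x LF M by (simp add: tens_carrier)
  interpret AT: normed_space AT by (rule AT_normed_space)
  have lin: "M u \<ominus>\<^bsub>AT\<^esub> M v = M (u \<ominus>\<^bsub>AT\<^esub> v)"
  proof -
    have "map (\<lambda>(b, c). ((- 1) \<odot> b, c)) (?L ys) = ?L (map (\<lambda>(b, c). ((- 1) \<odot> b, c)) ys)"
      using y(1) scale by (auto simp: FS_iff)
    then show ?thesis using x y by (simp add: M LF AT_minus FS_scale del: map_map)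
  qed
  have bound: "vnorm AT (M w) \<le> C * vnorm AT w" if w: "w \<in> carrier AT" for w
  proof (rule field_le_epsilon)
    fix e :: real assume e: "0 < e"
    define d where "d = e / (C + 1)"
    have d: "d > 0" "C * d \<le> e" using e C(1) unfolding d_def
      by (auto simp: divide_simps mult_left_mono)
    obtain zs where zs: "zs \<in> FS" "tens A zs = w" "cost zs < vnorm AT w + d" using AT_norm_less[OF w, of "vnorm AT w + d"] d by auto
    have "vnorm AT (M w) \<le> cost (?L zs)"
      using AT_norm_le[OF LF[OF zs(1)]] M[OF zs(1)] zs(2) by simp
    also have "\<dots> = sum_pairs (\<lambda>b c. vnorm A (f b) * vnorm A (g c)) zs" unfolding cost_def by (rule sum_pairs_map)
    also have "\<dots> \<le> norm (sum_pairs (\<lambda>b c. vnorm A (f b) * vnorm A (g c)) zs)" by simp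
    also have "\<dots> \<le> sum_pairs (\<lambda>b c. C * (vnorm A b * vnorm A c)) zs"
      using zs(1) f g C(2) by (intro norm_sum_pairs_le) (auto simp: FS_iff abs_mult vnorm_nonneg)
    also have "\<dots> = C * cost zs" by (simp only: sum_pairs_mult cost_def)
    also have "\<dots> \<le> C * (vnorm AT w + d)" using zs(3) C(1) by (intro mult_left_mono) auto
    also have "\<dots> \<le> C * vnorm AT w + e" using d by (simp add: distrib_left)
    finally show "vnorm AT (M w) \<le> C * vnorm AT w + e" .
  qed
  show "vnorm AT (M u \<ominus>\<^bsub>AT\<^esub> M v) \<le> C * vnorm AT (u \<ominus>\<^bsub>AT\<^esub> v)"
    unfolding lin by (rule bound) (use u v in simp)
qed

lemma lact_alg_lipschitz:
  assumes "u \<in> carrier AT" "v \<in> carrier AT" and a: "a \<in> carrier A"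
  shows "lact_alg A a u \<in> carrier AT" "vnorm AT (lact_alg A a u \<ominus>\<^bsub>AT\<^esub> lact_alg A a v) \<le> vnorm A a * vnorm AT (u \<ominus>\<^bsub>AT\<^esub> v)"
proof -
  have C: "vnorm A (a \<otimes> b) * vnorm A c \<le> vnorm A a * (vnorm A b * vnorm A c)" if "b \<in> carrier A" "c \<in> carrier A" for b c
    using vnorm_mult[OF a that(1)] vnorm_nonneg[OF that(2)] by (simp add: mult_right_mono flip: mult.assoc)
  note L = pair_map_lipschitz[of "lact_alg A a" "\<lambda>b. a \<otimes> b" "\<lambda>c. c", OF lact_alg_tens[OF _ a] _ _ _ vnorm_nonneg[OF a] C assms(1,2)]
  show "lact_alg A a u \<in> carrier AT" "vnorm AT (lact_alg A a u \<ominus>\<^bsub>AT\<^esub> lact_alg A a v) \<le> vnorm A a * vnorm AT (u \<ominus>\<^bsub>AT\<^esub> v)"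
    by (rule L; simp add: a mult_closed mult_smult_r)+
qed

lemma ract_alg_lipschitz:
  assumes "u \<in> carrier AT" "v \<in> carrier AT" and a: "a \<in> carrier A"
  shows "ract_alg A u a \<in> carrier AT" "vnorm AT (ract_alg A u a \<ominus>\<^bsub>AT\<^esub> ract_alg A v a) \<le> vnorm A a * vnorm AT (u \<ominus>\<^bsub>AT\<^esub> v)"
proof -
  have C: "vnorm A b * vnorm A (c \<otimes> a) \<le> vnorm A a * (vnorm A b * vnorm A c)" if "b \<in> carrier A" "c \<in> carrier A" for b c
    using mult_left_mono[OF vnorm_mult[OF that(2) a] vnorm_nonneg[OF that(1)]] by (simp add: ac_simps)
  note L = pair_map_lipschitz[of "\<lambda>u. ract_alg A u a" "\<lambda>b. b" "\<lambda>c. c \<otimes> a", OF ract_alg_tens[OF _ a] _ _ _ vnorm_nonneg[OF a] C assms(1,2)]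
  show "ract_alg A u a \<in> carrier AT" "vnorm AT (ract_alg A u a \<ominus>\<^bsub>AT\<^esub> ract_alg A v a) \<le> vnorm A a * vnorm AT (u \<ominus>\<^bsub>AT\<^esub> v)"
    by (rule L; simp add: a mult_closed)+
qed

text \<open>The explicit factor 1 gives the bound the shape of the hypothesis of
  \<open>cauchy_lipschitz\<close>.\<close>

lemma prod_alg_lipschitz:
  assumes u: "u \<in> carrier AT" and v: "v \<in> carrier AT"
  shows "prod_alg A u \<in> carrier A" "vnorm A (prod_alg A u \<ominus> prod_alg A v) \<le> 1 * vnorm AT (u \<ominus>\<^bsub>AT\<^esub> v)"
proof -
  obtain xs ys where x: "xs \<in> FS" "u = tens A xs" and y: "ys \<in> FS" "v = tens A ys" using u v by (auto simp: AT_simps)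
  have cl: "vsum (\<otimes>) zs \<in> carrier A" if "zs \<in> FS" for zs using that by (intro vsum_closed mult_closed)
  show "prod_alg A u \<in> carrier A" using x cl by (simp add: prod_alg_tens)
  interpret AT: normed_space AT by (rule AT_normed_space)
  have lin: "prod_alg A u \<ominus> prod_alg A v = prod_alg A (u \<ominus>\<^bsub>AT\<^esub> v)"
    unfolding x(2) y(2) AT_minus[OF x(1) y(1)] using x(1) y(1)
  proof (simp add: prod_alg_tens FS_scale, intro \<Psi>_eqI)
    fix \<psi> assume \<psi>: "\<psi> \<in> \<Psi>"
    have "sum_pairs (\<lambda>b c. \<psi> ((- 1) \<odot> b \<otimes> c)) ys = sum_pairs (\<lambda>b c. (- 1) * \<psi> (b \<otimes> c)) ys"
      using y(1) \<psi> by (intro sum_pairs_cong) (auto simp: FS_iff mult_smult_l \<Psi>_scale mult_closed)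
    also have "\<dots> = (- 1) * sum_pairs (\<lambda>b c. \<psi> (b \<otimes> c)) ys" by (rule sum_pairs_mult)
    finally show "\<psi> (vsum (\<otimes>) xs \<ominus> vsum (\<otimes>) ys) = \<psi> (vsum (\<otimes>) (xs @ map (\<lambda>(b, c). ((- 1) \<odot> b, c)) ys))"
      using \<psi> x(1) y(1) cl by (simp add: minus_eq_scale \<Psi>_add \<Psi>_scale \<Psi>_vsum_mult FS_scale sum_pairs_map)
  qed (auto intro!: cl simp: FS_scale)
  have bound: "vnorm A (prod_alg A w) \<le> vnorm AT w" if w: "w \<in> carrier AT" for w
  proof (rule field_le_epsilon)
    fix e :: real assume e: "0 < e"
    obtain zs where zs: "zs \<in> FS" "tens A zs = w" "cost zs < vnorm AT w + e" using AT_norm_less[OF w, of "vnorm AT w + e"] e by auto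
    have "vnorm A (prod_alg A w) \<le> sum_pairs (\<lambda>b c. vnorm A (b \<otimes> c)) zs"
      using zs prod_alg_tens[OF zs(1)] vnorm_vsum[OF zs(1), of "(\<otimes>)"] mult_closed by auto
    also have "\<dots> \<le> norm (sum_pairs (\<lambda>b c. vnorm A (b \<otimes> c)) zs)" by simp
    also have "\<dots> \<le> cost zs" unfolding cost_def
      using zs(1) by (intro norm_sum_pairs_le) (auto simp: FS_iff vnorm_nonneg mult_closed vnorm_mult)
    finally show "vnorm A (prod_alg A w) \<le> vnorm AT w + e" using zs(3) by simp
  qed
  show "vnorm A (prod_alg A u \<ominus> prod_alg A v) \<le> 1 * vnorm AT (u \<ominus>\<^bsub>AT\<^esub> v)"
    unfolding lin using bound[of "u \<ominus>\<^bsub>AT\<^esub> v"] u v by simp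
qed

text \<open>An approximate diagonal may be replaced by formal sums: far out in a Cauchy sequence representing
  an element of the completion, all the (finitely many, strict) inequalities already hold.\<close>

lemma pseudo_amenable_formal_sums:
  assumes pa: "pseudo_amenable" and F: "finite F" "F \<subseteq> carrier A" and e: "e > 0"
  shows "\<exists>xs\<in>FS. (\<forall>a\<in>F. vnorm A (vsum (\<otimes>) xs \<otimes> a \<ominus> a) < e \<and>
    (\<exists>ys\<in>FS. cost ys < e \<and> (\<forall>\<phi>. bilinear_form A \<phi> \<longrightarrow>
       sum_pairs \<phi> ys = sum_pairs (\<lambda>b c. \<phi> (a \<otimes> b) c - \<phi> b (c \<otimes> a)) xs)))"
proof -
  obtain \<F> :: "'b ptensor filter" where \<F>: "\<F> \<noteq> bot" "\<forall>\<^sub>F m in \<F>. m \<in> carrier (proj_tensor A)"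
    "\<And>a. a \<in> carrier A \<Longrightarrow> ((\<lambda>m. vnorm (proj_tensor A) (lact A a m \<ominus>\<^bsub>proj_tensor A\<^esub> ract A m a)) \<longlongrightarrow> 0) \<F>"
    "\<And>a. a \<in> carrier A \<Longrightarrow> ((\<lambda>m. vnorm A (prod_map A m \<otimes> a \<ominus> a)) \<longlongrightarrow> 0) \<F>"
    using pa unfolding pseudo_amenable_def by blast
  have "\<forall>\<^sub>F m in \<F>. \<forall>a\<in>F. vnorm (proj_tensor A) (lact A a m \<ominus>\<^bsub>proj_tensor A\<^esub> ract A m a) < e \<and>
      vnorm A (prod_map A m \<otimes> a \<ominus> a) < e"
    using F(1)
  proof (rule eventually_ball_finite, intro ballI)
    fix a assume "a \<in> F"
    then have a: "a \<in> carrier A" using F(2) by blast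
    show "\<forall>\<^sub>F m in \<F>. vnorm (proj_tensor A) (lact A a m \<ominus>\<^bsub>proj_tensor A\<^esub> ract A m a) < e \<and> vnorm A (prod_map A m \<otimes> a \<ominus> a) < e"
      using order_tendstoD(2)[OF \<F>(3)[OF a] e] order_tendstoD(2)[OF \<F>(4)[OF a] e] by eventually_elim simp
  qed
  with \<F>(2) have "\<forall>\<^sub>F m in \<F>. m \<in> carrier (proj_tensor A) \<and> (\<forall>a\<in>F. vnorm (proj_tensor A) (lact A a m \<ominus>\<^bsub>proj_tensor A\<^esub> ract A m a) < e \<and>
      vnorm A (prod_map A m \<otimes> a \<ominus> a) < e)" by (rule eventually_conj)
  from eventually_happens'[OF \<F>(1) this] obtain m where m: "m \<in> carrier (proj_tensor A)"
    "\<And>a. a \<in> F \<Longrightarrow> vnorm (proj_tensor A) (lact A a m \<ominus>\<^bsub>proj_tensor A\<^esub> ract A m a) < e"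
    "\<And>a. a \<in> F \<Longrightarrow> vnorm A (prod_map A m \<otimes> a \<ominus> a) < e" by blast
  interpret AT: normed_space AT by (rule AT_normed_space)
  define s where "s = rep m"
  have s: "s \<in> cauchy_seqs AT" unfolding s_def using AT.rep_completion(1) m(1) by (simp add: proj_tensor_def)
  note sc = AT.cauchy_seqs_closed[OF s]
  define q where "q = prod_map A m"
  have ps: "(\<lambda>n. prod_alg A (s n)) \<in> cauchy_seqs A"
    by (rule AT.cauchy_lipschitz[OF normed_space_axioms s prod_alg_lipschitz])
  have q: "q \<in> carrier A" "(\<lambda>n. vnorm A (prod_alg A (s n) \<ominus> q)) \<longlonglongrightarrow> 0"
    using limit_cauchy[OF ps] by (simp_all add: q_def prod_map_def extend_into_def s_def)
  have ev: "\<forall>\<^sub>F n in sequentially. \<forall>a\<in>F. vnorm AT (lact_alg A a (s n) \<ominus>\<^bsub>AT\<^esub> ract_alg A (s n) a) < e \<and>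
      vnorm A (prod_alg A (s n) \<otimes> a \<ominus> a) < e"
    using F(1)
  proof (rule eventually_ball_finite, intro ballI)
    fix a assume aF: "a \<in> F"
    then have a: "a \<in> carrier A" using F(2) by blast
    have l: "(\<lambda>n. lact_alg A a (s n)) \<in> cauchy_seqs AT"
      by (rule AT.cauchy_lipschitz[OF AT_normed_space s lact_alg_lipschitz[OF _ _ a]])
    have r: "(\<lambda>n. ract_alg A (s n) a) \<in> cauchy_seqs AT"
      by (rule AT.cauchy_lipschitz[OF AT_normed_space s ract_alg_lipschitz[OF _ _ a]])
    have "(\<lambda>n. vnorm AT (lact_alg A a (s n) \<ominus>\<^bsub>AT\<^esub> ract_alg A (s n) a)) \<longlonglongrightarrow>
        vnorm (proj_tensor A) (lact A a m \<ominus>\<^bsub>proj_tensor A\<^esub> ract A m a)"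
      using AT.completion_norm_minus[OF l r]
      by (simp add: proj_tensor_def lact_def ract_def extend_endo_def s_def)
    from order_tendstoD(2)[OF this m(2)[OF aF]]
    have e1: "\<forall>\<^sub>F n in sequentially. vnorm AT (lact_alg A a (s n) \<ominus>\<^bsub>AT\<^esub> ract_alg A (s n) a) < e" .
    have "(\<lambda>n. vnorm A (prod_alg A (s n) \<ominus> q) * vnorm A a + vnorm A (q \<otimes> a \<ominus> a)) \<longlonglongrightarrow> 0 * vnorm A a + vnorm A (q \<otimes> a \<ominus> a)"
      by (intro tendsto_intros q)
    then have "\<forall>\<^sub>F n in sequentially. vnorm A (prod_alg A (s n) \<ominus> q) * vnorm A a + vnorm A (q \<otimes> a \<ominus> a) < e"
      using m(3)[OF aF] by (intro order_tendstoD(2)) (auto simp: q_def)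
    then have e2: "\<forall>\<^sub>F n in sequentially. vnorm A (prod_alg A (s n) \<otimes> a \<ominus> a) < e"
    proof eventually_elim
      fix n assume le: "vnorm A (prod_alg A (s n) \<ominus> q) * vnorm A a + vnorm A (q \<otimes> a \<ominus> a) < e"
      have p: "prod_alg A (s n) \<in> carrier A" using prod_alg_lipschitz(1)[OF sc sc] .
      have "prod_alg A (s n) \<otimes> a \<ominus> q \<otimes> a = (prod_alg A (s n) \<ominus> q) \<otimes> a"
        using p q(1) a by (simp add: minus_eq_scale mult_distr_l mult_smult_l mult_closed)
      then have "vnorm A (prod_alg A (s n) \<otimes> a \<ominus> q \<otimes> a) \<le> vnorm A (prod_alg A (s n) \<ominus> q) * vnorm A a"
        using vnorm_mult[of "prod_alg A (s n) \<ominus> q" a] p q(1) a by simp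
      then show "vnorm A (prod_alg A (s n) \<otimes> a \<ominus> a) < e"
        using minus_triangle[of "prod_alg A (s n) \<otimes> a" "q \<otimes> a" a] p q(1) a le by (simp add: mult_closed)
    qed
    from e1 e2 show "\<forall>\<^sub>F n in sequentially. vnorm AT (lact_alg A a (s n) \<ominus>\<^bsub>AT\<^esub> ract_alg A (s n) a) < e \<and>
      vnorm A (prod_alg A (s n) \<otimes> a \<ominus> a) < e" by (rule eventually_conj)
  qed
  obtain n where n: "\<And>a. a \<in> F \<Longrightarrow> vnorm AT (lact_alg A a (s n) \<ominus>\<^bsub>AT\<^esub> ract_alg A (s n) a) < e"
      "\<And>a. a \<in> F \<Longrightarrow> vnorm A (prod_alg A (s n) \<otimes> a \<ominus> a) < e"
    using eventually_happens'[OF sequentially_bot ev] by blast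
  obtain xs where xs: "xs \<in> FS" "s n = tens A xs" using sc[of n] by (auto simp: AT_simps)
  show ?thesis
  proof (rule bexI[OF _ xs(1)], intro ballI conjI)
    fix a assume aF: "a \<in> F"
    then have a: "a \<in> carrier A" using F(2) by blast
    show "vnorm A (vsum (\<otimes>) xs \<otimes> a \<ominus> a) < e" using n(2)[OF aF] xs by (simp add: prod_alg_tens)
    let ?l = "map (\<lambda>(b, c). (a \<otimes> b, c)) xs" and ?r = "map (\<lambda>(b, c). (b, c \<otimes> a)) xs"
    have lr: "?l \<in> FS" "?r \<in> FS" using xs(1) a by (auto intro!: FS_map simp: mult_closed)
    have "lact_alg A a (s n) \<ominus>\<^bsub>AT\<^esub> ract_alg A (s n) a = tens A (?l @ map (\<lambda>(b, c). ((- 1) \<odot> b, c)) ?r)"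
      using xs a lr by (simp only: lact_alg_tens ract_alg_tens AT_minus)
    \<comment> \<open>The infimum in the projective norm supplies a sum of cost below
      \<open>e\<close> for the same tensor. This sum is all that is kept of the norm
      estimate.\<close>
    then obtain ys where ys: "ys \<in> FS" "tens A ys = tens A (?l @ map (\<lambda>(b, c). ((- 1) \<odot> b, c)) ?r)" "cost ys < e"
      using AT_norm_less[of "tens A (?l @ map (\<lambda>(b, c). ((- 1) \<odot> b, c)) ?r)" e] n(1)[OF aF] lr FS_scale[OF lr(2)]
      by (auto simp: tens_carrier)
    have "sum_pairs \<phi> ys = sum_pairs (\<lambda>b c. \<phi> (a \<otimes> b) c - \<phi> b (c \<otimes> a)) xs" if \<phi>: "bilinear_form A \<phi>" for \<phi>
    proof -
      have "sum_pairs \<phi> ys = sum_pairs \<phi> (?l @ map (\<lambda>(b, c). ((- 1) \<odot> b, c)) ?r)" using ys(2) \<phi> by (auto simp: tens_eq_iff)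
      also have "\<dots> = sum_pairs (\<lambda>b c. \<phi> (a \<otimes> b) c) xs + sum_pairs (\<lambda>b c. \<phi> ((- 1) \<odot> b) (c \<otimes> a)) xs"
        by (simp add: sum_pairs_map del: map_map)
      also have "\<dots> = sum_pairs (\<lambda>b c. \<phi> (a \<otimes> b) c + \<phi> ((- 1) \<odot> b) (c \<otimes> a)) xs" by (simp only: sum_pairs_add)
      also have "\<dots> = sum_pairs (\<lambda>b c. \<phi> (a \<otimes> b) c - \<phi> b (c \<otimes> a)) xs"
        using xs(1) a by (intro sum_pairs_cong) (auto simp: FS_iff bilinear_formD[OF \<phi>] mult_closed)
      finally show ?thesis .
    qed
    then show "\<exists>ys\<in>FS. cost ys < e \<and> (\<forall>\<phi>. bilinear_form A \<phi> \<longrightarrow>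
       sum_pairs \<phi> ys = sum_pairs (\<lambda>b c. \<phi> (a \<otimes> b) c - \<phi> b (c \<otimes> a)) xs)" using ys by blast
  qed
qed

end

section \<open>Reiter's condition\<close>

lemma integrable_sum_pairs:
  fixes f :: "'b \<Rightarrow> 'b \<Rightarrow> 'a \<Rightarrow> 'c::{banach, second_countable_topology}"
  assumes "\<And>b c. (b, c) \<in> set xs \<Longrightarrow> integrable M (f b c)"
  shows "integrable M (\<lambda>y. sum_pairs (\<lambda>b c. f b c y) xs)"
    "(\<integral>y. sum_pairs (\<lambda>b c. f b c y) xs \<partial>M) = sum_pairs (\<lambda>b c. \<integral>y. f b c y \<partial>M) xs"
  using assms by (induction xs) auto

section \<open>The Segal algebra as a Banach algebra separated by integration functionals\<close>

context segal_algebra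
begin

abbreviation "LS \<equiv> L1_sub G \<mu> S N"

lemma LS_simps [simp]:
  "carrier LS = S" "mult LS = mult LG" "add LS = add LG" "zero LS = zero LG"
  "smult LS = smult LG" "vnorm LS = N"
  by (simp_all add: L1_sub_def)

lemma S_L1: "X \<in> S \<Longrightarrow> X \<in> carrier LG"
  using subgroup.subset[OF submodule.axioms(1)[OF subspace]] by auto

text \<open>Submultiplicativity combines the module inequality with the contractive embedding. The
  algebraic laws are those of convolution, transferred from functions to classes.\<close>

lemma segal_banach_algebra: "banach_algebra LS"
proof -
  interpret LS: banach_space LS by (rule banach)
  have mult: "X \<otimes>\<^bsub>LG\<^esub> Y \<in> S" if "X \<in> S" "Y \<in> S" for X Y using left_ideal[OF S_L1] that by simp
  have conv_left: "AE x in \<mu>. conv f g x = conv f' g x"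
    if "integrable \<mu> f" "integrable \<mu> f'" "integrable \<mu> g" "AE x in \<mu>. f x = f' x" for f f' g
    using convolution_cong_left[of f f' g] that by (intro AE_I2) (auto simp: space_haar)
  show ?thesis
  proof (intro banach_algebra.intro banach banach_algebra_axioms.intro, simp_all only: LS_simps)
    fix X Y assume X: "X \<in> S" and Y: "Y \<in> S"
    note X' = S_L1[OF X] and Y' = S_L1[OF Y]
    note iX = rep_L1(1)[OF X'] and iY = rep_L1(1)[OF Y']
    show "X \<otimes>\<^bsub>LG\<^esub> Y \<in> S" by (rule mult[OF X Y])
    have "N (X \<otimes>\<^bsub>LG\<^esub> Y) \<le> vnorm LG X * N Y" by (rule contractive_module[OF X' Y])
    also have "\<dots> \<le> N X * N Y"
      using contractive_embedding[OF X] LS.vnorm_nonneg[of Y] Y by (intro mult_right_mono) auto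
    finally show "N (X \<otimes>\<^bsub>LG\<^esub> Y) \<le> N X * N Y" .
    fix c
    note cX = L1_scale[OF X', of c] and cY = L1_scale[OF Y', of c]
    note XY = L1_mult[OF X' Y']
    have "AE x in \<mu>. rep ((c \<odot>\<^bsub>LG\<^esub> X) \<otimes>\<^bsub>LG\<^esub> Y) x = c * conv (rep X) (rep Y) x"
      using L1_mult(2)[OF cX(1) Y'] conv_left[OF rep_L1(1)[OF cX(1)] _ iY cX(2)] iX
      by (auto simp: convolution_scale_left elim: eventually_elim2)
    moreover have "AE x in \<mu>. rep (c \<odot>\<^bsub>LG\<^esub> (X \<otimes>\<^bsub>LG\<^esub> Y)) x = c * conv (rep X) (rep Y) x"
      using L1_scale(2)[OF XY(1), of c] XY(2) by eventually_elim simp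
    ultimately show "(c \<odot>\<^bsub>LG\<^esub> X) \<otimes>\<^bsub>LG\<^esub> Y = c \<odot>\<^bsub>LG\<^esub> (X \<otimes>\<^bsub>LG\<^esub> Y)"
      by (intro L1_eqI'[OF L1_mult(1)[OF cX(1) Y'] L1_scale(1)[OF XY(1)]])
    have "AE x in \<mu>. rep (X \<otimes>\<^bsub>LG\<^esub> (c \<odot>\<^bsub>LG\<^esub> Y)) x = c * conv (rep X) (rep Y) x"
      using L1_mult(2)[OF X' cY(1)] convolution_cong_right[OF iX rep_L1(1)[OF cY(1)] _ cY(2)] iY
      by (auto simp: convolution_scale_right elim: eventually_elim2)
    then show "X \<otimes>\<^bsub>LG\<^esub> (c \<odot>\<^bsub>LG\<^esub> Y) = c \<odot>\<^bsub>LG\<^esub> (X \<otimes>\<^bsub>LG\<^esub> Y)"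
      using \<open>AE x in \<mu>. rep (c \<odot>\<^bsub>LG\<^esub> (X \<otimes>\<^bsub>LG\<^esub> Y)) x = c * conv (rep X) (rep Y) x\<close>
      by (intro L1_eqI'[OF L1_mult(1)[OF X' cY(1)] L1_scale(1)[OF XY(1)]])
  next
    fix X Y Z assume X: "X \<in> S" and Y: "Y \<in> S" and Z: "Z \<in> S"
    note X' = S_L1[OF X] and Y' = S_L1[OF Y] and Z' = S_L1[OF Z]
    note iX = rep_L1(1)[OF X'] and iY = rep_L1(1)[OF Y'] and iZ = rep_L1(1)[OF Z']
    note XY = L1_mult[OF X' Y'] and YZ = L1_mult[OF Y' Z'] and XZ = L1_mult[OF X' Z']
      and ZX = L1_mult[OF Z' X'] and ZY = L1_mult[OF Z' Y']
    note aXY = L1_add[OF X' Y']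
      have "AE x in \<mu>. rep ((X \<otimes>\<^bsub>LG\<^esub> Y) \<otimes>\<^bsub>LG\<^esub> Z) x = conv (rep X) (conv (rep Y) (rep Z)) x"
      using L1_mult(2)[OF XY(1) Z'] conv_left[OF rep_L1(1)[OF XY(1)] convolution_Fubini(2)[OF iX iY] iZ XY(2)]
        convolution_assoc[OF iX iY iZ] by eventually_elim simp
    moreover have "AE x in \<mu>. rep (X \<otimes>\<^bsub>LG\<^esub> (Y \<otimes>\<^bsub>LG\<^esub> Z)) x = conv (rep X) (conv (rep Y) (rep Z)) x"
      using L1_mult(2)[OF X' YZ(1)] convolution_cong_right[OF iX rep_L1(1)[OF YZ(1)] convolution_Fubini(2)[OF iY iZ] YZ(2)]
      by eventually_elim simp
    ultimately show "(X \<otimes>\<^bsub>LG\<^esub> Y) \<otimes>\<^bsub>LG\<^esub> Z = X \<otimes>\<^bsub>LG\<^esub> (Y \<otimes>\<^bsub>LG\<^esub> Z)"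
      by (intro L1_eqI'[OF L1_mult(1)[OF XY(1) Z'] L1_mult(1)[OF X' YZ(1)]])
    have iXY: "integrable \<mu> (\<lambda>x. rep X x + rep Y x)" using iX iY by simp
    have "AE x in \<mu>. rep ((X \<oplus>\<^bsub>LG\<^esub> Y) \<otimes>\<^bsub>LG\<^esub> Z) x = conv (rep X) (rep Z) x + conv (rep Y) (rep Z) x"
      using L1_mult(2)[OF aXY(1) Z'] conv_left[OF rep_L1(1)[OF aXY(1)] iXY iZ aXY(2)] convolution_add_left[OF iX iY iZ]
      by eventually_elim simp
    moreover have "AE x in \<mu>. rep (X \<otimes>\<^bsub>LG\<^esub> Z \<oplus>\<^bsub>LG\<^esub> Y \<otimes>\<^bsub>LG\<^esub> Z) x = conv (rep X) (rep Z) x + conv (rep Y) (rep Z) x"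
      using L1_add(2)[OF XZ(1) YZ(1)] XZ(2) YZ(2) by eventually_elim simp
    ultimately show "(X \<oplus>\<^bsub>LG\<^esub> Y) \<otimes>\<^bsub>LG\<^esub> Z = X \<otimes>\<^bsub>LG\<^esub> Z \<oplus>\<^bsub>LG\<^esub> Y \<otimes>\<^bsub>LG\<^esub> Z"
      by (intro L1_eqI'[OF L1_mult(1)[OF aXY(1) Z'] L1_add(1)[OF XZ(1) YZ(1)]])
    have "AE x in \<mu>. rep (Z \<otimes>\<^bsub>LG\<^esub> (X \<oplus>\<^bsub>LG\<^esub> Y)) x = conv (rep Z) (rep X) x + conv (rep Z) (rep Y) x"
      using L1_mult(2)[OF Z' aXY(1)] convolution_cong_right[OF iZ rep_L1(1)[OF aXY(1)] iXY aXY(2)] convolution_add_right[OF iZ iX iY]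
      by eventually_elim simp
    moreover have "AE x in \<mu>. rep (Z \<otimes>\<^bsub>LG\<^esub> X \<oplus>\<^bsub>LG\<^esub> Z \<otimes>\<^bsub>LG\<^esub> Y) x = conv (rep Z) (rep X) x + conv (rep Z) (rep Y) x"
      using L1_add(2)[OF ZX(1) ZY(1)] ZX(2) ZY(2) by eventually_elim simp
    ultimately show "Z \<otimes>\<^bsub>LG\<^esub> (X \<oplus>\<^bsub>LG\<^esub> Y) = Z \<otimes>\<^bsub>LG\<^esub> X \<oplus>\<^bsub>LG\<^esub> Z \<otimes>\<^bsub>LG\<^esub> Y"
      by (intro L1_eqI'[OF L1_mult(1)[OF Z' aXY(1)] L1_add(1)[OF ZX(1) ZY(1)]])
  qed
qed

lemma segal_separated: "separated_banach_algebra LS (tau ` sets \<mu>)"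
proof (intro separated_banach_algebra.intro segal_banach_algebra separated_banach_algebra_axioms.intro, simp_all only: LS_simps)
  fix \<psi> X assume \<psi>: "\<psi> \<in> tau ` sets \<mu>" and X: "X \<in> S"
  then obtain E where E: "E \<in> sets \<mu>" "\<psi> = tau E" by blast
  show "\<psi> (c \<odot>\<^bsub>LG\<^esub> X) = c * \<psi> X" for c using E tau_scale S_L1[OF X] by simp
  show "cmod (\<psi> X) \<le> N X" using E tau_bound[OF E(1) S_L1[OF X]] contractive_embedding[OF X] by simp
  show "\<psi> (X \<oplus>\<^bsub>LG\<^esub> Y) = \<psi> X + \<psi> Y" if "Y \<in> S" for Y using E tau_add S_L1[OF X] S_L1[OF that] by simp
next
  fix X assume "X \<in> S" "\<And>\<psi>. \<psi> \<in> tau ` sets \<mu> \<Longrightarrow> \<psi> X = 0"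
  then show "X = \<zero>\<^bsub>LG\<^esub>" by (intro tau_separating S_L1) auto
qed

section \<open>Almost invariant functions from approximate diagonals\<close>

lemma convolution_sum_pairs:
  assumes f: "integrable \<mu> f" and g: "\<And>b c. (b, c) \<in> set xs \<Longrightarrow> integrable \<mu> (g b)"
  shows "AE y in \<mu>. conv f (\<lambda>y. sum_pairs (\<lambda>b c. k c * g b y) xs) y = sum_pairs (\<lambda>b c. k c * conv f (g b) y) xs"
  using g
proof (induction xs)
  case Nil then show ?case by (simp add: convolution_def)
next
  case (Cons p xs)
  obtain b c where p: "p = (b, c)" by fastforce
  have i: "integrable \<mu> (\<lambda>y. k c * g b y)" "integrable \<mu> (\<lambda>y. sum_pairs (\<lambda>b c. k c * g b y) xs)"
    using Cons.prems p by (auto intro!: integrable_sum_pairs)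
  have "AE y in \<mu>. conv f (\<lambda>y. sum_pairs (\<lambda>b c. k c * g b y) xs) y = sum_pairs (\<lambda>b c. k c * conv f (g b) y) xs"
    using Cons by auto
  with convolution_add_right[OF f i] show ?case
    by eventually_elim (simp add: p convolution_scale_right)
qed

text \<open>The slice map is applied to two formal sums: \<open>xs\<close>, which gives
  \<open>n\<close>, and the cheap sum \<open>ys\<close> for \<open>a . m - m . a\<close>, which
  gives a function \<open>r'\<close> whose norm is at most the cost. As \<open>ys\<close> is known
  only through bilinear forms, \<open>r'\<close> is identified with
  \<open>a * n - aug a \<cdot> n\<close> by integrating both over Borel sets.\<close>

lemma almost_invariant_module:
  assumes pa: "banach_algebra.pseudo_amenable LS" and F: "finite F" "F \<subseteq> S" and e: "e > 0"
  shows "\<exists>n. integrable \<mu> n \<and> (\<forall>a\<in>F. (\<integral>y. cmod (conv (rep a) n y - aug a * n y) \<partial>\<mu>) < e \<and>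
    cmod (aug a * (\<integral>y. n y \<partial>\<mu>) - aug a) < e)"
proof -
  interpret A: separated_banach_algebra LS "tau ` sets \<mu>" by (rule segal_separated)
  obtain xs where xs: "xs \<in> formal_sums LS" and
    est: "\<And>a. a \<in> F \<Longrightarrow> N (A.vsum (mult LS) xs \<otimes>\<^bsub>LS\<^esub> a \<ominus>\<^bsub>LS\<^esub> a) < e"
      "\<And>a. a \<in> F \<Longrightarrow> \<exists>ys\<in>formal_sums LS. A.cost ys < e \<and> (\<forall>\<phi>. bilinear_form LS \<phi> \<longrightarrow>
       sum_pairs \<phi> ys = sum_pairs (\<lambda>b c. \<phi> (a \<otimes>\<^bsub>LS\<^esub> b) c - \<phi> b (c \<otimes>\<^bsub>LS\<^esub> a)) xs)"
    using A.pseudo_amenable_formal_sums[OF pa F(1) _ e] F(2) by auto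
  have FS: "b \<in> carrier LG" "c \<in> carrier LG" "b \<in> S" "c \<in> S" if "(b, c) \<in> set zs" "zs \<in> formal_sums LS" for b c zs
    using that S_L1 by (auto simp: formal_sums_def)
  define n where "n y = sum_pairs (\<lambda>b c. aug c * rep b y) xs" for y
  have n: "integrable \<mu> n" unfolding n_def using FS[OF _ xs] rep_L1(1) by (intro integrable_sum_pairs) auto
  have int_n: "(\<integral>y. n y \<partial>\<mu>) = sum_pairs (\<lambda>b c. aug b * aug c) xs"
    unfolding n_def using FS[OF _ xs] rep_L1(1)
    by (subst integrable_sum_pairs) (auto intro!: sum_pairs_cong simp: aug_eq)
  show ?thesis
  proof (intro exI[of _ n] conjI ballI n)
    fix a assume aF: "a \<in> F"
    then have aS: "a \<in> S" using F by blast
    note a = S_L1[OF aS]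
    note ia = rep_L1(1)[OF a]
    obtain ys where ys: "ys \<in> formal_sums LS" "A.cost ys < e" "\<And>\<phi>. bilinear_form LS \<phi> \<Longrightarrow>
       sum_pairs \<phi> ys = sum_pairs (\<lambda>b c. \<phi> (a \<otimes>\<^bsub>LS\<^esub> b) c - \<phi> b (c \<otimes>\<^bsub>LS\<^esub> a)) xs" using est(2)[OF aF] by blast
    define r where "r y = conv (rep a) n y - aug a * n y" for y
    define r' where "r' y = sum_pairs (\<lambda>b c. aug c * rep b y) ys" for y
    have ir: "integrable \<mu> r" unfolding r_def using convolution_Fubini(2)[OF ia n] n by auto
    have ir': "integrable \<mu> r'" unfolding r'_def using FS[OF _ ys(1)] rep_L1(1) by (intro integrable_sum_pairs) auto
    have "(\<integral>y. (r y - r' y) * indicator E y \<partial>\<mu>) = 0" if E: "E \<in> sets \<mu>" for E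
    proof -
      have tauE: "(\<integral>y. sum_pairs (\<lambda>b c. aug c * rep b y) zs * indicator E y \<partial>\<mu>) = sum_pairs (\<lambda>b c. tau E b * aug c) zs"
        if zs: "zs \<in> formal_sums LS" for zs
      proof -
        have "sum_pairs (\<lambda>b c. aug c * rep b y) zs * indicator E y = sum_pairs (\<lambda>b c. aug c * (rep b y * indicator E y)) zs" for y
          by (induction zs) (auto simp: algebra_simps)
        moreover have "(\<integral>y. sum_pairs (\<lambda>b c. aug c * (rep b y * indicator E y)) zs \<partial>\<mu>) = sum_pairs (\<lambda>b c. \<integral>y. aug c * (rep b y * indicator E y) \<partial>\<mu>) zs"
          using FS[OF _ zs] rep_L1(1) integrable_times_indicator[OF E] by (intro integrable_sum_pairs(2)) auto
        moreover have "\<dots> = sum_pairs (\<lambda>b c. tau E b * aug c) zs"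
          by (rule sum_pairs_cong) (simp add: tau_def mult.commute)
        ultimately show ?thesis by simp
      qed
      \<comment> \<open>Integrating a slice over \<open>E\<close> amounts to evaluating this
        bilinear form; \<open>aug\<close> appears as a \<open>tau\<close> so that both factors are
        members of the separating family.\<close>
      let ?\<phi> = "\<lambda>b c. tau E b * tau (carrier G) c"
      have "(\<integral>y. r' y * indicator E y \<partial>\<mu>) = sum_pairs ?\<phi> ys"
        unfolding r'_def tauE[OF ys(1)] by (simp add: aug_def)
      also have "\<dots> = sum_pairs (\<lambda>b c. ?\<phi> (a \<otimes>\<^bsub>LS\<^esub> b) c - ?\<phi> b (c \<otimes>\<^bsub>LS\<^esub> a)) xs"
        using E carrier_sets by (intro ys(3) A.bilinear_form_\<Psi>) auto
      also have "\<dots> = sum_pairs (\<lambda>b c. tau E (a \<otimes>\<^bsub>LG\<^esub> b) * aug c + (- aug a) * (tau E b * aug c)) xs"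
        using FS[OF _ xs] a by (intro sum_pairs_cong) (simp add: aug_mult flip: aug_def)
      also have "\<dots> = sum_pairs (\<lambda>b c. tau E (a \<otimes>\<^bsub>LG\<^esub> b) * aug c) xs + (- aug a) * sum_pairs (\<lambda>b c. tau E b * aug c) xs"
        by (simp only: sum_pairs_add sum_pairs_mult)
      also have "sum_pairs (\<lambda>b c. tau E b * aug c) xs = (\<integral>y. n y * indicator E y \<partial>\<mu>)"
        unfolding n_def tauE[OF xs] ..
      also have "sum_pairs (\<lambda>b c. tau E (a \<otimes>\<^bsub>LG\<^esub> b) * aug c) xs = (\<integral>y. conv (rep a) n y * indicator E y \<partial>\<mu>)"
      proof -
        let ?k = "\<lambda>y. sum_pairs (\<lambda>b c. aug c * conv (rep a) (rep b) y) xs"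
        have ik: "integrable \<mu> ?k" using FS[OF _ xs] rep_L1(1) convolution_Fubini(2)[OF ia] by (intro integrable_sum_pairs) auto
        have "(\<integral>y. conv (rep a) n y * indicator E y \<partial>\<mu>) = (\<integral>y. ?k y * indicator E y \<partial>\<mu>)"
        proof (rule integral_cong_AE)
          show "AE y in \<mu>. conv (rep a) n y * indicator E y = ?k y * indicator E y"
            using convolution_sum_pairs[OF ia, of xs rep aug] FS[OF _ xs] rep_L1(1)
            unfolding n_def by (auto elim: eventually_mono)
        qed (use integrable_times_indicator[OF E] convolution_Fubini(2)[OF ia n] ik in auto)
        also have "(\<lambda>y. ?k y * indicator E y) = (\<lambda>y. sum_pairs (\<lambda>b c. aug c * (conv (rep a) (rep b) y * indicator E y)) xs)"
        proof
          fix y show "?k y * indicator E y = sum_pairs (\<lambda>b c. aug c * (conv (rep a) (rep b) y * indicator E y)) xs"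
            by (induction xs) (auto simp: algebra_simps)
        qed
        also have "(\<integral>y. sum_pairs (\<lambda>b c. aug c * (conv (rep a) (rep b) y * indicator E y)) xs \<partial>\<mu>) =
            sum_pairs (\<lambda>b c. \<integral>y. aug c * (conv (rep a) (rep b) y * indicator E y) \<partial>\<mu>) xs"
          using FS[OF _ xs] rep_L1(1) integrable_times_indicator[OF E] convolution_Fubini(2)[OF ia]
          by (intro integrable_sum_pairs(2)) auto
        also have "\<dots> = sum_pairs (\<lambda>b c. tau E (a \<otimes>\<^bsub>LG\<^esub> b) * aug c) xs"
        proof (rule sum_pairs_cong)
          fix b c assume "(b, c) \<in> set xs"
          then have b: "b \<in> carrier LG" using FS[OF _ xs] by blast
          have "tau E (a \<otimes>\<^bsub>LG\<^esub> b) = (\<integral>y. conv (rep a) (rep b) y * indicator E y \<partial>\<mu>)"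
            using L1_mult[OF a b] convolution_Fubini(2)[OF ia rep_L1(1)[OF b]] by (intro tau_eq E) auto
          then show "(\<integral>y. aug c * (conv (rep a) (rep b) y * indicator E y) \<partial>\<mu>) = tau E (a \<otimes>\<^bsub>LG\<^esub> b) * aug c"
            by (simp add: mult.commute)
        qed
        finally show ?thesis ..
      qed
      also have "(\<integral>y. conv (rep a) n y * indicator E y \<partial>\<mu>) + (- aug a) * (\<integral>y. n y * indicator E y \<partial>\<mu>)
          = (\<integral>y. r y * indicator E y \<partial>\<mu>)"
        unfolding r_def using integrable_times_indicator[OF E n] integrable_times_indicator[OF E convolution_Fubini(2)[OF ia n]]
        by (simp add: left_diff_distrib mult.assoc)
      finally have "(\<integral>y. r' y * indicator E y \<partial>\<mu>) = (\<integral>y. r y * indicator E y \<partial>\<mu>)" .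
      then show ?thesis using integrable_times_indicator[OF E ir] integrable_times_indicator[OF E ir']
        by (simp add: left_diff_distrib)
    qed
    then have "AE y in \<mu>. r y - r' y = 0" using ir ir' by (intro integral_indicators_zero_imp_AE) auto
    then have "(\<integral>y. cmod (r y) \<partial>\<mu>) = (\<integral>y. cmod (r' y) \<partial>\<mu>)"
      using ir ir' by (intro integral_cong_AE) (auto elim: eventually_mono)
    also have "\<dots> \<le> (\<integral>y. sum_pairs (\<lambda>b c. cmod (aug c) * cmod (rep b y)) ys \<partial>\<mu>)"
    proof (rule integral_mono)
      show "integrable \<mu> (\<lambda>y. sum_pairs (\<lambda>b c. cmod (aug c) * cmod (rep b y)) ys)"
        using FS[OF _ ys(1)] rep_L1(1) by (intro integrable_sum_pairs) auto
      show "cmod (r' y) \<le> sum_pairs (\<lambda>b c. cmod (aug c) * cmod (rep b y)) ys" for y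
        unfolding r'_def by (intro norm_sum_pairs_le) (simp add: norm_mult)
    qed (use ir' in simp)
    also have "\<dots> = sum_pairs (\<lambda>b c. \<integral>y. cmod (aug c) * cmod (rep b y) \<partial>\<mu>) ys"
      using FS[OF _ ys(1)] rep_L1(1) by (intro integrable_sum_pairs) auto
    also have "\<dots> \<le> norm (sum_pairs (\<lambda>b c. \<integral>y. cmod (aug c) * cmod (rep b y) \<partial>\<mu>) ys)" by simp
    also have "\<dots> \<le> A.cost ys" unfolding A.cost_def
    proof (rule norm_sum_pairs_le)
      fix b c assume "(b, c) \<in> set ys"
      note bc = FS[OF this ys(1)]
      have "cmod (aug c) \<le> N c" using tau_bound[OF carrier_sets bc(2)] contractive_embedding[OF bc(4)] by (simp add: aug_def)
      moreover have "(\<integral>y. cmod (rep b y) \<partial>\<mu>) \<le> N b" using contractive_embedding[OF bc(3)] by (simp add: L1_vnorm)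
      ultimately have "cmod (aug c) * (\<integral>y. cmod (rep b y) \<partial>\<mu>) \<le> N c * N b"
        using A.vnorm_nonneg[of c] bc by (intro mult_mono) auto
      then show "norm (\<integral>y. cmod (aug c) * cmod (rep b y) \<partial>\<mu>) \<le> vnorm LS b * vnorm LS c"
        by (simp add: mult.commute)
    qed
    also have "\<dots> < e" by (rule ys(2))
    finally show "(\<integral>y. cmod (conv (rep a) n y - aug a * n y) \<partial>\<mu>) < e" by (simp add: r_def)
    \<comment> \<open>The product of the diagonal has the same augmentation as \<open>n\<close>, so
      that \<open>p * a\<close> being close to \<open>a\<close> says how close \<open>aug a\<close>
      times the integral of \<open>n\<close> is to \<open>aug a\<close>.\<close>
    define p where "p = A.vsum (mult LS) xs"
    have p: "p \<in> S" unfolding p_def using A.vsum_closed[OF xs, of "mult LS"] A.mult_closed by auto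
    have augp: "aug p = sum_pairs (\<lambda>b c. aug b * aug c) xs"
      unfolding p_def aug_def using carrier_sets FS[OF _ xs]
      by (subst A.\<Psi>_vsum_mult[OF xs]) (auto intro!: sum_pairs_cong aug_mult simp flip: aug_def)
    have pa: "p \<otimes>\<^bsub>LG\<^esub> a \<in> S" using left_ideal[OF S_L1[OF p] aS] .
    have d: "p \<otimes>\<^bsub>LS\<^esub> a \<ominus>\<^bsub>LS\<^esub> a = p \<otimes>\<^bsub>LG\<^esub> a \<oplus>\<^bsub>LG\<^esub> (- 1) \<odot>\<^bsub>LG\<^esub> a"
      using A.minus_eq_scale[of "p \<otimes>\<^bsub>LS\<^esub> a" a] pa aS by simp
    have dS: "p \<otimes>\<^bsub>LS\<^esub> a \<ominus>\<^bsub>LS\<^esub> a \<in> S" using A.minus_closed'[of "p \<otimes>\<^bsub>LS\<^esub> a" a] pa aS by simp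
    have "aug (p \<otimes>\<^bsub>LS\<^esub> a \<ominus>\<^bsub>LS\<^esub> a) = aug p * aug a - aug a"
      unfolding d using carrier_sets L1_scale[OF a] S_L1[OF pa] S_L1[OF p] a
      by (simp add: aug_def tau_add tau_scale aug_mult[unfolded aug_def])
    moreover have "cmod (aug (p \<otimes>\<^bsub>LS\<^esub> a \<ominus>\<^bsub>LS\<^esub> a)) \<le> N (p \<otimes>\<^bsub>LS\<^esub> a \<ominus>\<^bsub>LS\<^esub> a)"
      using tau_bound[OF carrier_sets S_L1[OF dS]] contractive_embedding[OF dS] by (simp add: aug_def)
    ultimately have "cmod (aug p * aug a - aug a) < e" using est(1)[OF aF] by (simp add: p_def)
    then show "cmod (aug a * (\<integral>y. n y \<partial>\<mu>) - aug a) < e" by (simp add: int_n augp mult.commute)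
  qed
qed

text \<open>Inner regularity gives a compact set of positive finite measure \<open>m\<close>. Its
  indicator has integral \<open>m\<close>, and by density some element of \<open>S\<close> is at
  distance less than \<open>m\<close> from it, too close for its integral to vanish.\<close>

lemma ex_aug_nonzero: "\<exists>a\<in>S. aug a \<noteq> 0"
proof -
  have "openin T (carrier G)" using openin_topspace[of T] by (simp add: topspace_eq)
  from inner_regular[OF this] nonzero obtain K where K: "compactin T K" "emeasure \<mu> K \<noteq> 0"
    by (metis (no_types, lifting) SUP_bot_conv(1) bot_ennreal mem_Collect_eq)
  have Ks: "K \<in> sets \<mu>" "emeasure \<mu> K < \<infinity>" using compactin_sets[OF K(1)] finite_compact[OF K(1)] by auto
  define m where "m = measure \<mu> K"
  have m: "m > 0" using K(2) Ks by (simp add: m_def measure_eq_emeasure_eq_ennreal emeasure_eq_ennreal_measure zero_less_measure_iff less_top[symmetric])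
  let ?f = "\<lambda>x. complex_of_real (indicator K x)"
  have f: "integrable \<mu> ?f" using Ks by (auto intro!: integrable_of_real simp: less_top[symmetric])
  let ?X = "ae_class ?f"
  have X: "?X \<in> carrier LG" by (rule ae_class_in_L1[OF f])
  have augX: "aug ?X = complex_of_real m"
  proof -
    have "aug ?X = (\<integral>x. ?f x \<partial>\<mu>)" unfolding aug_eq
      using rep_ae_class[OF f] rep_L1(1)[OF X] f by (intro integral_cong_AE) auto
    also have "\<dots> = complex_of_real (\<integral>x. indicator K x \<partial>\<mu>)" by (rule integral_complex_of_real)
    finally show ?thesis using Ks by (simp add: m_def)
  qed
  interpret L: normed_space "LG" by (rule L1_normed_space)
  interpret M: Metric_space "carrier LG" "ndist LG" by (rule L.Metric_space_ndist)
  have "?X \<in> M.mtopology closure_of S" using dense X by (simp add: ntopology_def)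
  then obtain a where a: "a \<in> S" "a \<in> M.mball ?X m" using m unfolding M.metric_closure_of by blast
  note aL = S_L1[OF a(1)]
  have "vnorm LG (?X \<ominus>\<^bsub>LG\<^esub> a) < m" using a(2) X aL by (simp add: M.mball_def ndist_def)
  moreover have "aug (?X \<ominus>\<^bsub>LG\<^esub> a) = aug ?X - aug a"
    using X aL carrier_sets by (simp add: L.minus_eq_scale aug_def tau_add tau_scale)
  moreover have "cmod (aug (?X \<ominus>\<^bsub>LG\<^esub> a)) \<le> vnorm LG (?X \<ominus>\<^bsub>LG\<^esub> a)"
    using tau_bound[OF carrier_sets L.minus_closed'[OF X aL]] by (simp add: aug_def)
  ultimately have "cmod (complex_of_real m - aug a) < m" using augX by simp
  then have "aug a \<noteq> 0" using m by auto
  then show ?thesis using a(1) by blast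
qed

lemma almost_invariant:
  assumes pa: "banach_algebra.pseudo_amenable LS" and K: "finite K" "K \<subseteq> carrier G" and \<delta>: "\<delta> > 0"
  shows "\<exists>p :: 'a \<Rightarrow> real. integrable \<mu> p \<and> (\<forall>y. 0 \<le> p y) \<and> (\<integral>y. p y \<partial>\<mu>) = 1 \<and>
    (\<forall>x\<in>K. (\<integral>y. \<bar>p (inv x \<otimes> y) - p y\<bar> \<partial>\<mu>) \<le> \<delta>)"
proof -
  obtain a where aS: "a \<in> S" and \<kappa>0: "aug a \<noteq> 0" using ex_aug_nonzero by blast
  note a = S_L1[OF aS]
  note ia = rep_L1(1)[OF a]
  define \<kappa> where "\<kappa> = aug a"
  \<comment> \<open>The first bound keeps the norm \<open>c\<close> of \<open>g\<close> at least
    \<open>cmod \<kappa> / 2\<close>; the second then makes \<open>2 * e / c\<close> at most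
    \<open>\<delta>\<close>.\<close>
  define e where "e = min (cmod \<kappa> / 2) (\<delta> * cmod \<kappa> / 4)"
  have e: "e > 0" "e \<le> cmod \<kappa> / 2" "e \<le> \<delta> * cmod \<kappa> / 4" using \<kappa>0 \<delta> by (auto simp: e_def \<kappa>_def)
  \<comment> \<open>All these elements have the same augmentation \<open>\<kappa>\<close>, so the
    convolution of each of them with \<open>n\<close> is within \<open>e\<close> of the one function
    \<open>\<kappa> \<cdot> n\<close>.\<close>
  let ?F = "insert a ((\<lambda>x. L1_ltrans G \<mu> x a) ` K)"
  have "finite ?F" "?F \<subseteq> S" using K aS translation_closed[OF _ aS] by auto
  from almost_invariant_module[OF pa this e(1)] obtain n where n: "integrable \<mu> n"
    and n1: "\<And>b. b \<in> ?F \<Longrightarrow> (\<integral>y. cmod (conv (rep b) n y - aug b * n y) \<partial>\<mu>) < e"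
    and n2: "\<And>b. b \<in> ?F \<Longrightarrow> cmod (aug b * (\<integral>y. n y \<partial>\<mu>) - aug b) < e" by blast
  define g where "g = conv (rep a) n"
  have g: "integrable \<mu> g" unfolding g_def by (rule convolution_Fubini(2)[OF ia n])
  have "(\<integral>y. g y \<partial>\<mu>) = \<kappa> * (\<integral>y. n y \<partial>\<mu>)" unfolding g_def \<kappa>_def aug_eq by (rule convolution_Fubini(3)[OF ia n])
  then have "cmod ((\<integral>y. g y \<partial>\<mu>) - \<kappa>) < e" using n2[of a] by (simp add: \<kappa>_def)
  then have "cmod (\<integral>y. g y \<partial>\<mu>) \<ge> cmod \<kappa> / 2"
    using e norm_triangle_ineq2[of \<kappa> "\<integral>y. g y \<partial>\<mu>"] by (simp add: norm_minus_commute)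
  then have c: "(\<integral>y. cmod (g y) \<partial>\<mu>) \<ge> cmod \<kappa> / 2" using integral_norm_bound[of \<mu> g] by linarith
  define c where "c = (\<integral>y. cmod (g y) \<partial>\<mu>)"
  have c0: "c > 0" using c \<kappa>0 unfolding c_def \<kappa>_def by (smt (verit) half_gt_zero zero_less_norm_iff)
  have inv: "(\<integral>y. cmod (ltrans G x g y - g y) \<partial>\<mu>) \<le> 2 * e" if x: "x \<in> K" for x
  proof -
    have xG: "x \<in> carrier G" using x K by blast
    let ?b = "L1_ltrans G \<mu> x a"
    have b: "?b \<in> carrier LG" and rb: "AE y in \<mu>. rep ?b y = ltrans G x (rep a) y" using L1_ltrans[OF a xG] by auto
    have ib: "integrable \<mu> (rep ?b)" by (rule rep_L1(1)[OF b])
    have lg: "integrable \<mu> (ltrans G x g)" by (rule ltrans_integrable(1)[OF xG g])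
    have eqb: "conv (rep ?b) n y = ltrans G x g y" if "y \<in> carrier G" for y
      using convolution_cong_left[OF _ _ rb _ that, of n] ib ltrans_integrable(1)[OF xG ia] n
        ltrans_convolution[OF xG that _ _, of "rep a" n] ia by (simp add: g_def)
    have "(\<integral>y. cmod (conv (rep ?b) n y - aug ?b * n y) \<partial>\<mu>) = (\<integral>y. cmod (ltrans G x g y - \<kappa> * n y) \<partial>\<mu>)"
      by (intro Bochner_Integration.integral_cong) (auto simp: space_haar eqb \<kappa>_def aug_ltrans[OF a xG])
    then have 1: "(\<integral>y. cmod (ltrans G x g y - \<kappa> * n y) \<partial>\<mu>) < e" using n1[of ?b] x by simp
    have 2: "(\<integral>y. cmod (g y - \<kappa> * n y) \<partial>\<mu>) < e" using n1[of a] by (simp add: g_def \<kappa>_def)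
    have "(\<integral>y. cmod (ltrans G x g y - g y) \<partial>\<mu>) \<le> (\<integral>y. cmod (ltrans G x g y - \<kappa> * n y) + cmod (g y - \<kappa> * n y) \<partial>\<mu>)"
    proof (rule integral_mono)
      fix y
      show "cmod (ltrans G x g y - g y) \<le> cmod (ltrans G x g y - \<kappa> * n y) + cmod (g y - \<kappa> * n y)"
        using norm_triangle_ineq4[of "ltrans G x g y - \<kappa> * n y" "g y - \<kappa> * n y"] by simp
    qed (use g lg n in auto)
    also have "\<dots> = (\<integral>y. cmod (ltrans G x g y - \<kappa> * n y) \<partial>\<mu>) + (\<integral>y. cmod (g y - \<kappa> * n y) \<partial>\<mu>)"
      using g lg n by (intro Bochner_Integration.integral_add) auto
    finally show ?thesis using 1 2 by linarith
  qed
  define p where "p y = cmod (g y) / c" for y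
  have ip: "integrable \<mu> p" unfolding p_def using g by simp
  show ?thesis
  proof (intro exI[of _ p] conjI ip allI ballI)
    show "0 \<le> p y" for y using c0 by (simp add: p_def)
    show "(\<integral>y. p y \<partial>\<mu>) = 1" using c0 by (simp add: p_def flip: c_def)
    fix x assume x: "x \<in> K"
    then have xG: "x \<in> carrier G" using K by blast
    have lg: "integrable \<mu> (ltrans G x g)" by (rule ltrans_integrable(1)[OF xG g])
    have le: "\<bar>p (inv x \<otimes> y) - p y\<bar> \<le> cmod (ltrans G x g y - g y) / c" for y
    proof -
      have "\<bar>p (inv x \<otimes> y) - p y\<bar> = \<bar>cmod (ltrans G x g y) - cmod (g y)\<bar> / c"
        using c0 by (simp add: p_def ltrans_def flip: diff_divide_distrib)
      also have "\<dots> \<le> cmod (ltrans G x g y - g y) / c"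
        using c0 by (intro divide_right_mono norm_triangle_ineq3) auto
      finally show ?thesis .
    qed
    have ipx: "integrable \<mu> (\<lambda>y. p (inv x \<otimes> y))" using lg unfolding p_def ltrans_def by simp
    have "(\<integral>y. \<bar>p (inv x \<otimes> y) - p y\<bar> \<partial>\<mu>) \<le> (\<integral>y. cmod (ltrans G x g y - g y) / c \<partial>\<mu>)"
      using ip ipx lg g le by (intro integral_mono) auto
    also have "\<dots> = (\<integral>y. cmod (ltrans G x g y - g y) \<partial>\<mu>) / c" by simp
    also have "\<dots> \<le> 2 * e / c" using inv[OF x] c0 by (intro divide_right_mono) auto
    also have "\<dots> \<le> \<delta>"
    proof -
      have "2 * e \<le> \<delta> * (cmod \<kappa> / 2)" using e(3) by simp
      also have "\<dots> \<le> \<delta> * c" using c \<delta> by (intro mult_left_mono) (auto simp: c_def)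
      finally show ?thesis using c0 by (simp add: pos_divide_le_eq)
    qed
    finally show "(\<integral>y. \<bar>p (inv x \<otimes> y) - p y\<bar> \<partial>\<mu>) \<le> \<delta>" .
  qed
qed

end

section \<open>Invariant means\<close>

text \<open>The set is a product of closed discs over all functions, in the topology of pointwise
  convergence.\<close>

lemma compact_functionals: "compact {\<Lambda> :: ('a \<Rightarrow> complex) \<Rightarrow> complex. \<forall>f. cmod (\<Lambda> f) \<le> B f}"
proof -
  have "compactin (product_topology (\<lambda>f. euclidean) UNIV) (\<Pi>\<^sub>E f\<in>UNIV. cball (0::complex) (B f))"
    unfolding compactin_PiE by simp
  then have "compact (\<Pi>\<^sub>E f\<in>UNIV. cball (0::complex) (B f))"
    by (simp add: euclidean_product_topology)
  moreover have "(\<Pi>\<^sub>E f\<in>UNIV. cball (0::complex) (B f)) = {\<Lambda>. \<forall>f. cmod (\<Lambda> f) \<le> B f}" by (auto simp: PiE_def)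
  ultimately show ?thesis by simp
qed

lemma continuous_eval: "continuous_on UNIV (\<lambda>\<Lambda> :: ('a \<Rightarrow> complex) \<Rightarrow> complex. \<Lambda> f)"
  by (rule continuous_on_product_coordinates)

context left_haar_measure
begin

section \<open>Pairing locally bounded functions with integrable functions\<close>

lemma Linf_bound:
  assumes "f \<in> Linf \<mu>"
  obtains C where "0 \<le> C" "loc_AE \<mu> (\<lambda>x. cmod (f x) \<le> C)"
proof -
  obtain C where C: "loc_AE \<mu> (\<lambda>x. cmod (f x) \<le> C)" using assms by (auto simp: Linf_def)
  have "loc_AE \<mu> (\<lambda>x. cmod (f x) \<le> max C 0)"
    unfolding loc_AE_def
  proof
    fix E assume "E \<in> fmeasurable \<mu>"
    then have "AE x in \<mu>. x \<in> E \<longrightarrow> cmod (f x) \<le> C" using C by (auto simp: loc_AE_def)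
    then show "AE x in \<mu>. x \<in> E \<longrightarrow> cmod (f x) \<le> max C 0" by eventually_elim auto
  qed
  then show ?thesis using that[of "max C 0"] by simp
qed

lemma Linf_norm_nonneg: "f \<in> Linf \<mu> \<Longrightarrow> 0 \<le> Linf_norm \<mu> f"
  unfolding Linf_norm_def by (rule cInf_greatest) (auto elim: Linf_bound)

text \<open>\<open>f\<close> is measurable and bounded only locally, but \<open>p\<close> lives on
  the countably many sets \<open>E n\<close> of finite measure. On each of them the local conditions
  are genuine ones, and countably many null sets may be discarded.\<close>

lemma Linf_pairing:
  fixes p :: "'a \<Rightarrow> real"
  assumes f: "f \<in> Linf \<mu>" and p: "integrable \<mu> p"
  shows "integrable \<mu> (\<lambda>y. f y * complex_of_real (p y))"
    and "cmod (\<integral>y. f y * complex_of_real (p y) \<partial>\<mu>) \<le> Linf_norm \<mu> f * (\<integral>y. \<bar>p y\<bar> \<partial>\<mu>)"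
proof -
  define E where "E n = {y \<in> space \<mu>. 1 / real (Suc n) \<le> \<bar>p y\<bar>}" for n
  have Es: "E n \<in> sets \<mu>" for n unfolding E_def using p by measurable
  have Ef: "E n \<in> fmeasurable \<mu>" for n
  proof (rule fmeasurableI[OF Es])
    have "emeasure \<mu> (E n) \<le> (1 / (1 / real (Suc n))) * (\<integral>x. \<bar>p x\<bar> \<partial>\<mu>)"
      unfolding E_def using p by (intro integral_Markov_inequality) auto
    then show "emeasure \<mu> (E n) < \<infinity>" by (rule le_less_trans) simp
  qed
  have Ep: "\<forall>\<^sub>F n in sequentially. y \<in> E n" if y: "y \<in> space \<mu>" "p y \<noteq> 0" for y
  proof -
    obtain n where n: "1 / real (Suc n) < \<bar>p y\<bar>" using nat_approx_posE[of "\<bar>p y\<bar>"] y by auto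
    have "1 / real (Suc m) \<le> \<bar>p y\<bar>" if "m \<ge> n" for m
    proof -
      have "1 / real (Suc m) \<le> 1 / real (Suc n)" using that by (intro divide_left_mono) auto
      then show ?thesis using n by linarith
    qed
    then show ?thesis using y unfolding eventually_sequentially E_def by auto
  qed
  have fm: "(\<lambda>y. f y * indicator (E n) y) \<in> borel_measurable \<mu>" for n
  proof -
    have "f \<in> borel_measurable (restrict_space \<mu> (E n))" using f Ef by (auto simp: Linf_def)
    then have "(\<lambda>y. indicator (E n) y *\<^sub>R f y) \<in> borel_measurable \<mu>"
      using Es by (subst (asm) borel_measurable_restrict_space_iff) auto
    moreover have "(\<lambda>y. indicator (E n) y *\<^sub>R f y) = (\<lambda>y. f y * indicator (E n) y)" by (auto simp: indicator_def)
    ultimately show ?thesis by simp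
  qed
  have meas: "(\<lambda>y. f y * complex_of_real (p y)) \<in> borel_measurable \<mu>"
  proof (rule borel_measurable_LIMSEQ_metric)
    have "p \<in> borel_measurable \<mu>" using p by simp
    then show "(\<lambda>y. (f y * indicator (E n) y) * complex_of_real (p y)) \<in> borel_measurable \<mu>" for n
      by (intro borel_measurable_times fm) measurable
    fix y assume y: "y \<in> space \<mu>"
    show "(\<lambda>n. (f y * indicator (E n) y) * complex_of_real (p y)) \<longlonglongrightarrow> f y * complex_of_real (p y)"
    proof (cases "p y = 0")
      case False
      have "\<forall>\<^sub>F n in sequentially. (f y * indicator (E n) y) * complex_of_real (p y) = f y * complex_of_real (p y)"
        using Ep[OF y False] by eventually_elim simp
      then show ?thesis by (rule tendsto_eventually)
    qed simp
  qed
  have bound: "AE y in \<mu>. cmod (f y * complex_of_real (p y)) \<le> C * \<bar>p y\<bar>"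
    if C: "0 \<le> C" "loc_AE \<mu> (\<lambda>x. cmod (f x) \<le> C)" for C
  proof -
    have "AE y in \<mu>. \<forall>n. y \<in> E n \<longrightarrow> cmod (f y) \<le> C"
      using C(2) Ef unfolding AE_all_countable loc_AE_def by blast
    with AE_space show ?thesis
    proof eventually_elim
      fix y assume y: "y \<in> space \<mu>" "\<forall>n. y \<in> E n \<longrightarrow> cmod (f y) \<le> C"
      show "cmod (f y * complex_of_real (p y)) \<le> C * \<bar>p y\<bar>"
      proof (cases "p y = 0")
        case False
        then obtain n where "y \<in> E n" using eventually_happens'[OF sequentially_bot Ep[OF y(1) False]] by blast
        then have "cmod (f y) \<le> C" using y(2) by blast
        then show ?thesis by (simp add: norm_mult mult_right_mono)
      qed simp
    qed
  qed
  obtain C0 where C0: "0 \<le> C0" "loc_AE \<mu> (\<lambda>x. cmod (f x) \<le> C0)" using Linf_bound[OF f] .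
  have ip: "integrable \<mu> (\<lambda>y. \<bar>p y\<bar>)" using p by simp
  have ic: "integrable \<mu> (\<lambda>y. C * \<bar>p y\<bar>)" for C using ip by simp
  show i: "integrable \<mu> (\<lambda>y. f y * complex_of_real (p y))"
    using bound[OF C0] by (intro Bochner_Integration.integrable_bound[OF ic[of C0] meas]) (auto elim: eventually_mono)
  have le: "cmod (\<integral>y. f y * complex_of_real (p y) \<partial>\<mu>) \<le> C * (\<integral>y. \<bar>p y\<bar> \<partial>\<mu>)"
    if C: "0 \<le> C" "loc_AE \<mu> (\<lambda>x. cmod (f x) \<le> C)" for C
  proof -
    have "cmod (\<integral>y. f y * complex_of_real (p y) \<partial>\<mu>) \<le> (\<integral>y. cmod (f y * complex_of_real (p y)) \<partial>\<mu>)" by (rule integral_norm_bound)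
    also have "\<dots> \<le> (\<integral>y. C * \<bar>p y\<bar> \<partial>\<mu>)" using i ic bound[OF C] by (intro integral_mono_AE) auto
    finally show ?thesis by simp
  qed
  show "cmod (\<integral>y. f y * complex_of_real (p y) \<partial>\<mu>) \<le> Linf_norm \<mu> f * (\<integral>y. \<bar>p y\<bar> \<partial>\<mu>)"
  proof (cases "(\<integral>y. \<bar>p y\<bar> \<partial>\<mu>) = 0")
    case True
    then show ?thesis using le[OF C0] by simp
  next
    \<comment> \<open>After division by the norm of \<open>p\<close> the estimate bounds every
      admissible \<open>C\<close> from below, and hence the infimum that defines
      \<open>Linf_norm\<close>.\<close>
    case False
    moreover have "0 \<le> (\<integral>y. \<bar>p y\<bar> \<partial>\<mu>)" by simp
    ultimately have J: "(\<integral>y. \<bar>p y\<bar> \<partial>\<mu>) > 0" by linarith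
    have "cmod (\<integral>y. f y * complex_of_real (p y) \<partial>\<mu>) / (\<integral>y. \<bar>p y\<bar> \<partial>\<mu>) \<le> Linf_norm \<mu> f"
      unfolding Linf_norm_def
    proof (rule cInf_greatest)
      show "{C. 0 \<le> C \<and> loc_AE \<mu> (\<lambda>x. cmod (f x) \<le> C)} \<noteq> {}" using C0 by blast
      fix C assume "C \<in> {C. 0 \<le> C \<and> loc_AE \<mu> (\<lambda>x. cmod (f x) \<le> C)}"
      then show "cmod (\<integral>y. f y * complex_of_real (p y) \<partial>\<mu>) / (\<integral>y. \<bar>p y\<bar> \<partial>\<mu>) \<le> C"
        using le[of C] J by (simp add: pos_divide_le_eq)
    qed
    then show ?thesis using J by (simp add: pos_divide_le_eq)
  qed
qed

lemma Linf_one: "(\<lambda>x. 1) \<in> Linf \<mu>"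
  by (auto simp: Linf_def loc_AE_def intro!: exI[of _ 1])

lemma Linf_add:
  assumes "f \<in> Linf \<mu>" "g \<in> Linf \<mu>"
  shows "(\<lambda>x. f x + g x) \<in> Linf \<mu>"
proof -
  obtain C D where C: "loc_AE \<mu> (\<lambda>x. cmod (f x) \<le> C)" and D: "loc_AE \<mu> (\<lambda>x. cmod (g x) \<le> D)"
    using assms by (auto simp: Linf_def)
  have "loc_AE \<mu> (\<lambda>x. cmod (f x + g x) \<le> C + D)"
    unfolding loc_AE_def
  proof
    fix E assume E: "E \<in> fmeasurable \<mu>"
    have "AE x in \<mu>. x \<in> E \<longrightarrow> cmod (f x) \<le> C" "AE x in \<mu>. x \<in> E \<longrightarrow> cmod (g x) \<le> D" using C D E by (auto simp: loc_AE_def)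
    then show "AE x in \<mu>. x \<in> E \<longrightarrow> cmod (f x + g x) \<le> C + D" by eventually_elim (auto intro: norm_triangle_mono)
  qed
  then show ?thesis using assms by (auto simp: Linf_def intro!: borel_measurable_add)
qed

lemma Linf_scale:
  assumes "f \<in> Linf \<mu>"
  shows "(\<lambda>x. c * f x) \<in> Linf \<mu>"
proof -
  obtain C where C: "loc_AE \<mu> (\<lambda>x. cmod (f x) \<le> C)" using assms by (auto simp: Linf_def)
  have "loc_AE \<mu> (\<lambda>x. cmod (c * f x) \<le> cmod c * C)"
    unfolding loc_AE_def
  proof
    fix E assume E: "E \<in> fmeasurable \<mu>"
    have "AE x in \<mu>. x \<in> E \<longrightarrow> cmod (f x) \<le> C" using C E by (auto simp: loc_AE_def)
    then show "AE x in \<mu>. x \<in> E \<longrightarrow> cmod (c * f x) \<le> cmod c * C" by eventually_elim (auto simp: norm_mult mult_left_mono)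
  qed
  then show ?thesis using assms by (auto simp: Linf_def intro!: borel_measurable_times)
qed

text \<open>The local conditions for the translate on \<open>E\<close> are those for
  \<open>f\<close> on the translate of \<open>E\<close> by \<open>inv x\<close>, which has the same
  finite measure.\<close>

lemma Linf_ltrans:
  assumes x: "x \<in> carrier G" and f: "f \<in> Linf \<mu>"
  shows "ltrans G x f \<in> Linf \<mu>"
proof -
  have ix: "inv x \<in> carrier G" using x by simp
  obtain C where C: "loc_AE \<mu> (\<lambda>x. cmod (f x) \<le> C)" using f by (auto simp: Linf_def)
  let ?E = "\<lambda>E. (\<lambda>y. x \<otimes> y) -` E \<inter> space \<mu>"
  have tr: "?E E \<in> fmeasurable \<mu>" if E: "E \<in> fmeasurable \<mu>" for E
  proof (rule fmeasurableI)
    show "?E E \<in> sets \<mu>" using measurable_sets[OF measurable_lmult[OF x]] E by auto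
    have "emeasure \<mu> (?E E) = emeasure (distr \<mu> \<mu> (\<lambda>y. x \<otimes> y)) E"
      using E by (intro emeasure_distr[symmetric] measurable_lmult x) auto
    then show "emeasure \<mu> (?E E) < \<infinity>" using E by (simp add: distr_lmult[OF x] fmeasurable_def)
  qed
  have mem: "inv x \<otimes> y \<in> ?E E" if "y \<in> E" "y \<in> space \<mu>" for y E
    using that x ix by (simp add: space_haar flip: m_assoc)
  have "loc_AE \<mu> (\<lambda>y. cmod (ltrans G x f y) \<le> C)"
    unfolding loc_AE_def
  proof
    fix E assume E: "E \<in> fmeasurable \<mu>"
    have "AE y in \<mu>. y \<in> ?E E \<longrightarrow> cmod (f y) \<le> C" using C tr[OF E] by (auto simp: loc_AE_def)
    from AE_space AE_lmult[OF ix this] show "AE y in \<mu>. y \<in> E \<longrightarrow> cmod (ltrans G x f y) \<le> C"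
      by eventually_elim (use mem in \<open>auto simp: ltrans_def\<close>)
  qed
  moreover have "ltrans G x f \<in> borel_measurable (restrict_space \<mu> E)" if E: "E \<in> fmeasurable \<mu>" for E
  proof -
    have "(\<lambda>y. inv x \<otimes> y) \<in> measurable (restrict_space \<mu> E) (restrict_space \<mu> (?E E))"
    proof (rule measurable_restrict_space2)
      show "(\<lambda>y. inv x \<otimes> y) \<in> space (restrict_space \<mu> E) \<rightarrow> ?E E" using mem by (auto simp: space_restrict_space)
      show "(\<lambda>y. inv x \<otimes> y) \<in> measurable (restrict_space \<mu> E) \<mu>" by (rule measurable_restrict_space1[OF measurable_lmult[OF ix]])
    qed
    moreover have "f \<in> borel_measurable (restrict_space \<mu> (?E E))" using f tr[OF E] by (auto simp: Linf_def)
    ultimately show ?thesis unfolding ltrans_def by (rule measurable_compose)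
  qed
  ultimately show ?thesis by (auto simp: Linf_def)
qed

text \<open>The substitution of \<open>x \<otimes> y\<close> for \<open>y\<close> moves the
  translation from \<open>f\<close> to \<open>p\<close>, where it becomes translation by the
  inverse.\<close>

lemma Linf_pairing_ltrans:
  fixes p :: "'a \<Rightarrow> real"
  assumes x: "x \<in> carrier G" and f: "f \<in> Linf \<mu>" and p: "integrable \<mu> p"
  shows "cmod ((\<integral>y. ltrans G x f y * complex_of_real (p y) \<partial>\<mu>) - (\<integral>y. f y * complex_of_real (p y) \<partial>\<mu>))
    \<le> Linf_norm \<mu> f * (\<integral>y. \<bar>p (x \<otimes> y) - p y\<bar> \<partial>\<mu>)"
proof -
  have m: "(\<lambda>y. ltrans G x f y * complex_of_real (p y)) \<in> borel_measurable \<mu>"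
    using Linf_pairing(1)[OF Linf_ltrans[OF x f] p] by simp
  have "(\<integral>y. ltrans G x f y * complex_of_real (p y) \<partial>\<mu>) = (\<integral>y. ltrans G x f (x \<otimes> y) * complex_of_real (p (x \<otimes> y)) \<partial>\<mu>)"
    using integral_lmult[OF x m] by simp
  also have "\<dots> = (\<integral>y. f y * complex_of_real (p (x \<otimes> y)) \<partial>\<mu>)"
    using x by (intro Bochner_Integration.integral_cong) (auto simp: space_haar ltrans_def simp flip: m_assoc)
  finally have 1: "(\<integral>y. ltrans G x f y * complex_of_real (p y) \<partial>\<mu>) = (\<integral>y. f y * complex_of_real (p (x \<otimes> y)) \<partial>\<mu>)" .
  have px: "integrable \<mu> (\<lambda>y. p (x \<otimes> y))"
    using integrable_distr[OF measurable_lmult[OF x], of p] p by (simp add: distr_lmult[OF x])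
  have "(\<integral>y. f y * complex_of_real (p (x \<otimes> y)) \<partial>\<mu>) - (\<integral>y. f y * complex_of_real (p y) \<partial>\<mu>)
      = (\<integral>y. f y * complex_of_real (p (x \<otimes> y) - p y) \<partial>\<mu>)"
    using Linf_pairing(1)[OF f px] Linf_pairing(1)[OF f p] by (simp add: right_diff_distrib)
  then show ?thesis using Linf_pairing(2)[OF f, of "\<lambda>y. p (x \<otimes> y) - p y"] px p 1 by simp
qed

text \<open>The functionals \<open>f \<mapsto> \<integral> f p\<close> lie in a compact set of functionals by Tychonoff's theorem, and
  almost invariance gives the finite intersection property for the closed conditions of invariance.\<close>

lemma amenable_of_almost_invariant:
  assumes ai: "\<And>K \<delta>. finite K \<Longrightarrow> K \<subseteq> carrier G \<Longrightarrow> \<delta> > 0 \<Longrightarrow>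
    \<exists>p :: 'a \<Rightarrow> real. integrable \<mu> p \<and> (\<forall>y. 0 \<le> p y) \<and> (\<integral>y. p y \<partial>\<mu>) = 1 \<and>
      (\<forall>x\<in>K. (\<integral>y. \<bar>p (inv x \<otimes> y) - p y\<bar> \<partial>\<mu>) \<le> \<delta>)"
  shows amenable
proof -
  \<comment> \<open>The bound 0 off \<open>Linf\<close> fixes the functional there, so the compact
    product can be indexed by the whole type of functions.\<close>
  define B where "B f = (if f \<in> Linf \<mu> then Linf_norm \<mu> f else 0)" for f
  \<comment> \<open>Each condition is an equation in finitely many coordinates and is therefore
    closed for pointwise convergence.\<close>
  define Lin where "Lin = {\<Lambda> :: ('a \<Rightarrow> complex) \<Rightarrow> complex. \<Lambda> (\<lambda>x. 1) = 1} \<inter>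
    (\<Inter>f\<in>Linf \<mu>. \<Inter>g\<in>Linf \<mu>. {\<Lambda>. \<Lambda> (\<lambda>x. f x + g x) = \<Lambda> f + \<Lambda> g}) \<inter>
    (\<Inter>f\<in>Linf \<mu>. \<Inter>c. {\<Lambda>. \<Lambda> (\<lambda>x. c * f x) = c * \<Lambda> f})"
  have "closed Lin" unfolding Lin_def
    by (intro closed_Int closed_INT ballI closed_Collect_eq continuous_intros continuous_eval)
  define S where "S = {\<Lambda> :: ('a \<Rightarrow> complex) \<Rightarrow> complex. \<forall>f. cmod (\<Lambda> f) \<le> B f} \<inter> Lin"
  have S: "compact S" unfolding S_def by (rule compact_Int_closed[OF compact_functionals \<open>closed Lin\<close>])
  define I where "I = carrier G \<times> Linf \<mu> \<times> {0::real<..}"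
  \<comment> \<open>Invariance is relaxed to an error \<open>\<delta>\<close>, as the functionals at
    hand are only almost invariant; membership for all \<open>\<delta> > 0\<close> restores exact
    invariance at the end.\<close>
  define C where "C = (\<lambda>(x, f, \<delta>). {\<Lambda> :: ('a \<Rightarrow> complex) \<Rightarrow> complex. cmod (\<Lambda> (ltrans G x f) - \<Lambda> f) \<le> \<delta>})"
  have "S \<inter> \<Inter>(C ` I) \<noteq> {}"
  proof (rule compact_imp_fip_image[OF S])
    show "closed (C i)" for i unfolding C_def case_prod_beta
      by (intro closed_Collect_le continuous_intros continuous_eval)
    fix J assume J: "finite J" "J \<subseteq> I"
    \<comment> \<open>Inverses, since moving a translation by \<open>x\<close> onto \<open>p\<close>
      produces \<open>p (x \<otimes> y)\<close>, whereas the hypothesis speaks of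
      \<open>p (inv x \<otimes> y)\<close>.\<close>
    define K where "K = (\<lambda>i. inv (fst i)) ` J"
    \<comment> \<open>The element 1 keeps the minimum defined when \<open>J\<close> is empty, and
      the summand 1 in the denominator covers functions of norm 0.\<close>
    define \<delta> where "\<delta> = Min (insert 1 ((\<lambda>(x, f, d). d / (Linf_norm \<mu> f + 1)) ` J))"
    have Lp: "0 < Linf_norm \<mu> f + 1" if "f \<in> Linf \<mu>" for f using Linf_norm_nonneg[OF that] by simp
    have "\<delta> > 0" unfolding \<delta>_def using J Lp by (subst Min_gr_iff) (auto simp: I_def)
    moreover have "finite K" "K \<subseteq> carrier G" using J by (auto simp: K_def I_def)
    ultimately obtain p :: "'a \<Rightarrow> real" where p: "integrable \<mu> p" "\<And>y. 0 \<le> p y" "(\<integral>y. p y \<partial>\<mu>) = 1"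
      "\<And>x. x \<in> K \<Longrightarrow> (\<integral>y. \<bar>p (inv x \<otimes> y) - p y\<bar> \<partial>\<mu>) \<le> \<delta>" using ai[of K \<delta>] by blast
    define \<Lambda> where "\<Lambda> f = (if f \<in> Linf \<mu> then \<integral>y. f y * complex_of_real (p y) \<partial>\<mu> else 0)" for f
    have "cmod (\<Lambda> f) \<le> B f" for f
      using Linf_pairing(2)[of f, OF _ p(1)] p(2,3) by (simp add: \<Lambda>_def B_def)
    moreover have "\<Lambda> \<in> Lin"
    proof -
      have "\<Lambda> (\<lambda>x. 1) = 1" using p(3) Linf_one by (simp add: \<Lambda>_def integral_complex_of_real)
      moreover have "\<Lambda> (\<lambda>x. f x + g x) = \<Lambda> f + \<Lambda> g" if "f \<in> Linf \<mu>" "g \<in> Linf \<mu>" for f g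
        using that Linf_add[OF that] Linf_pairing(1)[OF _ p(1)] by (simp add: \<Lambda>_def distrib_right)
      moreover have "\<Lambda> (\<lambda>x. c * f x) = c * \<Lambda> f" if "f \<in> Linf \<mu>" for f c
        using that Linf_scale[OF that] by (simp add: \<Lambda>_def mult.assoc)
      ultimately show ?thesis by (auto simp: Lin_def)
    qed
    moreover have "\<Lambda> \<in> C i" if i: "i \<in> J" for i
    proof -
      obtain x f d where xfd: "i = (x, f, d)" by (cases i)
      then have x: "x \<in> carrier G" and f: "f \<in> Linf \<mu>" and d: "d > 0" using i J by (auto simp: I_def)
      have "inv x \<in> K" using i xfd by (force simp: K_def)
      from p(4)[OF this] have "(\<integral>y. \<bar>p (x \<otimes> y) - p y\<bar> \<partial>\<mu>) \<le> \<delta>" using x by simp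
      also have "\<delta> \<le> d / (Linf_norm \<mu> f + 1)"
        unfolding \<delta>_def using J(1) i xfd by (intro Min_le) (auto intro!: image_eqI[of _ _ i])
      finally have le: "(\<integral>y. \<bar>p (x \<otimes> y) - p y\<bar> \<partial>\<mu>) \<le> d / (Linf_norm \<mu> f + 1)" .
      have "cmod (\<Lambda> (ltrans G x f) - \<Lambda> f) \<le> Linf_norm \<mu> f * (\<integral>y. \<bar>p (x \<otimes> y) - p y\<bar> \<partial>\<mu>)"
        using Linf_pairing_ltrans[OF x f p(1)] f Linf_ltrans[OF x f] by (simp add: \<Lambda>_def)
      also have "\<dots> \<le> Linf_norm \<mu> f * (d / (Linf_norm \<mu> f + 1))"
        by (intro mult_left_mono le Linf_norm_nonneg f)
      also have "\<dots> \<le> d" using Lp[OF f] d Linf_norm_nonneg[OF f] by (simp add: field_simps)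
      finally show ?thesis by (simp add: C_def xfd)
    qed
    ultimately have "\<Lambda> \<in> S \<inter> \<Inter>(C ` J)" by (auto simp: S_def)
    then show "S \<inter> \<Inter>(C ` J) \<noteq> {}" by blast
  qed
  then obtain \<Lambda> where \<Lambda>: "\<Lambda> \<in> S" "\<And>i. i \<in> I \<Longrightarrow> \<Lambda> \<in> C i" by blast
  have "\<Lambda> (ltrans G x f) = \<Lambda> f" if x: "x \<in> carrier G" and f: "f \<in> Linf \<mu>" for x f
  proof -
    have "cmod (\<Lambda> (ltrans G x f) - \<Lambda> f) \<le> 0 + d" if "d > 0" for d
      using \<Lambda>(2)[of "(x, f, d)"] x f that by (simp add: I_def C_def)
    then have "cmod (\<Lambda> (ltrans G x f) - \<Lambda> f) \<le> 0" by (rule field_le_epsilon)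
    then show ?thesis by simp
  qed
  moreover have "mean \<mu> \<Lambda>"
    unfolding mean_def
  proof (intro conjI ballI allI)
    fix f assume f: "f \<in> Linf \<mu>"
    have "cmod (\<Lambda> f) \<le> B f" using \<Lambda>(1) by (auto simp: S_def)
    then show "cmod (\<Lambda> f) \<le> Linf_norm \<mu> f" using f by (simp add: B_def)
  qed (use \<Lambda>(1) in \<open>auto simp: S_def Lin_def\<close>)
  ultimately show ?thesis unfolding amenable_def by blast
qed

end

section \<open>Pseudo-amenability implies amenability\<close>

theorem theorem3p1:
  fixes G :: "('a, 'g) monoid_scheme" and T :: "'a topology" and \<mu> :: "'a measure"
    and S :: "('a \<Rightarrow> complex) set set" and N :: "('a \<Rightarrow> complex) set \<Rightarrow> real"
  assumes "locally_compact_group G T"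
    and "left_haar_measure G T \<mu>"
    and "segal_algebra G T \<mu> S N"
    and "banach_algebra.pseudo_amenable (L1_sub G \<mu> S N)"
  shows "left_haar_measure.amenable G \<mu>"
proof -
  interpret segal_algebra G T \<mu> S N by (rule assms(3))
  show ?thesis by (rule amenable_of_almost_invariant) (rule almost_invariant[OF assms(4)])
qed

end
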